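(* $\mathcal A_4\neq\mathcal B_4=\mathcal D_4\neq\mathcal E_4$.
   Context: Let $n=4$ and $N=\{1,2,3,4\}$. Matrices are complex; positive definite (PD) matrices are Hermitian. For an $n\times n$ matrix $A$ and $S\subseteq N$, $A[S]$ is the principal submatrix in rows and columns $S$, with $\det A[\emptyset]=1$. Given finitely many index sets $\alpha_1,\dots,\alpha_p\subseteq N$ and exponents $\eta_1,\dots,\eta_p>0$ put $\alpha(A)=\prod_{i=1}^p(\det A[\alpha_i])^{\eta_i}$. A ratio $\frac{\alpha}{\beta}$ is the function $A\mapsto \alpha(A)/\beta(A)$ on $n\times n$ PD matrices, for two such products $\alpha,\beta$. It is bounded if it has an upper bound independent of the PD matrix $A$, and absolutely bounded if $1$ is such an upper bound; $\mathcal B_n$ is the set of bounded ratios and $\mathcal A_n$ the set of absolutely bounded ratios. The formal logarithm $\log(\frac{\alpha}{\beta})\in\mathbb R^{(2^N)}$ is the vector indexed by the subsets of $N$ whose entry at a nonempty $S$ is the total exponent of $S$ in $\alpha$ minus that in $\beta$, and whose entry at $\emptyset$ is chosen so that all entries sum to $0$; this entry is called the exponent of the subset in the ratio. Ratios are identified when they have the same formal logarithm. A ratio is homogeneous if $\alpha(D)/\beta(D)=1$ for every PD diagonal matrix $D$. For a matrix $M$ with $n$ columns, its nullity type $\operatorname{nul}(M)\in\mathbb R^{(2^N)}$ is the vector whose entry at $T\subseteq N$ is the dimension of the null space of the submatrix of $M$ formed by the columns in $T$ (entry $0$ for $T=\emptyset$). $\mathcal D_n$ is the set of homogeneous ratios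 $\frac{\alpha}{\beta}$ such that $\log(\frac{\alpha}{\beta})^T\nu\ge 0$ for every nullity type $\nu$ of a matrix with $n$ columns. $\mathcal E_n$ is the set of ratios satisfying, for every $S\subseteq N$, both: (ST1) the sum of the exponents in $\frac{\alpha}{\beta}$ of all $T$ with $S\subseteq T\subseteq N$ is nonnegative; and (ST2) the sum of the exponents in $\frac{\alpha}{\beta}$ of all $T\subseteq S$ (including $T=\emptyset$) is nonnegative. *)

theory Defs
  imports
    Complex_Main
    "Jordan_Normal_Form.DL_Submatrix"
    "Jordan_Normal_Form.Matrix_Kernel"
    "Jordan_Normal_Form.Schur_Decomposition"
begin

text \<open>Rows and columns are indexed from 0, so the index set of an \<open>n \<times> n\<close> matrix is
  \<open>{..<n}\<close> in place of \<open>{1, \<dots>, n}\<close>.\<close>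

definition pos_def_mat :: "nat \<Rightarrow> complex mat \<Rightarrow> bool" where
  "pos_def_mat n A \<longleftrightarrow> A \<in> carrier_mat n n \<and> mat_adjoint A = A \<and>
     (\<forall>v \<in> carrier_vec n. v \<noteq> 0\<^sub>v n \<longrightarrow> Re ((A *\<^sub>v v) \<bullet>c v) > 0)"

text \<open>Principal minors of Hermitian matrices are real, so taking the real part loses nothing where
  this is used. The determinant of the empty matrix is 1.\<close>

definition principal_minor :: "complex mat \<Rightarrow> nat set \<Rightarrow> real" where
  "principal_minor A S = Re (det (submatrix A S S))"

text \<open>A formal product of powers of principal minors: the list of its factors, each given by its
  index set and its exponent. Index sets may be repeated.\<close>

type_synonym minor_product = "(nat set \<times> real) list"

definition minor_products :: "nat \<Rightarrow> minor_product set" where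
  "minor_products n = {\<alpha>. \<forall>(S, \<eta>) \<in> set \<alpha>. S \<subseteq> {..<n} \<and> \<eta> > 0}"

definition product_value :: "minor_product \<Rightarrow> complex mat \<Rightarrow> real" where
  "product_value \<alpha> A = (\<Prod>(S, \<eta>)\<leftarrow>\<alpha>. principal_minor A S powr \<eta>)"

definition total_exponent :: "minor_product \<Rightarrow> nat set \<Rightarrow> real" where
  "total_exponent \<alpha> S = (\<Sum>(T, \<eta>)\<leftarrow>\<alpha>. if T = S then \<eta> else 0)"

type_synonym ratio = "minor_product \<times> minor_product"

definition ratios :: "nat \<Rightarrow> ratio set" where
  "ratios n = minor_products n \<times> minor_products n"

definition ratio_value :: "ratio \<Rightarrow> complex mat \<Rightarrow> real" where
  "ratio_value r A = product_value (fst r) A / product_value (snd r) A"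

definition net_exponent :: "ratio \<Rightarrow> nat set \<Rightarrow> real" where
  "net_exponent r S = total_exponent (fst r) S - total_exponent (snd r) S"

definition formal_log :: "nat \<Rightarrow> ratio \<Rightarrow> nat set \<Rightarrow> real" where
  "formal_log n r S =
     (if S = {} then - (\<Sum>T \<in> Pow {..<n} - {{}}. net_exponent r T) else net_exponent r S)"

definition same_ratio :: "nat \<Rightarrow> (ratio \<times> ratio) set" where
  "same_ratio n = {(r, s). r \<in> ratios n \<and> s \<in> ratios n \<and>
     (\<forall>S \<subseteq> {..<n}. formal_log n r S = formal_log n s S)}"

definition bounded_ratio :: "nat \<Rightarrow> ratio \<Rightarrow> bool" where
  "bounded_ratio n r \<longleftrightarrow> (\<exists>C. \<forall>A. pos_def_mat n A \<longrightarrow> ratio_value r A \<le> C)"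

definition absolutely_bounded_ratio :: "nat \<Rightarrow> ratio \<Rightarrow> bool" where
  "absolutely_bounded_ratio n r \<longleftrightarrow> (\<forall>A. pos_def_mat n A \<longrightarrow> ratio_value r A \<le> 1)"

definition homogeneous_ratio :: "nat \<Rightarrow> ratio \<Rightarrow> bool" where
  "homogeneous_ratio n r \<longleftrightarrow>
     (\<forall>D. pos_def_mat n D \<and> diagonal_mat D \<longrightarrow> ratio_value r D = 1)"

definition nullity_type :: "complex mat \<Rightarrow> nat set \<Rightarrow> real" where
  "nullity_type M T = (if T = {} then 0 else real (kernel_dim (submatrix M UNIV T)))"

definition ST1 :: "nat \<Rightarrow> ratio \<Rightarrow> bool" where
  "ST1 n r \<longleftrightarrow>
     (\<forall>S \<subseteq> {..<n}. (\<Sum>T | S \<subseteq> T \<and> T \<subseteq> {..<n}. formal_log n r T) \<ge> 0)"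

definition ST2 :: "nat \<Rightarrow> ratio \<Rightarrow> bool" where
  "ST2 n r \<longleftrightarrow> (\<forall>S \<subseteq> {..<n}. (\<Sum>T \<in> Pow S. formal_log n r T) \<ge> 0)"

text \<open>Ratios with the same formal logarithm are identified, so the following are sets of
  equivalence classes.\<close>

definition \<A> :: "nat \<Rightarrow> ratio set set" where
  "\<A> n = {r \<in> ratios n. absolutely_bounded_ratio n r} // same_ratio n"

definition \<B> :: "nat \<Rightarrow> ratio set set" where
  "\<B> n = {r \<in> ratios n. bounded_ratio n r} // same_ratio n"

definition \<D> :: "nat \<Rightarrow> ratio set set" where
  "\<D> n = {r \<in> ratios n. homogeneous_ratio n r \<and>
     (\<forall>M. dim_col M = n \<longrightarrow>
        (\<Sum>T \<in> Pow {..<n}. formal_log n r T * nullity_type M T) \<ge> 0)} // same_ratio n"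

definition \<E> :: "nat \<Rightarrow> ratio set set" where
  "\<E> n = {r \<in> ratios n. ST1 n r \<and> ST2 n r} // same_ratio n"

end

theory Submission
  imports
    Defs
    "Jordan_Normal_Form.Jordan_Normal_Form_Existence"
    "Jordan_Normal_Form.Jordan_Normal_Form_Uniqueness"
    "HOL-Real_Asymp.Real_Asymp"
begin

text \<open>
  Write \<open>D\<^sub>S\<close> for the principal minor of a positive definite matrix at \<open>S\<close>. The logarithm of a
  ratio at \<open>A\<close> is the pairing of its formal logarithm with \<open>S \<mapsto> ln D\<^sub>S\<close>. Homogeneity says that the
  formal logarithm annihilates modular functions of \<open>S\<close>, so only the deficit \<open>g S = (\<Sum>i\<in>S. ln D\<^sub>i)
  - ln D\<^sub>S\<close> matters, and boundedness of the ratio is a lower bound for the pairing of the formal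
  logarithm with all deficits.

  Bounded ratios lie in \<open>\<D>\<close>: a bounded ratio is invariant under diagonal scaling because its value
  along a one-parameter group of diagonal matrices is an exponential. For a matrix \<open>M\<close> the
  positive definite matrices \<open>M\<^sup>*M + \<epsilon>I\<close> have \<open>D\<^sub>T\<close> equal to \<open>\<epsilon>\<close> to the power of the nullity of the
  columns \<open>T\<close>, times a factor with a positive limit (lemma \<open>principal_minor_gram_mat\<close>), so a
  negative pairing with a nullity type makes the ratio unbounded as \<open>\<epsilon> \<rightarrow> 0\<close>.

  Conversely, for \<open>n = 4\<close> every deficit is within a universal constant of a nonnegative
  combination of nullity types, which gives the lower bound. Two families of inequalities between
  principal minors enter. Koteljanskii's inequality says that \<open>g\<close> is supermodular. The second one
  is the triangle inequality for the sine of the angle between lines: in the numbers \<open>- ln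
  (sin\<^sup>2)\<close>, the smaller two of the three values of a triple agree up to \<open>ln 4\<close>. Both hold for the
  vectors themselves and, by Schur complements, after projection along one of them. Thus the pair
  values \<open>g {i,j}\<close>, and for each \<open>l\<close> the conditional values \<open>g {i,j,l} - g {i,l} - g {j,l}\<close>, form
  an ultrametric up to bounded errors, that is, a rooted tree. There are two shapes of trees on
  four points, and in each of them a few comparisons determine which conical combination of
  nullity types of vector configurations \<open>g\<close> is close to (lemma \<open>near_model_of_ultrametrics\<close>).
  Each nullity type needed is realised by four explicit vectors in a space of dimension at most
  three, and the nullities are read off from the same limit \<open>\<epsilon> \<rightarrow> 0\<close>.

  The inequality \<open>\<A> \<noteq> \<B>\<close> is witnessed by the ratio of Ingleton's inequality, which is bounded by
  the above estimates but exceeds 1 at a small integer matrix. The inequality \<open>\<D> \<noteq> \<E>\<close> is witnessed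
  by the ratio with exponent \<open>(-1)\<close> to the power \<open>|S|\<close> at \<open>S\<close>: the sums in (ST1) and (ST2) are 0
  or 1, but it pairs to \<open>-2\<close> with the nullity type of four vectors in general position in the
  plane.
\<close>

section \<open>Hermitian forms and positive definite matrices\<close>

lemma norm_sum_square:
  fixes N :: "nat \<Rightarrow> nat \<Rightarrow> complex" and v :: "nat \<Rightarrow> complex"
  shows "(\<Sum>i<n. (\<Sum>j<n. (\<Sum>r<m. cnj (N r i) * N r j) * v j) * cnj (v i)) =
     complex_of_real (\<Sum>r<m. (cmod (\<Sum>j<n. N r j * v j))\<^sup>2)"
proof -
  have "(\<Sum>i<n. (\<Sum>j<n. (\<Sum>r<m. cnj (N r i) * N r j) * v j) * cnj (v i))
    = (\<Sum>i<n. \<Sum>j<n. \<Sum>r<m. cnj (N r i * v i) * (N r j * v j))"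
    by (simp add: sum_distrib_left sum_distrib_right mult_ac)
  also have "\<dots> = (\<Sum>i<n. \<Sum>r<m. \<Sum>j<n. cnj (N r i * v i) * (N r j * v j))"
    by (intro sum.cong refl sum.swap)
  also have "\<dots> = (\<Sum>r<m. \<Sum>i<n. \<Sum>j<n. cnj (N r i * v i) * (N r j * v j))"
    by (rule sum.swap)
  also have "\<dots> = (\<Sum>r<m. cnj (\<Sum>j<n. N r j * v j) * (\<Sum>j<n. N r j * v j))"
    by (simp add: sum_product)
  also have "\<dots> = complex_of_real (\<Sum>r<m. (cmod (\<Sum>j<n. N r j * v j))\<^sup>2)"
    by (simp add: complex_norm_square mult.commute del: of_real_power)
  finally show ?thesis .
qed

text \<open>The matrix \<open>N\<^sup>*N + \<epsilon>I\<close>.\<close>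
definition gram_mat :: "complex mat \<Rightarrow> real \<Rightarrow> complex mat" where
  "gram_mat N \<epsilon> = mat (dim_col N) (dim_col N)
     (\<lambda>(i, j). (\<Sum>r<dim_row N. cnj (N $$ (r, i)) * N $$ (r, j)) + (if i
         = j then of_real \<epsilon> else 0))"

lemma gram_mat_carrier [simp]: "gram_mat N \<epsilon> \<in> carrier_mat (dim_col N) (dim_col N)"
  and gram_mat_dim [simp]: "dim_row (gram_mat N \<epsilon>) = dim_col N"
      "dim_col (gram_mat N \<epsilon>) = dim_col N"
  and gram_mat_index: "i < dim_col N \<Longrightarrow> j < dim_col N \<Longrightarrow>
    gram_mat N \<epsilon> $$ (i, j) = (\<Sum>r<dim_row N. cnj (N $$ (r, i)) * N $$ (r, j)) + (if i
        = j then of_real \<epsilon> else 0)"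
  by (auto simp: gram_mat_def)

lemma mat_mult_vec_index:
  "A \<in> carrier_mat m n \<Longrightarrow> v \<in> carrier_vec n \<Longrightarrow> i < m \<Longrightarrow> (A *\<^sub>v v) $ i = (\<Sum>j<n. A $$ (i, j) * v $ j)"
  by (simp add: scalar_prod_def lessThan_atLeast0)

lemma quadratic_form_expand:
  assumes "A \<in> carrier_mat n n" "v \<in> carrier_vec n"
  shows "(A *\<^sub>v v) \<bullet>c v = (\<Sum>i<n. (\<Sum>j<n. A $$ (i, j) * v $ j) * cnj (v $ i))"
  using assms by (simp add: scalar_prod_def lessThan_atLeast0 )

text \<open>The form is \<open>|N v|\<^sup>2 + \<epsilon> |v|\<^sup>2\<close>, which is positive for \<open>\<epsilon> > 0\<close> and at \<open>\<epsilon> = 0\<close> vanishes only on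
  the kernel of \<open>N\<close>.\<close>
lemma gram_form:
  fixes v :: "complex vec"
  assumes "v \<in> carrier_vec (dim_col N)"
  shows "(gram_mat N \<epsilon> *\<^sub>v v) \<bullet>c v =
    complex_of_real ((\<Sum>r<dim_row N. (cmod (\<Sum>j<dim_col N. N $$ (r, j) * v $ j))\<^sup>2)
      + \<epsilon> * (\<Sum>i<dim_col N. (cmod (v $ i))\<^sup>2))"
proof -
  let ?n = "dim_col N"
  let ?G = "\<lambda>i j. \<Sum>r<dim_row N. cnj (N $$ (r, i)) * N $$ (r, j)"
  have "(gram_mat N \<epsilon> *\<^sub>v v) \<bullet>c v = (\<Sum>i<?n. (\<Sum>j<?n. (?G i j + (if i
      = j then of_real \<epsilon> else 0)) * v $ j) * cnj (v $ i))"
    by (simp add: quadratic_form_expand[OF gram_mat_carrier assms] gram_mat_index)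
  also have "\<dots> = (\<Sum>i<?n. (\<Sum>j<?n. ?G i j * v $ j) * cnj (v $ i))
      + (\<Sum>i<?n. of_real \<epsilon> * v $ i * cnj (v $ i))"
    by (simp add: distrib_right sum.distrib if_distrib[of "\<lambda>x. x * _"] cong: if_cong)
  also have "(\<Sum>i<?n. of_real \<epsilon> * v $ i * cnj (v $ i))
      = complex_of_real (\<epsilon> * (\<Sum>i<?n. (cmod (v $ i))\<^sup>2))"
    by (simp add: complex_norm_square sum_distrib_left mult.assoc del: of_real_power)
  finally show ?thesis by (simp add: norm_sum_square)
qed

lemma vec_norm_pos:
  fixes v :: "complex vec"
  assumes "v \<in> carrier_vec n" "v \<noteq> 0\<^sub>v n"
  shows "(\<Sum>i<n. (cmod (v $ i))\<^sup>2) > 0"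
proof -
  obtain i where "i < n" "v $ i \<noteq> 0" using assms by (metis eq_vecI carrier_vecD index_zero_vec)
  then show ?thesis by (intro sum_pos2[of _ i]) auto
qed

lemma mat_adjoint_index:
  "A \<in> carrier_mat n n \<Longrightarrow> i < n \<Longrightarrow> j < n \<Longrightarrow> mat_adjoint A $$ (i, j) = cnj (A $$ (j, i))"
  by (simp add: mat_adjoint_def mat_of_rows_index)

lemma mat_adjoint_eqI:
  assumes A: "A \<in> carrier_mat n n" and sym: "\<And>i j. i < n \<Longrightarrow> j < n \<Longrightarrow>
      A $$ (i, j) = cnj (A $$ (j, i))"
  shows "mat_adjoint A = A"
proof (rule eq_matI)
  fix i j assume "i < dim_row A" "j < dim_col A"
  then have ij: "i < n" "j < n" using A by auto
  show "mat_adjoint A $$ (i, j) = A $$ (i, j)" using mat_adjoint_index[OF A ij] sym[OF ij] by simp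
qed (use A in \<open>auto simp: mat_adjoint_def\<close>)

lemma mat_adjoint_eqD:
  assumes "A \<in> carrier_mat n n" "mat_adjoint A = A" "i < n" "j < n"
  shows "A $$ (i, j) = cnj (A $$ (j, i))"
  using mat_adjoint_index[OF assms(1,3,4)] assms(2) by simp

lemma gram_mat_pos_def:
  assumes "\<epsilon> > 0" shows "pos_def_mat (dim_col N) (gram_mat N \<epsilon>)"
  unfolding pos_def_mat_def
proof (intro conjI ballI impI)
  show "mat_adjoint (gram_mat N \<epsilon>) = gram_mat N \<epsilon>"
    by (rule mat_adjoint_eqI[OF gram_mat_carrier]) (auto simp: gram_mat_index cnj_sum
        mult.commute)
  fix v :: "complex vec" assume v: "v \<in> carrier_vec (dim_col N)" "v \<noteq> 0\<^sub>v (dim_col N)"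
  have "0 \<le> (\<Sum>r<dim_row N. (cmod (\<Sum>j<dim_col N. N $$ (r, j) * v $ j))\<^sup>2)"
      by (intro sum_nonneg) auto
  from add_nonneg_pos[OF this mult_pos_pos[OF assms vec_norm_pos[OF v]]]
  show "0 < Re ((gram_mat N \<epsilon> *\<^sub>v v) \<bullet>c v)"
    by (simp only: gram_form[OF v(1)] Re_complex_of_real)
qed simp

text \<open>The left-hand side is, up to the sign \<open>(-1)\<^sup>n\<close>, the characteristic polynomial at \<open>-x\<close>.\<close>
lemma det_shift_factorization:
  assumes A: "(A :: complex mat) \<in> carrier_mat n n" and as: "char_poly A = (\<Prod>a\<leftarrow>as. [:- a, 1:])"
  shows "det (A + x \<cdot>\<^sub>m 1\<^sub>m n) = (\<Prod>a\<leftarrow>as. a + x)"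
proof -
  have len: "length as = n"
    using degree_monic_char_poly[OF A] as by (simp add: degree_linear_factors)
  have "char_matrix A (-x) = A + x \<cdot>\<^sub>m 1\<^sub>m n" using A by (simp add: char_matrix_def)
  then have "poly (char_poly A) (-x) = det (- (A + x \<cdot>\<^sub>m 1\<^sub>m n))"
    using char_poly_matrix[OF A, of "-x"] by simp
  also have "- (A + x \<cdot>\<^sub>m 1\<^sub>m n) = (-1) \<cdot>\<^sub>m (A + x \<cdot>\<^sub>m 1\<^sub>m n)" using A by (intro eq_matI) auto
  also have "det \<dots> = (-1)^n * det (A + x \<cdot>\<^sub>m 1\<^sub>m n)" using A by (subst det_smult) simp
  finally have 1: "(-1)^n * det (A + x \<cdot>\<^sub>m 1\<^sub>m n) = poly (char_poly A) (-x)" by simp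
  have "poly (\<Prod>a\<leftarrow>as. [:- a, 1:]) (-x) = (-1)^length as * (\<Prod>a\<leftarrow>as. a + x)"
    by (induction as) (auto simp: algebra_simps)
  then have "(-1)^n * det (A + x \<cdot>\<^sub>m 1\<^sub>m n) = (-1)^n * (\<Prod>a\<leftarrow>as. a + x)" using 1 as len by simp
  then show ?thesis by simp
qed

lemma eigenvalue_of_root:
  assumes A: "(A :: complex mat) \<in> carrier_mat n n" and as: "char_poly A = (\<Prod>a\<leftarrow>as. [:- a, 1:])"
      and a: "a \<in> set as"
  obtains v where "v \<in> carrier_vec n" "v \<noteq> 0\<^sub>v n"
      "(A *\<^sub>v v) \<bullet>c v = a * complex_of_real (\<Sum>i<n. (cmod (v $ i))\<^sup>2)"
proof -
  have "poly (char_poly A) a = 0" using a unfolding as by (induction as) auto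
  then obtain v where v: "v \<in> carrier_vec n" "v \<noteq> 0\<^sub>v n" "A *\<^sub>v v = a \<cdot>\<^sub>v v"
    using eigenvalue_root_char_poly[OF A] A unfolding eigenvalue_def eigenvector_def by auto
  have "(A *\<^sub>v v) \<bullet>c v = a * (v \<bullet>c v)" using v by simp
  also have "v \<bullet>c v = complex_of_real (\<Sum>i<n. (cmod (v $ i))\<^sup>2)"
    using v(1) by (simp add: scalar_prod_def lessThan_atLeast0 complex_norm_square del:
        of_real_power)
  finally show ?thesis using v that by blast
qed

text \<open>The determinant is the product of the eigenvalues, each of which is a quotient of two
  positive values of Hermitian forms at an eigenvector.\<close>
lemma pos_def_det_pos:
  assumes "pos_def_mat n A"
  shows "Re (det A) > 0"
proof -
  have A: "A \<in> carrier_mat n n" using assms by (simp add: pos_def_mat_def)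
  obtain as where as: "char_poly A = (\<Prod>a\<leftarrow>as. [:- a, 1:])" using char_poly_factorized[OF A]
      by blast
  have pos: "\<exists>r>0. a = complex_of_real r" if a: "a \<in> set as" for a
  proof -
    obtain v where v: "v \<in> carrier_vec n" "v \<noteq> 0\<^sub>v n"
        "(A *\<^sub>v v) \<bullet>c v = a * complex_of_real (\<Sum>i<n. (cmod (v $ i))\<^sup>2)"
      using eigenvalue_of_root[OF A as a] by blast
    have herm: "cnj (A $$ (i, j)) = A $$ (j, i)" if "i < n" "j < n" for i j
      using assms mat_adjoint_eqD[OF A _ that(2,1)] by (simp add: pos_def_mat_def)
    let ?q = "(A *\<^sub>v v) \<bullet>c v"
    have "cnj ?q = (\<Sum>i<n. \<Sum>j<n. cnj (A $$ (i, j)) * cnj (v $ j) * v $ i)"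
      by (simp add: quadratic_form_expand[OF A v(1)] cnj_sum sum_distrib_right)
    also have "\<dots> = (\<Sum>j<n. \<Sum>i<n. cnj (A $$ (i, j)) * cnj (v $ j) * v $ i)" by (rule sum.swap)
    also have "\<dots> = (\<Sum>j<n. \<Sum>i<n. A $$ (j, i) * cnj (v $ j) * v $ i)"
      using herm by (intro sum.cong refl) simp
    also have "\<dots> = ?q" by (simp add: quadratic_form_expand[OF A v(1)] sum_distrib_left
        sum_distrib_right mult_ac)
    finally have "Im ?q = 0" by (metis Reals_cnj_iff complex_is_Real_iff)
    moreover have "Re ?q > 0" using assms v by (auto simp: pos_def_mat_def)
    ultimately have "Re a > 0 \<and> Im a = 0"
      using vec_norm_pos[OF v(1,2)] v(3)
          by (simp add: zero_less_mult_iff del: of_real_sum of_real_power)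
    then show ?thesis by (intro exI[of _ "Re a"]) (auto simp: complex_eq_iff)
  qed
  have "A + 0 \<cdot>\<^sub>m 1\<^sub>m n = A" using A by (intro eq_matI) auto
  then have "det A = prod_list as"
    using det_shift_factorization[OF A as, of 0] by simp
  moreover have "\<exists>r>0. prod_list bs = complex_of_real r"
      if "\<forall>b\<in>set bs. \<exists>r>0. b = complex_of_real r" for bs
    using that
  proof (induction bs)
    case Nil
    have "prod_list [] = complex_of_real 1" by simp
    then show ?case by (intro exI[of _ 1]) simp
  next
    case (Cons b bs)
    obtain r where r: "r > 0" "prod_list bs = complex_of_real r" using Cons.IH Cons.prems by auto
    obtain s where s: "s > 0" "b = complex_of_real s" using Cons.prems by auto
    have "prod_list (b # bs) = complex_of_real (s * r)" using r s by simp
    then show ?case using r s by (intro exI[of _ "s * r"]) simp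
  qed
  ultimately obtain r where "r > 0" "det A = complex_of_real r" using pos by metis
  then show ?thesis by simp
qed

section \<open>Principal submatrices\<close>

lemma card_restrict: "T \<subseteq> {..<n::nat} \<Longrightarrow> {i. i < n \<and> i \<in> T} = T"
  by auto

lemma pick_bij_betw: "finite T \<Longrightarrow> bij_betw (pick T) {..<card T} T"
proof (rule bij_betw_imageI)
  assume "finite T"
  show "inj_on (pick T) {..<card T}"

  proof (rule inj_onI)
    fix x y assume xy: "x \<in> {..<card T}" "y \<in> {..<card T}" "pick T x = pick T y"
    show "x = y"
      using xy pick_mono[of x T y] pick_mono[of y T x] by (cases x y rule: linorder_cases) auto
  qed
  show "pick T ` {..<card T} = T"
  proof
    show "pick T ` {..<card T} \<subseteq> T" using pick_in_set by auto
    show "T \<subseteq> pick T ` {..<card T}"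
    proof
      fix i assume i: "i \<in> T"
      have "{a \<in> T. a < i} \<subset> T" using i by auto
      then have "card {a \<in> T. a < i} < card T" using \<open>finite T\<close> by (simp add: psubset_card_mono)
      then show "i \<in> pick T ` {..<card T}" using pick_card_in_set[OF i]
          by (intro image_eqI[where x = "card {a \<in> T. a < i}"]) simp_all
    qed
  qed
qed

lemma submatrix_principal_carrier:
  "A \<in> carrier_mat n n \<Longrightarrow> S \<subseteq> {..<n} \<Longrightarrow> submatrix A S S \<in> carrier_mat (card S) (card S)"
  by (auto simp: dim_submatrix card_restrict)

lemma pick_lt: "S \<subseteq> {..<n} \<Longrightarrow> i < card S \<Longrightarrow> pick S i < n"
  using pick_in_set by (metis lessThan_iff subsetD)

text \<open>A vector on \<open>S\<close> extended by zero turns the form of the submatrix into a value of the form of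
  \<open>A\<close>.\<close>
lemma pos_def_submatrix:
  assumes pd: "pos_def_mat n A" and S: "S \<subseteq> {..<n}"
  shows "pos_def_mat (card S) (submatrix A S S)"
  unfolding pos_def_mat_def
proof (intro conjI ballI impI)
  have A: "A \<in> carrier_mat n n" and adj: "mat_adjoint A = A" using pd
      by (auto simp: pos_def_mat_def)
  have fin: "finite S" using S finite_subset by auto
  let ?B = "submatrix A S S" and ?k = "card S"
  show B: "?B \<in> carrier_mat ?k ?k" by (rule submatrix_principal_carrier[OF A S])
  have ind: "?B $$ (i, j) = A $$ (pick S i, pick S j)" if "i < ?k" "j < ?k" for i j
    using that A S by (intro submatrix_index) (auto simp: card_restrict)
  show "mat_adjoint ?B = ?B"
  proof (rule mat_adjoint_eqI[OF B])
    fix i j assume "i < ?k" "j < ?k"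
    then show "?B $$ (i, j) = cnj (?B $$ (j, i))"
      unfolding ind[OF \<open>i < ?k\<close> \<open>j < ?k\<close>] ind[OF \<open>j < ?k\<close> \<open>i < ?k\<close>]
      by (intro mat_adjoint_eqD[OF A adj] pick_lt[OF S])
  qed
  fix v :: "complex vec" assume v: "v \<in> carrier_vec ?k" "v \<noteq> 0\<^sub>v ?k"
  note bij = pick_bij_betw[OF fin]
  define w where "w = vec n (\<lambda>i. if i \<in> S then v $ (inv_into {..<?k} (pick S) i) else 0)"
  have w: "w \<in> carrier_vec n" by (simp add: w_def)
  have wv: "w $ pick S i = v $ i" if "i < ?k" for i
  proof -
    have "pick S i \<in> S" using that bij by (auto simp: bij_betw_def)
    then show ?thesis
      using that bij pick_lt[OF S that] by (simp add: w_def bij_betw_def inv_into_f_f)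
  qed
  obtain i where i: "i < ?k" "v $ i \<noteq> 0" using v by (metis eq_vecI carrier_vecD index_zero_vec)
  then have "w $ pick S i \<noteq> 0" by (simp add: wv)
  then have w0: "w \<noteq> 0\<^sub>v n" using pick_lt[OF S i(1)] by auto
  have restr: "(\<Sum>i<n. f i) = (\<Sum>i<?k. f (pick S i))" if "\<And>i. i < n \<Longrightarrow> i \<notin> S \<Longrightarrow> f i = 0"
      for f :: "nat \<Rightarrow> complex"
  proof -
    have "(\<Sum>i<n. f i) = (\<Sum>i\<in>S. f i)" using that S by (intro sum.mono_neutral_right) auto
    also have "\<dots> = (\<Sum>i<?k. f (pick S i))" by (rule sum.reindex_bij_betw[OF bij, symmetric])
    finally show ?thesis .
  qed
  have out: "w $ i = 0" if "i < n" "i \<notin> S" for i using that by (simp add: w_def)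
  have "(A *\<^sub>v w) \<bullet>c w = (\<Sum>i<n. (\<Sum>j<n. A $$ (i, j) * w $ j) * cnj (w $ i))"
    by (rule quadratic_form_expand[OF A w])
  also have "\<dots> = (\<Sum>i<?k. (\<Sum>j<?k. A $$ (pick S i, pick S j) * w $ (pick S j)) * cnj (w $ pick S
      i))"
    using out by (simp add: restr)
  also have "\<dots> = (\<Sum>i<?k. (\<Sum>j<?k. ?B $$ (i, j) * v $ j) * cnj (v $ i))"
    by (simp add: ind wv)
  also have "\<dots> = (?B *\<^sub>v v) \<bullet>c v" by (rule quadratic_form_expand[OF B v(1), symmetric])
  finally show "0 < Re ((?B *\<^sub>v v) \<bullet>c v)" using pd w w0 by (auto simp: pos_def_mat_def)
qed

lemma principal_minor_pos: "pos_def_mat n A \<Longrightarrow> S \<subseteq> {..<n} \<Longrightarrow> principal_minor A S > 0"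
  unfolding principal_minor_def by (rule pos_def_det_pos[OF pos_def_submatrix])

section \<open>Principal minors of Gram matrices and nullities\<close>

lemma submatrix_gram_mat:
  assumes T: "T \<subseteq> {..<dim_col M}"
  shows "submatrix (gram_mat M \<epsilon>) T T = gram_mat (submatrix M UNIV T) \<epsilon>"
proof (rule eq_matI)
  have fin: "finite T" using T finite_subset by auto
  let ?N = "submatrix M UNIV T"
  have dims: "dim_row ?N = dim_row M" "dim_col ?N = card T" using T
      by (simp_all add: dim_submatrix card_restrict)
  fix i j assume "i < dim_row (gram_mat ?N \<epsilon>)" "j < dim_col (gram_mat ?N \<epsilon>)"
  then have ij: "i < card T" "j < card T" by (simp_all add: dims)
  have N: "?N $$ (r, i) = M $$ (r, pick T i)" if "r < dim_row M" "i < card T" for r i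
    using that T by (subst submatrix_index) (auto simp: card_restrict pick_UNIV)
  have "submatrix (gram_mat M \<epsilon>) T T $$ (i, j) = gram_mat M \<epsilon> $$ (pick T i, pick T j)"
    using ij T by (intro submatrix_index) (auto simp: card_restrict)
  also have "\<dots> = gram_mat ?N \<epsilon> $$ (i, j)"
    using ij pick_lt[OF T] bij_betw_imp_inj_on[OF pick_bij_betw[OF fin]]
    by (auto simp: gram_mat_index dims N inj_on_eq_iff)
  finally show "submatrix (gram_mat M \<epsilon>) T T $$ (i, j) = gram_mat ?N \<epsilon> $$ (i, j)" .
qed (use T in \<open>auto simp: dim_submatrix card_restrict\<close>)

lemma gram_mat_mult_vec:
  assumes v: "v \<in> carrier_vec (dim_col N)" and i: "i < dim_col N"
  shows "(gram_mat N 0 *\<^sub>v v) $ i = (\<Sum>r<dim_row N. cnj (N $$ (r, i)) * (N *\<^sub>v v) $ r)"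
proof -
  have "(gram_mat N 0 *\<^sub>v v) $ i = (\<Sum>j<dim_col N. \<Sum>r<dim_row N. cnj (N $$ (r, i)) * N $$ (r, j) * v
      $ j)"
    by (simp add: mat_mult_vec_index[OF gram_mat_carrier v i] gram_mat_index i sum_distrib_right
        cong: if_cong)
  also have "\<dots> = (\<Sum>r<dim_row N. \<Sum>j<dim_col N. cnj (N $$ (r, i)) * N $$ (r, j) * v $ j)"
      by (rule sum.swap)
  also have "\<dots> = (\<Sum>r<dim_row N. cnj (N $$ (r, i)) * (N *\<^sub>v v) $ r)"
    by (intro sum.cong refl, subst mat_mult_vec_index[of N "dim_row N" "dim_col N"]) (use v in
        \<open>auto simp: sum_distrib_left mult_ac\<close>)
  finally show ?thesis .
qed

lemma kernel_gram_mat: "mat_kernel (gram_mat N 0) = mat_kernel N"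
proof (intro equalityI subsetI)
  fix v assume v: "v \<in> mat_kernel (gram_mat N 0)"
  then have c: "v \<in> carrier_vec (dim_col N)" and z: "gram_mat N 0 *\<^sub>v v = 0\<^sub>v (dim_col N)"
      by (auto simp: mat_kernel_def)
  have "(gram_mat N 0 *\<^sub>v v) \<bullet>c v = 0" unfolding z using c by simp
  then have "complex_of_real (\<Sum>r<dim_row N. (cmod (\<Sum>j<dim_col N. N $$ (r, j) * v $ j))\<^sup>2)
      = complex_of_real 0"
    unfolding gram_form[OF c] by (simp only: mult_zero_left add_0_right of_real_0)
  then have "(\<Sum>r<dim_row N. (cmod (\<Sum>j<dim_col N. N $$ (r, j) * v $ j))\<^sup>2) = 0"
      by (simp only: of_real_eq_iff)
  then have "\<forall>r<dim_row N. (\<Sum>j<dim_col N. N $$ (r, j) * v $ j) = 0"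
    by (subst (asm) sum_nonneg_eq_0_iff) auto
  then have "N *\<^sub>v v = 0\<^sub>v (dim_row N)"
    by (intro eq_vecI) (auto simp: mat_mult_vec_index[OF _ c, of N "dim_row N"] simp del:
        index_mult_mat_vec)
  then show "v \<in> mat_kernel N" using c by (simp add: mat_kernel_def)
next
  fix v assume v: "v \<in> mat_kernel N"
  then have c: "v \<in> carrier_vec (dim_col N)" and z: "N *\<^sub>v v = 0\<^sub>v (dim_row N)"
      by (auto simp: mat_kernel_def)
  have "gram_mat N 0 *\<^sub>v v = 0\<^sub>v (dim_col N)"
  proof (rule eq_vecI)
    fix i assume "i < dim_vec (0\<^sub>v (dim_col N) :: complex vec)"
    then have i: "i < dim_col N" by simp
    show "(gram_mat N 0 *\<^sub>v v) $ i = 0\<^sub>v (dim_col N) $ i" unfolding gram_mat_mult_vec[OF c i] z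
        using i by simp
  qed simp
  then show "v \<in> mat_kernel (gram_mat N 0)" using c by (simp add: mat_kernel_def)
qed

text \<open>With \<open>kernel_gram_mat\<close> this says that 0 is a semisimple eigenvalue of \<open>N\<^sup>*N\<close>, so that its
  algebraic multiplicity is the nullity of \<open>N\<close>.\<close>
lemma kernel_gram_mat_square: "mat_kernel (gram_mat N 0 * gram_mat N 0)
    = mat_kernel (gram_mat N 0)"
proof
  let ?B = "gram_mat N 0" and ?n = "dim_col N"
  note B = gram_mat_carrier[of N 0]
  show "mat_kernel ?B \<subseteq> mat_kernel (?B * ?B)" by (rule mat_kernel_mult_subset[OF B B])
  show "mat_kernel (?B * ?B) \<subseteq> mat_kernel ?B"
  proof
    fix v assume v: "v \<in> mat_kernel (?B * ?B)"
    then have c: "v \<in> carrier_vec ?n" by (simp add: mat_kernel_def)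
    define w where "w = ?B *\<^sub>v v"
    have wc: "w \<in> carrier_vec ?n" using mult_mat_vec_carrier[OF B c] by (simp add: w_def)
    have "?B *\<^sub>v w = 0\<^sub>v ?n" unfolding w_def using v c B
        by (simp add: mat_kernel_def assoc_mult_mat_vec)
    then have "w \<in> mat_kernel N" using wc kernel_gram_mat[of N] by (auto simp: mat_kernel_def)
    then have Nw: "N *\<^sub>v w = 0\<^sub>v (dim_row N)" by (simp add: mat_kernel_def)
    \<comment> \<open>\<open>w = N\<^sup>* (N v)\<close> is orthogonal to the kernel of \<open>N\<close>, which contains \<open>w\<close>.\<close>
    have "(\<Sum>i<?n. w $ i * cnj (w $ i)) = (\<Sum>i<?n. \<Sum>r<dim_row N. cnj (N $$ (r, i)) * (N *\<^sub>v v) $ r *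
        cnj (w $ i))"
    proof (intro sum.cong refl)
      fix i assume "i \<in> {..<?n}"
      then have "w $ i = (\<Sum>r<dim_row N. cnj (N $$ (r, i)) * (N *\<^sub>v v) $ r)"
        unfolding w_def by (intro gram_mat_mult_vec[OF c]) simp
      then have "w $ i * cnj (w $ i) = (\<Sum>r<dim_row N. cnj (N $$ (r, i)) * (N *\<^sub>v v) $ r) * cnj (w $
          i)"
        by (rule arg_cong[where f = "\<lambda>x. x * cnj (w $ i)"])
      then show "w $ i * cnj (w $ i) = (\<Sum>r<dim_row N. cnj (N $$ (r, i)) * (N *\<^sub>v v) $ r * cnj (w $
          i))"
        by (simp only: sum_distrib_right)
    qed
    also have "\<dots> = (\<Sum>r<dim_row N. \<Sum>i<?n. cnj (N $$ (r, i)) * (N *\<^sub>v v) $ r * cnj (w $ i))"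
        by (rule sum.swap)
    also have "\<dots> = (\<Sum>r<dim_row N. (N *\<^sub>v v) $ r * cnj ((N *\<^sub>v w) $ r))"
    proof (intro sum.cong refl)
      fix r assume "r \<in> {..<dim_row N}"
      then have "(N *\<^sub>v w) $ r = (\<Sum>i<?n. N $$ (r, i) * w $ i)"
          by (intro mat_mult_vec_index[OF _ wc, of N "dim_row N"]) auto
      then show "(\<Sum>i<?n. cnj (N $$ (r, i)) * (N *\<^sub>v v) $ r * cnj (w $ i))
          = (N *\<^sub>v v) $ r * cnj ((N *\<^sub>v w) $ r)"
        by (simp add: sum_distrib_left mult_ac del: index_mult_mat_vec)
    qed
    also have "\<dots> = 0" unfolding Nw by simp
    finally have "(\<Sum>i<?n. w $ i * cnj (w $ i)) = 0" .
    then have "complex_of_real (\<Sum>i<?n. (cmod (w $ i))\<^sup>2) = 0"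
        by (simp add: complex_norm_square del: of_real_power)
    then have "w = 0\<^sub>v ?n" using vec_norm_pos[OF wc] by (metis less_irrefl of_real_eq_0_iff)
    then show "v \<in> mat_kernel ?B" using c by (simp add: mat_kernel_def w_def)
  qed
qed

lemma kernel_dim_cong: "dim_col A = dim_col B \<Longrightarrow> mat_kernel A = mat_kernel B \<Longrightarrow>
    kernel_dim A = kernel_dim B"
  unfolding kernel_dim_def by simp

text \<open>If \<open>ns\<close> are the sizes of the Jordan blocks of an eigenvalue, the two sums are the dimensions
  of the kernels of the second and the first power; their equality means that all blocks have size
  at most one.\<close>
lemma sum_list_min:
  fixes ns :: "nat list"
  assumes "(\<Sum>n\<leftarrow>ns. min 2 n) = (\<Sum>n\<leftarrow>ns. min 1 n)"
  shows "(\<Sum>n\<leftarrow>ns. min 1 n) = sum_list ns"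
  using assms
proof (induction ns)
  case (Cons a ns)
  have "(\<Sum>n\<leftarrow>ns. min 1 n) \<le> (\<Sum>n\<leftarrow>ns. min 2 n)" by (intro sum_list_mono) auto
  then have "min 2 a = min 1 a" "(\<Sum>n\<leftarrow>ns. min 2 n) = (\<Sum>n\<leftarrow>ns. min 1 n)" using Cons.prems by auto
  then show ?case using Cons.IH by auto
qed simp

text \<open>The numbers \<open>es\<close> are the nonzero eigenvalues of \<open>N\<^sup>*N\<close>. The eigenvalue 0 contributes one
  factor \<open>\<epsilon>\<close> for each dimension of the kernel, since its Jordan blocks are trivial.\<close>
lemma det_gram_mat:
  obtains es where "\<forall>e\<in>set es. e > 0"
    "\<And>\<epsilon>. det (gram_mat N \<epsilon>) = complex_of_real (\<epsilon> ^ kernel_dim N * (\<Prod>e\<leftarrow>es. e + \<epsilon>))"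
proof -
  let ?B = "gram_mat N 0" and ?n = "dim_col N"
  note B = gram_mat_carrier[of N 0]
  obtain bs where "char_poly ?B = (\<Prod>a\<leftarrow>bs. [:- a, 1:])" using char_poly_factorized[OF B] by blast
  then obtain n_as where jnf: "jordan_nf ?B n_as" using jordan_nf_exists[OF B] by blast
  define as where "as = concat (map (\<lambda>(n, a). replicate n a) n_as)"
  have "(\<Prod>a\<leftarrow>as. [:- a, 1:]) = (\<Prod>(n, a)\<leftarrow>n_as. [:- a, 1:] ^ n)"
    unfolding as_def by (induction n_as) (auto simp: prod_list_replicate)
  then have as: "char_poly ?B = (\<Prod>a\<leftarrow>as. [:- a, 1:])" using jordan_nf_char_poly[OF jnf] by simp
  have real: "\<exists>r\<ge>0. a = complex_of_real r" if a: "a \<in> set as" for a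
  proof -
    obtain v where v: "v \<in> carrier_vec ?n" "v \<noteq> 0\<^sub>v ?n"
        "(?B *\<^sub>v v) \<bullet>c v = a * complex_of_real (\<Sum>i<?n. (cmod (v $ i))\<^sup>2)"
      using eigenvalue_of_root[OF B as a] by blast
    define s where "s = (\<Sum>r<dim_row N. (cmod (\<Sum>j<dim_col N. N $$ (r, j) * v $ j))\<^sup>2)"
    define t where "t = (\<Sum>i<?n. (cmod (v $ i))\<^sup>2)"
    have "s \<ge> 0" unfolding s_def by (intro sum_nonneg) auto
    have "t > 0" unfolding t_def by (rule vec_norm_pos[OF v(1,2)])
    have "complex_of_real s = a * complex_of_real t"
      using v(3) unfolding gram_form[OF v(1)] s_def[symmetric] t_def[symmetric] by simp
    then have "a = complex_of_real (s / t)" using \<open>t > 0\<close> by (simp add: field_simps)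
    then show ?thesis using \<open>s \<ge> 0\<close> \<open>t > 0\<close> by (intro exI[of _ "s / t"]) simp
  qed
  define ns where "ns = map fst [(n, e)\<leftarrow>n_as . e = 0]"
  have cm: "char_matrix ?B 0 = ?B" unfolding char_matrix_def by (intro eq_matI) auto
  have k: "kernel_dim (?B ^\<^sub>m k) = (\<Sum>n\<leftarrow>ns. min k n)" for k
    using dim_gen_eigenspace[OF jnf, of 0 k] unfolding dim_gen_eigenspace_def cm ns_def .
  have k1: "kernel_dim N = (\<Sum>n\<leftarrow>ns. min 1 n)"
    unfolding k[symmetric] by (rule kernel_dim_cong) (simp_all add: kernel_gram_mat)
  have "?B ^\<^sub>m 2 = ?B * ?B" by (simp add: numeral_2_eq_2)
  then have "kernel_dim N = (\<Sum>n\<leftarrow>ns. min 2 n)"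
    unfolding k[symmetric] by (intro kernel_dim_cong) (simp_all add: kernel_gram_mat_square
        kernel_gram_mat)
  then have "(\<Sum>n\<leftarrow>ns. min 2 n) = (\<Sum>n\<leftarrow>ns. min 1 n)" using k1 by metis
  then have kd: "kernel_dim N = sum_list ns" unfolding k1 by (rule sum_list_min)
  have len: "length (filter (\<lambda>a. a = 0) as) = sum_list ns"
    unfolding as_def ns_def by (induction n_as) (auto simp: filter_replicate)
  have split: "(\<Prod>a\<leftarrow>as. a + x) = x ^ length (filter (\<lambda>a. a
      = 0) as) * (\<Prod>a\<leftarrow>filter (\<lambda>a. a \<noteq> 0) as. a + x)" for x :: complex
    by (induction as) auto
  define es where "es = map Re (filter (\<lambda>a. a \<noteq> 0) as)"
  have "filter (\<lambda>a. a \<noteq> 0) as = map complex_of_real es"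
    unfolding es_def map_map by (rule map_idI[symmetric]) (use real in force)
  show ?thesis
  proof
    show "\<forall>e\<in>set es. e > 0" using real by (fastforce simp: es_def)
    fix \<epsilon>
    have "gram_mat N \<epsilon> = ?B + complex_of_real \<epsilon> \<cdot>\<^sub>m 1\<^sub>m ?n"
      by (rule eq_matI) (auto simp: gram_mat_index)
    then have "det (gram_mat N \<epsilon>) = (\<Prod>a\<leftarrow>as. a + complex_of_real \<epsilon>)"
      using det_shift_factorization[OF B as] by simp
    also have "\<dots> = complex_of_real \<epsilon> ^ kernel_dim N * (\<Prod>a\<leftarrow>map complex_of_real es. a
        + complex_of_real \<epsilon>)"
      unfolding split len kd using \<open>filter (\<lambda>a. a \<noteq> 0) as = map complex_of_real es\<close> by simp
    also have "(\<Prod>a\<leftarrow>map complex_of_real es. a + complex_of_real \<epsilon>)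
        = complex_of_real (\<Prod>e\<leftarrow>es. e + \<epsilon>)"
      by (induction es) auto
    finally show "det (gram_mat N \<epsilon>) = complex_of_real (\<epsilon> ^ kernel_dim N * (\<Prod>e\<leftarrow>es. e + \<epsilon>))"
        by simp
  qed
qed

text \<open>This is the link between nullity types and principal minors: nullities are the orders of
  vanishing of the principal minors of \<open>M\<^sup>*M + \<epsilon>I\<close> at \<open>\<epsilon> = 0\<close>.\<close>
lemma principal_minor_gram_mat:
  assumes "T \<subseteq> {..<dim_col M}"
  obtains k es where "nullity_type M T = real k" "\<forall>e\<in>set es. e > 0"
    "\<And>\<epsilon>. principal_minor (gram_mat M \<epsilon>) T = \<epsilon> ^ k * (\<Prod>e\<leftarrow>es. e + \<epsilon>)"
proof (cases "T = {}")
  case True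
  have "det (submatrix (gram_mat M \<epsilon>) {} {}) = 1" for \<epsilon>
    by (rule det_dim_zero) (auto simp: dim_submatrix)
  then show ?thesis using True by (intro that[of 0 "[]"]) (simp_all add: nullity_type_def
      principal_minor_def)
next
  case False
  let ?N = "submatrix M UNIV T"
  obtain es where es: "\<forall>e\<in>set es. e > 0"
    "\<And>\<epsilon>. det (gram_mat ?N \<epsilon>) = complex_of_real (\<epsilon> ^ kernel_dim ?N * (\<Prod>e\<leftarrow>es. e + \<epsilon>))"
    using det_gram_mat[of ?N] by metis
  show ?thesis
  proof (rule that)
    show "nullity_type M T = real (kernel_dim ?N)" using False by (simp add: nullity_type_def)
    show "\<forall>e\<in>set es. e > 0" by (rule es(1))
    show "principal_minor (gram_mat M \<epsilon>) T = \<epsilon> ^ kernel_dim ?N * (\<Prod>e\<leftarrow>es. e + \<epsilon>)" for \<epsilon>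
      unfolding principal_minor_def submatrix_gram_mat[OF assms] es(2)
          by (rule Re_complex_of_real)
  qed
qed

section \<open>Hermitian minors of order at most four\<close>

lemma det_reindex:
  assumes bij: "bij_betw f {..<k} {..<k}"
  shows "det (mat k k (\<lambda>(a, b). B $$ (f a, f b))) = det (mat k k (\<lambda>(a, b). B $$ (a, b)))"
proof -
  define p where "p a = (if a < k then f a else a)" for a
  have p: "p permutes {0..<k}"
    unfolding permutes_def
  proof (intro conjI allI impI)
    fix y
    show "\<exists>!x. p x = y"
    proof (cases "y < k")
      case True
      then have "y \<in> f ` {..<k}" using bij by (auto simp: bij_betw_def)
      then obtain x where x: "x < k" "f x = y" by auto
      show ?thesis
      proof (rule ex1I[of _ x])
        show "p x = y" using x by (simp add: p_def)
        fix x' assume "p x' = y"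
        then have "x' < k" "f x' = y" using True by (auto simp: p_def split: if_splits)
        then show "x' = x" using x bij by (auto simp: bij_betw_def inj_on_def)
      qed
    next
      case False
      have "f x < k" if "x < k" for x using bij that by (auto simp: bij_betw_def)
      then show ?thesis using False by (intro ex1I[of _ y]) (auto simp: p_def split: if_splits)
    qed
  qed (auto simp: p_def)
  let ?B = "mat k k (\<lambda>(a, b). B $$ (a, b))"
  let ?C = "mat k k (\<lambda>(a, b). ?B $$ (p a, b))"
  have pf: "p a = f a" if "a < k" for a using that by (simp add: p_def)
  have lt: "f a < k" if "a < k" for a using that bij by (auto simp: p_def bij_betw_def)
  have "mat k k (\<lambda>(a, b). B $$ (f a, f b)) = (mat k k (\<lambda>(a, b). (transpose_mat ?C) $$ (p a, b)))\<^sup>T"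
    by (rule eq_matI) (simp_all add: lt pf)
  moreover have "det (mat k k (\<lambda>(a, b). (transpose_mat ?C) $$ (p a, b)))\<^sup>T
      = det (mat k k (\<lambda>(a, b). (transpose_mat ?C) $$ (p a, b)))"
    by (rule det_transpose[OF mat_carrier])
  moreover have "det (mat k k (\<lambda>(a, b). (transpose_mat ?C) $$ (p a, b)))
      = signof p * det (transpose_mat ?C)"
    by (rule det_permute_rows[of "transpose_mat ?C" k p]) (simp_all add: p)
  moreover have "det (transpose_mat ?C) = det ?C" by (rule det_transpose[OF mat_carrier])
  moreover have "det ?C = signof p * det ?B"
      by (rule det_permute_rows[of ?B k p]) (simp_all add: p)
  moreover have "signof p * (signof p * det ?B) = det ?B" by (cases p rule: sign_cases) simp_all
  ultimately show ?thesis by (simp only:)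
qed

text \<open>Listing the index set in any order leaves the minor unchanged, because rows and columns are
  permuted alike. This makes the formulas below available for arbitrary distinct indices.\<close>
lemma principal_minor_reindex:
  assumes A: "A \<in> carrier_mat n n" and S: "set xs \<subseteq> {..<n}" and d: "distinct xs"
  shows "principal_minor A (set xs) = Re (det (mat (length xs) (length xs) (\<lambda>(a, b). A $$ (xs ! a,
      xs ! b))))"
proof -
  let ?S = "set xs" and ?k = "length xs"
  have card: "card ?S = ?k" using d by (rule distinct_card)
  have bp: "bij_betw (pick ?S) {..<?k} ?S" using pick_bij_betw[of ?S] card by simp
  have bx: "bij_betw ((!) xs) {..<?k} ?S" using d by (rule bij_betw_nth) auto
  define f where "f = inv_into {..<?k} (pick ?S) \<circ> (!) xs"
  have f: "bij_betw f {..<?k} {..<?k}" unfolding f_def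
      by (rule bij_betw_trans[OF bx bij_betw_inv_into[OF bp]])
  have pf: "pick ?S (f a) = xs ! a" if "a < ?k" for a
    unfolding f_def comp_def by (rule bij_betw_inv_into_right[OF bp]) (use that in auto)
  have lt: "f a < ?k" if "a < ?k" for a using f that by (auto simp: bij_betw_def)
  let ?B = "submatrix A ?S ?S"
  have B: "?B \<in> carrier_mat ?k ?k" using submatrix_principal_carrier[OF A S] card by simp
  have ind: "?B $$ (a, b) = A $$ (pick ?S a, pick ?S b)" if "a < ?k" "b < ?k" for a b
    using that A S by (intro submatrix_index) (auto simp: card_restrict card)
  have "mat ?k ?k (\<lambda>(a, b). A $$ (xs ! a, xs ! b)) = mat ?k ?k (\<lambda>(a, b). ?B $$ (f a, f b))"
    by (rule eq_matI) (auto simp: ind lt pf)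
  also have "det \<dots> = det (mat ?k ?k (\<lambda>(a, b). ?B $$ (a, b)))" by (rule det_reindex[OF f])
  also have "mat ?k ?k (\<lambda>(a, b). ?B $$ (a, b)) = ?B" using B by (intro eq_matI) auto
  finally show ?thesis unfolding principal_minor_def by simp
qed

lemma det_mat_1: "det (mat (Suc 0) (Suc 0) f) = f (0, 0)"
  by (subst det_single) auto

lemma det_mat_2: "det (mat 2 2 f) = f (0,0) * f (1,1) - f (0,1) * f (1,0)" for f :: "_ \<Rightarrow> complex"
  by (subst laplace_expansion_row[of _ 2 0])
    (auto simp: cofactor_def mat_delete_def numeral_2_eq_2 det_mat_1 insert_index_def)

lemma det_mat_3: "det (mat 3 3 f) = f (0,0) * (f (1,1) * f (2,2) - f (1,2) * f (2,1))
    - f (0,1) * (f (1,0) * f (2,2) - f (1,2) * f (2,0)) + f (0,2) * (f (1,0) * f (2,1)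
        - f (1,1) * f (2,0))" for f :: "_ \<Rightarrow> complex"
proof -
  have "det (mat 3 3 f) = (\<Sum>j<3. f (0, j) * ((-1)^j * det (mat 2 2 (\<lambda>(a, b). f (Suc a, if b < j
      then b else Suc b)))))"
    by (subst laplace_expansion_row[of _ 3 0])
      (auto simp: cofactor_def mat_delete_def intro!: sum.cong arg_cong[where f = det] cong_mat)
  also have "\<dots> = f (0,0) * (f (1,1) * f (2,2) - f (1,2) * f (2,1))
    - f (0,1) * (f (1,0) * f (2,2) - f (1,2) * f (2,0)) + f (0,2) * (f (1,0) * f (2,1)
        - f (1,1) * f (2,0))"
    unfolding det_mat_2 by (simp add: eval_nat_numeral algebra_simps)
  finally show ?thesis .
qed

lemma det_mat_4: "det (mat 4 4 f) = (\<Sum>j<4. f (0, j) * ((-1)^j * det (mat 3 3 (\<lambda>(a, b). f (Suc a,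
    if b < j then b else Suc b)))))" for f :: "_ \<Rightarrow> complex"
  by (subst laplace_expansion_row[of _ 4 0])
    (auto simp: cofactor_def mat_delete_def intro!: sum.cong arg_cong[where f = det] cong_mat)

text \<open>The determinant of the Hermitian matrix with diagonal \<open>x, y\<close> and upper entry \<open>p\<close>.\<close>
definition herm2 :: "real \<Rightarrow> real \<Rightarrow> complex \<Rightarrow> real" where
  "herm2 x y p = x * y - (cmod p)\<^sup>2"

text \<open>The determinant of the Hermitian matrix with diagonal \<open>x, y, z\<close> and upper entries \<open>p, q, r\<close>
  at the positions 12, 13 and 23.\<close>
definition herm3 :: "real \<Rightarrow> real \<Rightarrow> real \<Rightarrow> complex \<Rightarrow> complex \<Rightarrow> complex \<Rightarrow> real" where
  "herm3 x y z p q r = x * y * z + 2 * Re (p * r * cnj q) - x * (cmod r)\<^sup>2 - y * (cmod q)\<^sup>2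
      - z * (cmod p)\<^sup>2"

text \<open>A case of Sylvester's determinant identity (Desnanot--Jacobi); the square on the right is
  the off-diagonal minor, which is why Koteljanskii's inequality holds.\<close>
lemma herm3_submodular_identity:
  "herm3 x y z p q r * z = herm2 x z q * herm2 y z r - (cmod (of_real z * p - q * cnj r))\<^sup>2"
  unfolding herm3_def herm2_def cmod_power2 by (simp add: algebra_simps power2_eq_square)

text \<open>If \<open>u\<^sup>2 / X\<close>, \<open>v\<^sup>2 / Y\<close> and \<open>w\<^sup>2 / (X Y)\<close> are squared cosines of angles, the premise on \<open>w\<close>
  says that the cosine of the third angle is at least that of the sum of the first two; the
  conclusion bounds the squared sine of the third angle by twice the sum of the other two squared
  sines.\<close>
lemma squared_sine_triangle:
  fixes A B X Y u v w :: real
  assumes A: "A = X - u\<^sup>2" "0 \<le> A" and B: "B = Y - v\<^sup>2" "0 \<le> B" and pos: "0 \<le> u" "0 \<le> v" "0 \<le> w"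
    and w: "w \<ge> u * v - sqrt (A * B)"
  shows "X * Y - w\<^sup>2 \<le> 2 * (A * Y + B * X)"
proof (cases "u * v \<ge> sqrt (A * B)")
  case True
  have "0 \<le> (v * sqrt A - u * sqrt B)\<^sup>2" by simp
  also have "\<dots> = v\<^sup>2 * A + u\<^sup>2 * B - 2 * (u * v * sqrt (A * B))"
    using A B by (simp add: power2_diff power_mult_distrib real_sqrt_mult algebra_simps)
  finally have 1: "2 * (u * v * sqrt (A * B)) \<le> v\<^sup>2 * A + u\<^sup>2 * B" by simp
  have "(u * v - sqrt (A * B))\<^sup>2 \<le> w\<^sup>2" using True w by (intro power_mono) auto
  moreover have "(u * v - sqrt (A * B))\<^sup>2 = u\<^sup>2 * v\<^sup>2 + A * B - 2 * (u * v * sqrt (A * B))"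
    using A B by (simp add: power2_diff power_mult_distrib)
  ultimately have "u\<^sup>2 * v\<^sup>2 + A * B - (v\<^sup>2 * A + u\<^sup>2 * B) \<le> w\<^sup>2" using 1 by linarith
  moreover have "u\<^sup>2 = X - A" "v\<^sup>2 = Y - B" using A B by auto
  ultimately have "(X - A) * (Y - B) + A * B - ((Y - B) * A + (X - A) * B) \<le> w\<^sup>2" by (simp only:)
  then show ?thesis using mult_nonneg_nonneg[OF A(2) B(2)] by (simp add: algebra_simps)
next
  case False
  have "(u * v)\<^sup>2 \<le> (sqrt (A * B))\<^sup>2" using False pos by (intro power_mono) auto
  then have "u\<^sup>2 * v\<^sup>2 \<le> A * B" using A B by (simp add: power_mult_distrib)
  moreover have e: "u\<^sup>2 = X - A" "v\<^sup>2 = Y - B" using A B by auto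
  ultimately have "(X - A) * (Y - B) \<le> A * B" by (simp only:)
  then have "X * Y \<le> A * Y + B * X" by (simp add: algebra_simps)
  moreover have "0 \<le> w\<^sup>2" by simp
  moreover have "0 \<le> X" "0 \<le> Y"
    using e A(2) B(2) zero_le_power2[of u] zero_le_power2[of v] by linarith+
  then have "0 \<le> A * Y + B * X" using A(2) B(2) by simp
  ultimately show ?thesis unfolding distrib_left by linarith
qed

text \<open>The first inequality drops the square in \<open>herm3_submodular_identity\<close>. For the second one,
  the identity bounds that square by the product of the two minors, hence the modulus of \<open>p\<close> from
  below, and \<open>squared_sine_triangle\<close> applies.\<close>
lemma herm3_ineqs:
  assumes pos: "x > 0" "y > 0" "z > 0" "herm2 x z q > 0" "herm2 y z r > 0" "herm3 x y z p q r > 0"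
  shows "herm3 x y z p q r * z \<le> herm2 x z q * herm2 y z r"
    and "herm2 x y p * z \<le> 2 * (herm2 x z q * y + herm2 y z r * x)"
proof -
  show "herm3 x y z p q r * z \<le> herm2 x z q * herm2 y z r"
    unfolding herm3_submodular_identity by simp
  let ?A = "herm2 x z q" and ?B = "herm2 y z r"
  have "(cmod (of_real z * p - q * cnj r))\<^sup>2 \<le> ?A * ?B"
    using herm3_submodular_identity[of x y z p q r] mult_pos_pos[OF pos(6,3)] by linarith
  then have "cmod (of_real z * p - q * cnj r) \<le> sqrt (?A * ?B)" by (rule real_le_rsqrt)
  moreover have "cmod (q * cnj r) \<le> cmod (of_real z * p) + cmod (of_real z * p - q * cnj r)"
    using norm_triangle_sub[of "q * cnj r" "of_real z * p"] norm_minus_commute[of "q * cnj r"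
        "of_real z * p"] by linarith
  ultimately have "cmod q * cmod r - sqrt (?A * ?B) \<le> z * cmod p"
    using pos by (simp add: norm_mult)
  then have "x * z * (y * z) - (z * cmod p)\<^sup>2 \<le> 2 * (?A * (y * z) + ?B * (x * z))"
    using pos by (intro squared_sine_triangle[where u = "cmod q" and v
        = "cmod r"]) (simp_all add: herm2_def)
  then have "z * (herm2 x y p * z) \<le> z * (2 * (?A * y + ?B * x))"
    by (simp add: herm2_def algebra_simps power2_eq_square)
  then show "herm2 x y p * z \<le> 2 * (?A * y + ?B * x)" using pos(3) by simp
qed

text \<open>The determinant of the Hermitian \<open>4 \<times> 4\<close> matrix with upper entries \<open>p, q, r\<close> in the first
  row, \<open>s, t\<close> in the second and \<open>u\<close> in the third, written through the Schur complement of the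
  entry \<open>x\<close> so that the three-point inequalities apply to it.\<close>
definition herm4 :: "real \<Rightarrow> real \<Rightarrow> real \<Rightarrow> real \<Rightarrow> complex \<Rightarrow> complex \<Rightarrow> complex \<Rightarrow> complex \<Rightarrow> complex \<Rightarrow>
    complex \<Rightarrow> real" where
  "herm4 x y z w p q r s t u = x * herm3 (y - (cmod p)\<^sup>2 / x) (z - (cmod q)\<^sup>2 / x) (w
      - (cmod r)\<^sup>2 / x)
     (s - cnj p * q / x) (t - cnj p * r / x) (u - cnj q * r / x)"

lemma herm2_schur: "x \<noteq> 0 \<Longrightarrow> herm2 x y p = x * (y - (cmod p)\<^sup>2 / x)"
  by (simp add: herm2_def field_simps)

lemma of_real_herm3:
  "complex_of_real (herm3 x y z p q r) = of_real x * (of_real y * of_real z - r * cnj r)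
    - p * (cnj p * of_real z - r * cnj q) + q * (cnj p * cnj r - of_real y * cnj q)"
  unfolding herm3_def cmod_power2 by (rule complex_eqI) (simp_all add: algebra_simps
      power2_eq_square)

text \<open>Substituting \<open>p = x P\<close> and \<open>q = x Q\<close> removes the denominators.\<close>
lemma herm3_schur:
  assumes "x \<noteq> 0"
  shows "herm3 x y z p q r = x * herm2 (y - (cmod p)\<^sup>2 / x) (z - (cmod q)\<^sup>2 / x) (r
      - cnj p * q / x)"
proof -
  have p: "p = of_real x * (p / of_real x)" and q: "q = of_real x * (q / of_real x)" using assms
      by auto
  define P Q where "P = p / of_real x" and "Q = q / of_real x"
  have e: "(cmod (of_real x * P))\<^sup>2 / x = x * (cmod P)\<^sup>2"
      "(cmod (of_real x * Q))\<^sup>2 / x = x * (cmod Q)\<^sup>2"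
     "cnj (of_real x * P) * (of_real x * Q) / of_real x = of_real x * cnj P * Q"
    using assms unfolding norm_mult power_mult_distrib norm_of_real power2_abs
        by (simp_all add: power2_eq_square)
  show ?thesis
    unfolding p[folded P_def] q[folded Q_def] e
    unfolding herm2_def herm3_def cmod_power2 by (simp add: algebra_simps power2_eq_square)
qed

text \<open>Row reduction with the pivot \<open>x\<close>, stated with the pivot row and column divisible by \<open>x\<close> so
  that it is a polynomial identity.\<close>
lemma det_schur_4:
  fixes x :: complex
  assumes f: "f = (\<lambda>(a, b). [[x, x * P, x * Q, x * R],
      [x * P', y + x * P' * P, s + x * P' * Q, t + x * P' * R],
      [x * Q', s' + x * Q' * P, z + x * Q' * Q, u + x * Q' * R],
      [x * R', t' + x * R' * P, u' + x * R' * Q, w + x * R' * R]] ! a ! b)"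
  shows "det (mat 4 4 f) = x * (y * (z * w - u * u') - s * (s' * w - u * t') + t * (s' * u'
      - z * t'))"
  unfolding det_mat_4 det_mat_3 f by (simp add: eval_nat_numeral algebra_simps)

lemma hermitian_minors:
  assumes A: "A \<in> carrier_mat n n" and herm: "mat_adjoint A = A"
  shows "i < n \<Longrightarrow> principal_minor A {i} = Re (A $$ (i,i))"
   and "i < n \<Longrightarrow> j < n \<Longrightarrow> i \<noteq> j \<Longrightarrow> principal_minor A {i,j}
       = herm2 (Re (A $$ (i,i))) (Re (A $$ (j,j))) (A $$ (i,j))"
   and "i < n \<Longrightarrow> j < n \<Longrightarrow> k < n \<Longrightarrow> distinct [i,j,k] \<Longrightarrow> principal_minor A {i,j,k} =
      herm3 (Re (A $$ (i,i))) (Re (A $$ (j,j))) (Re (A $$ (k,k))) (A $$ (i,j)) (A $$ (i,k)) (A $$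
          (j,k))"
   and "i < n \<Longrightarrow> j < n \<Longrightarrow> k < n \<Longrightarrow> l < n \<Longrightarrow> distinct [i,j,k,l] \<Longrightarrow> Re (A $$ (i,i)) \<noteq> 0 \<Longrightarrow>
       principal_minor A {i,j,k,l} =
      herm4 (Re (A $$ (i,i))) (Re (A $$ (j,j))) (Re (A $$ (k,k))) (Re (A $$ (l,l)))
        (A $$ (i,j)) (A $$ (i,k)) (A $$ (i,l)) (A $$ (j,k)) (A $$ (j,l)) (A $$ (k,l))"
proof -
  have c: "A $$ (b, a) = cnj (A $$ (a, b))" if "a < n" "b < n" for a b
      using mat_adjoint_eqD[OF A herm that(2,1)] .
  have r: "A $$ (a, a) = of_real (Re (A $$ (a,a)))" if "a < n" for a
    using c[OF that that] by (metis Reals_cnj_iff of_real_Re)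
  show "principal_minor A {i} = Re (A $$ (i,i))" if "i < n"
    using principal_minor_reindex[OF A, of "[i]"] that by (simp add: det_mat_1)
  show "principal_minor A {i,j} = herm2 (Re (A $$ (i,i))) (Re (A $$ (j,j))) (A $$ (i,j))"
      if "i < n" "j < n" "i \<noteq> j"
  proof -
    have "det (mat 2 2 (\<lambda>(a, b). A $$ ([i,j] ! a, [i,j] ! b)))
        = complex_of_real (herm2 (Re (A $$ (i,i))) (Re (A $$ (j,j))) (A $$ (i,j)))"
      using that unfolding det_mat_2
      by (simp add: herm2_def complex_norm_square c[of i j] r[symmetric] del: of_real_power)
    then show ?thesis using principal_minor_reindex[OF A, of "[i,j]"] that
        by (simp add: numeral_2_eq_2)
  qed
  show "principal_minor A {i,j,k} =
      herm3 (Re (A $$ (i,i))) (Re (A $$ (j,j))) (Re (A $$ (k,k))) (A $$ (i,j)) (A $$ (i,k)) (A $$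
          (j,k))"
    if "i < n" "j < n" "k < n" "distinct [i,j,k]"
  proof -
    have "det (mat 3 3 (\<lambda>(a, b). A $$ ([i,j,k] ! a, [i,j,k] ! b))) =
      complex_of_real (herm3 (Re (A $$ (i,i))) (Re (A $$ (j,j))) (Re (A $$ (k,k))) (A $$ (i,j)) (A
          $$ (i,k)) (A $$ (j,k)))"
      using that unfolding det_mat_3 of_real_herm3
      by (simp add: c[of i j] c[of i k] c[of j k] r[symmetric])
    then show ?thesis using principal_minor_reindex[OF A, of "[i,j,k]"] that
        by (simp add: numeral_3_eq_3)
  qed
  show "principal_minor A {i,j,k,l} =
      herm4 (Re (A $$ (i,i))) (Re (A $$ (j,j))) (Re (A $$ (k,k))) (Re (A $$ (l,l)))
        (A $$ (i,j)) (A $$ (i,k)) (A $$ (i,l)) (A $$ (j,k)) (A $$ (j,l)) (A $$ (k,l))"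
    if "i < n" "j < n" "k < n" "l < n" "distinct [i,j,k,l]" "Re (A $$ (i,i)) \<noteq> 0"
  proof -
    define x y z w where "x = Re (A $$ (i,i))" and "y = Re (A $$ (j,j))" and "z = Re (A $$ (k,k))"
        and "w = Re (A $$ (l,l))"
    define p q r' s t u where "p = A $$ (i,j)" and "q = A $$ (i,k)" and "r' = A $$ (i,l)"
        and "s = A $$ (j,k)" and "t = A $$ (j,l)" and "u = A $$ (k,l)"
    have x: "x \<noteq> 0" using that by (simp add: x_def)
    have e: "A $$ (i,i) = of_real x" "A $$ (j,j) = of_real y" "A $$ (k,k) = of_real z"
        "A $$ (l,l) = of_real w"
      "A $$ (i,j) = p" "A $$ (i,k) = q" "A $$ (i,l) = r'" "A $$ (j,k) = s" "A $$ (j,l) = t"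
          "A $$ (k,l) = u"
      "A $$ (j,i) = cnj p" "A $$ (k,i) = cnj q" "A $$ (l,i) = cnj r'" "A $$ (k,j) = cnj s"
          "A $$ (l,j) = cnj t" "A $$ (l,k) = cnj u"
      unfolding x_def y_def z_def w_def p_def q_def r'_def s_def t_def u_def
      by (rule refl | rule r, fact | rule c, fact, fact)+
    define P Q R where "P = p / of_real x" and "Q = q / of_real x" and "R = r' / of_real x"
    have P: "p = of_real x * P" and Q: "q = of_real x * Q" and R: "r' = of_real x * R" using x
        by (simp_all add: P_def Q_def R_def)
    have sq: "complex_of_real (y - (cmod p)\<^sup>2 / x) = of_real y - of_real x * cnj P * P"
      "complex_of_real (z - (cmod q)\<^sup>2 / x) = of_real z - of_real x * cnj Q * Q"
      "complex_of_real (w - (cmod r')\<^sup>2 / x) = of_real w - of_real x * cnj R * R"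
      "s - cnj p * q / of_real x = s - of_real x * cnj P * Q"
      "t - cnj p * r' / of_real x = t - of_real x * cnj P * R"
      "u - cnj q * r' / of_real x = u - of_real x * cnj Q * R"
      unfolding of_real_diff of_real_divide complex_norm_square unfolding P Q R using x
          by simp_all
    let ?f = "\<lambda>(a, b). A $$ ([i,j,k,l] ! a, [i,j,k,l] ! b)"
    let ?g = "\<lambda>(a, b). [[of_real x, of_real x * P, of_real x * Q, of_real x * R],
      [of_real x * cnj P, (of_real y - of_real x * cnj P * P) + of_real x * cnj P * P, (s
          - of_real x * cnj P * Q) + of_real x * cnj P * Q, (t - of_real x * cnj P * R)
          + of_real x * cnj P * R],
      [of_real x * cnj Q, (cnj s - of_real x * cnj Q * P) + of_real x * cnj Q * P, (of_real z
          - of_real x * cnj Q * Q) + of_real x * cnj Q * Q, (u - of_real x * cnj Q * R)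
          + of_real x * cnj Q * R],
      [of_real x * cnj R, (cnj t - of_real x * cnj R * P) + of_real x * cnj R * P, (cnj u
          - of_real x * cnj R * Q) + of_real x * cnj R * Q, (of_real w - of_real x * cnj R * R)
          + of_real x * cnj R * R]] ! a ! b"
    have "mat 4 4 ?f = mat 4 4 ?g"
      by (rule cong_mat) (auto simp: less_Suc_eq eval_nat_numeral e P Q R)
    then have "det (mat 4 4 ?f) = det (mat 4 4 ?g)" by (rule arg_cong)
    also have "\<dots> = complex_of_real (herm4 x y z w p q r' s t u)"
      unfolding det_schur_4[OF refl] herm4_def of_real_mult of_real_herm3 sq
          by (simp add: mult_ac)
    finally have "det (mat 4 4 ?f) = complex_of_real (herm4 x y z w p q r' s t u)" .
    then show ?thesis using principal_minor_reindex[OF A, of "[i,j,k,l]"] that(1-5)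
      unfolding x_def[symmetric] y_def[symmetric] z_def[symmetric] w_def[symmetric]
          p_def[symmetric] q_def[symmetric] r'_def[symmetric] s_def[symmetric] t_def[symmetric]
          u_def[symmetric]
      by (simp add: eval_nat_numeral)
  qed
qed

section \<open>Approximate ultrametrics on four points\<close>

text \<open>Similarity values: large values mean close points. The smallest value is attained twice, up
  to \<open>\<kappa>\<close>.\<close>
definition almost_ultrametric :: "real \<Rightarrow> real \<Rightarrow> real \<Rightarrow> real \<Rightarrow> bool" where
  "almost_ultrametric \<kappa> x y z \<longleftrightarrow>
     min y z - \<kappa> \<le> x \<and> min x z - \<kappa> \<le> y \<and> min x y - \<kappa> \<le> z"

text \<open>The eleven arguments are the values of a set function at the subsets of \<open>{i,j,k,l}\<close> with at
  least two elements. They are compared with a combination of twelve nullity types of vector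
  configurations, with coefficients \<open>u1, u2, u3\<close> for four vectors in general position in dimension
  1, 2, 3; \<open>pij, pkl\<close> for one parallel pair and otherwise independent vectors; \<open>a\<close> for \<open>i, j, k\<close>
  parallel and \<open>l\<close> independent; \<open>cl, ck, cj, ci\<close> for three vectors in general position in a plane
  and the vector of the missing index independent of them; \<open>mij, mkl\<close> for four vectors in a plane
  of which only the indicated pair is parallel. Coefficients are allowed to be slightly negative,
  which avoids truncations.\<close>
definition near_model :: "real \<Rightarrow> real \<Rightarrow> real \<Rightarrow> real \<Rightarrow> real \<Rightarrow> real \<Rightarrow> real \<Rightarrow> real \<Rightarrow> real \<Rightarrow> real \<Rightarrow>
    real \<Rightarrow> real \<Rightarrow> bool" where
  "near_model K aij aik ajk ail ajl akl bijk bijl bikl bjkl d \<longleftrightarrow>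
      (\<exists>u1 u2 u3 pij pkl a cl ck cj ci mij mkl.
    - K \<le> u1 \<and> - K \<le> u2 \<and> - K \<le> u3 \<and> - K \<le> pij \<and> - K \<le> pkl \<and> - K \<le> a \<and> - K \<le> cl \<and> - K \<le> ck \<and>
        - K \<le> cj \<and> - K \<le> ci \<and> - K \<le> mij \<and> - K \<le> mkl \<and>
    aij \<le> u1 + pij + a + mij + K \<and> u1 + pij + a + mij \<le> aij + K \<and>
    aik \<le> u1 + a + K \<and> u1 + a \<le> aik + K \<and>
    ajk \<le> u1 + a + K \<and> u1 + a \<le> ajk + K \<and>
    ail \<le> u1 + K \<and> u1 \<le> ail + K \<and>
    ajl \<le> u1 + K \<and> u1 \<le> ajl + K \<and>
    akl \<le> u1 + pkl + mkl + K \<and> u1 + pkl + mkl \<le> akl + K \<and>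
    bijk \<le> u1 + u1 + u2 + pij + a + a + cl + mij + mkl + K \<and>
        u1 + u1 + u2 + pij + a + a + cl + mij + mkl \<le> bijk + K \<and>
    bijl \<le> u1 + u1 + u2 + pij + a + ck + mij + mkl + K \<and>
        u1 + u1 + u2 + pij + a + ck + mij + mkl \<le> bijl + K \<and>
    bikl \<le> u1 + u1 + u2 + pkl + a + cj + mij + mkl + K \<and>
        u1 + u1 + u2 + pkl + a + cj + mij + mkl \<le> bikl + K \<and>
    bjkl \<le> u1 + u1 + u2 + pkl + a + ci + mij + mkl + K \<and>
        u1 + u1 + u2 + pkl + a + ci + mij + mkl \<le> bjkl + K \<and>
    d \<le> u1 + u1 + u1 + u2 + u2 + u3 + pij + pkl + a + a + cl + ck + cj + ci + mij + mij + mkl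
        + mkl + K \<and> u1 + u1 + u1 + u2 + u2 + u3 + pij + pkl + a + a + cl + ck + cj + ci + mij
        + mij + mkl + mkl \<le> d + K)"

lemma ultra_two: "almost_ultrametric \<kappa> x y z \<Longrightarrow> y \<le> x \<Longrightarrow> z \<le> x \<Longrightarrow> \<bar>y - z\<bar> \<le> \<kappa>"
  unfolding almost_ultrametric_def by linarith

lemma ultra_rotate: "almost_ultrametric \<kappa> x y z \<Longrightarrow> almost_ultrametric \<kappa> z x y"
  unfolding almost_ultrametric_def by (auto simp: min.commute)

lemma ultra_gap: "almost_ultrametric \<kappa> x y z \<Longrightarrow> y + \<kappa> < x \<Longrightarrow> \<bar>y - z\<bar> \<le> \<kappa>"
  unfolding almost_ultrametric_def by linarith

lemma ultra_gap2: "almost_ultrametric \<kappa> x y z \<Longrightarrow> x + \<kappa> < y \<Longrightarrow> \<bar>x - z\<bar> \<le> \<kappa>"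
  unfolding almost_ultrametric_def by linarith

lemma ultra_gap3: "almost_ultrametric \<kappa> x y z \<Longrightarrow> z + \<kappa> < y \<Longrightarrow> \<bar>x - z\<bar> \<le> \<kappa>"
  unfolding almost_ultrametric_def by linarith

lemma ultra_gap4: "almost_ultrametric \<kappa> x y z \<Longrightarrow> y + \<kappa> < z \<Longrightarrow> \<bar>x - y\<bar> \<le> \<kappa>"
  unfolding almost_ultrametric_def by linarith

lemma ultra_low2: "almost_ultrametric \<kappa> x y z \<Longrightarrow> \<bar>y - z\<bar> \<le> \<kappa> \<Longrightarrow> y - 2 * \<kappa> \<le> x \<and> z - 2 * \<kappa> \<le> x"
  unfolding almost_ultrametric_def by linarith

lemma ultra_low: "almost_ultrametric \<kappa> x y z \<Longrightarrow> \<bar>x - y\<bar> \<le> \<kappa> \<Longrightarrow> x - 2 * \<kappa> \<le> z \<and> y - 2 * \<kappa> \<le> z"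
  unfolding almost_ultrametric_def by linarith

text \<open>Perturbing the three values costs only a larger constant.\<close>
lemma ultra_shift:
  assumes "almost_ultrametric \<kappa> x y z" and "\<bar>x - x'\<bar> \<le> 2 * \<kappa>" "\<bar>y - y'\<bar> \<le> 2 * \<kappa>"
      "\<bar>z - z'\<bar> \<le> 2 * \<kappa>"
  shows "almost_ultrametric (5 * \<kappa>) x' y' z'"
proof -
  have m: "min b' c' \<le> min b c + 2 * \<kappa>" if "\<bar>b - b'\<bar> \<le> 2 * \<kappa>" "\<bar>c - c'\<bar> \<le> 2 * \<kappa>"
      for b b' c c' :: real
    using that by (auto simp: min_def abs_le_iff)
  show ?thesis
    using assms m[OF assms(2,3)] m[OF assms(2,4)] m[OF assms(3,4)]
    unfolding almost_ultrametric_def abs_le_iff by (intro conjI; linarith)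
qed

lemma near_modelI:
  assumes "- K \<le> u1" "- K \<le> u2" "- K \<le> u3" "- K \<le> pij" "- K \<le> pkl" "- K \<le> a" "- K \<le> cl" "- K \<le> ck"
      "- K \<le> cj" "- K \<le> ci" "- K \<le> mij" "- K \<le> mkl"
    and "aij \<le> u1 + pij + a + mij + K" "u1 + pij + a + mij \<le> aij + K"
    "aik \<le> u1 + a + K" "u1 + a \<le> aik + K"
    "ajk \<le> u1 + a + K" "u1 + a \<le> ajk + K"
    "ail \<le> u1 + K" "u1 \<le> ail + K"
    "ajl \<le> u1 + K" "u1 \<le> ajl + K"
    "akl \<le> u1 + pkl + mkl + K" "u1 + pkl + mkl \<le> akl + K"
    "bijk \<le> u1 + u1 + u2 + pij + a + a + cl + mij + mkl + K"
        "u1 + u1 + u2 + pij + a + a + cl + mij + mkl \<le> bijk + K"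
    "bijl \<le> u1 + u1 + u2 + pij + a + ck + mij + mkl + K"
        "u1 + u1 + u2 + pij + a + ck + mij + mkl \<le> bijl + K"
    "bikl \<le> u1 + u1 + u2 + pkl + a + cj + mij + mkl + K"
        "u1 + u1 + u2 + pkl + a + cj + mij + mkl \<le> bikl + K"
    "bjkl \<le> u1 + u1 + u2 + pkl + a + ci + mij + mkl + K"
        "u1 + u1 + u2 + pkl + a + ci + mij + mkl \<le> bjkl + K"
    "d \<le> u1 + u1 + u1 + u2 + u2 + u3 + pij + pkl + a + a + cl + ck + cj + ci + mij + mij + mkl
        + mkl + K" "u1 + u1 + u1 + u2 + u2 + u3 + pij + pkl + a + a + cl + ck + cj + ci + mij
        + mij + mkl + mkl \<le> d + K"
  shows "near_model K aij aik ajk ail ajl akl bijk bijl bikl bjkl d"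
  unfolding near_model_def
  apply (rule exI[of _ u1], rule exI[of _ u2], rule exI[of _ u3], rule exI[of _ pij],
      rule exI[of _ pkl], rule exI[of _ a], rule exI[of _ cl], rule exI[of _ ck],
      rule exI[of _ cj], rule exI[of _ ci], rule exI[of _ mij], rule exI[of _ mkl])
  by (intro conjI; fact)

text \<open>The numbers are the deficits of the subsets of \<open>{i,j,k,l}\<close>. The pair values form a tree in
  which \<open>i\<close> and \<open>j\<close> are closest, and the two disjuncts of \<open>shape\<close> are the two tree shapes: either
  \<open>k\<close> joins \<open>{i,j}\<close> before \<open>l\<close> does, or \<open>{k,l}\<close> is a second cherry. In both cases the smallest
  level is \<open>ail\<close>, which is the coefficient of the nullity type of four parallel vectors, and the
  conditional trees at the single points determine the remaining coefficients. The coefficient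
  \<open>u3\<close> enters the value at \<open>{i,j,k,l}\<close> only; in every case it is one of the six conditional values
  given two points, hence nonnegative. The factor 30 absorbs the errors of the few comparisons
  made along the way.\<close>
lemma near_model_of_ultrametrics:
  fixes aij aik ajk ail ajl akl bijk bijl bikl bjkl d :: real
  assumes k: "0 \<le> \<kappa>"
  and dij: "d - bijl - bijk + aij \<ge> 0" and dik: "d - bijk - bikl + aik \<ge> 0"
      and djk: "d - bijk - bjkl + ajk \<ge> 0"
  and dil: "d - bijl - bikl + ail \<ge> 0" and djl: "d - bijl - bjkl + ajl \<ge> 0"
  and a0: "ail \<ge> 0"
  and n: "bijk - aij - aik \<ge> 0" "bijl - aij - ail \<ge> 0" "bikl - ail - akl \<ge> 0"
  and t: "almost_ultrametric \<kappa> aij aik ajk" "almost_ultrametric \<kappa> aij ail ajl"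
      "almost_ultrametric \<kappa> aik ail akl" "almost_ultrametric \<kappa> ajk ajl akl"
  and ti: "almost_ultrametric \<kappa> (bijk-aij-aik) (bijl-aij-ail) (bikl-aik-ail)"
  and tj: "almost_ultrametric \<kappa> (bijk-aij-ajk) (bijl-aij-ajl) (bjkl-ajk-ajl)"
  and tk: "almost_ultrametric \<kappa> (bijk-aik-ajk) (bikl-aik-akl) (bjkl-ajk-akl)"
  and tl: "almost_ultrametric \<kappa> (bijl-ail-ajl) (bikl-ail-akl) (bjkl-ajl-akl)"
  and ij: "aij \<ge> aik" "aij \<ge> ajk" "aij \<ge> ail" "aij \<ge> ajl"
  and shape: "aik \<ge> ajk \<and> aik \<ge> ail \<and> aik \<ge> ajl \<and> aik \<ge> akl \<or> akl \<ge> aik \<and> akl \<ge> ajk \<and> akl \<ge> ail \<and>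
      akl \<ge> ajl"
  shows "near_model (30*\<kappa>) aij aik ajk ail ajl akl bijk bijl bikl bjkl d"
  using shape
proof
  assume s: "aik \<ge> ajk \<and> aik \<ge> ail \<and> aik \<ge> ajl \<and> aik \<ge> akl"
  have e: "aik - ajk \<le> \<kappa>" "ajk - aik \<le> \<kappa>" "ail - ajl \<le> \<kappa>" "ajl - ail \<le> \<kappa>" "ail - akl \<le> \<kappa>"
      "akl - ail \<le> \<kappa>"
    using ultra_two[OF t(1)] ultra_two[OF t(2)] ultra_two[OF t(3)] ultra_two[OF ultra_rotate[OF
        t(3)]] ultra_two[OF ultra_rotate[OF t(4)]] s ij by (simp_all add: abs_le_iff)
  have s1: "ail \<le> aik" using s by simp
  \<comment> \<open>Conditional values given \<open>i\<close>; \<open>ykl\<close> is conditional on \<open>j\<close> and \<open>zij\<close> on \<open>k\<close>. Those given \<open>j\<close>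
      for the pairs \<open>ik\<close> and \<open>il\<close> are close to \<open>xjk\<close> and \<open>xjl\<close>.\<close>
  define xjk xjl xkl ykl zij where "xjk = bijk-aij-aik" and "xjl = bijl-aij-ail"
      and "xkl = bikl-aik-ail" and "ykl = bjkl-ajk-ajl" and "zij = bijk-aik-ajk"
  note D = this
  have ti': "almost_ultrametric (5*\<kappa>) xjk xjl xkl"
    by (rule ultra_shift[OF ti]; use e k in \<open>unfold D, argo\<close>)
  have tj': "almost_ultrametric (5*\<kappa>) xjk xjl ykl"
    by (rule ultra_shift[OF tj]; use e k in \<open>unfold D, argo\<close>)
  have tk': "almost_ultrametric (5*\<kappa>) zij xkl ykl"
    by (rule ultra_shift[OF tk]; use e k in \<open>unfold D, argo\<close>)
  consider "xjk > xjl + 5*\<kappa>" | "xjl > xjk + 5*\<kappa>" | "xjk - xjl \<le> 5*\<kappa>" "xjl - xjk \<le> 5*\<kappa>"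
    by linarith
  then show ?thesis
  proof cases
    case 1
    have e2: "xjl - xkl \<le> 5*\<kappa>" "xkl - xjl \<le> 5*\<kappa>" "xjl - ykl \<le> 5*\<kappa>" "ykl - xjl \<le> 5*\<kappa>"
      using ultra_gap[OF ti' 1] ultra_gap[OF tj' 1] by linarith+
    show ?thesis
      by (rule near_modelI[of _ "ail" "xjl" "d-bijk-bijl+aij" "aij-aik" "0" "aik-ail" "xjk-xjl"
          "0" "0" "0" "0" "0"];
        use 1 e e2 s1 ij(1,3) dij k a0 n(2) in \<open>unfold D, argo\<close>)
  next
    case 2
    have e2: "xjk - xkl \<le> 5*\<kappa>" "xkl - xjk \<le> 5*\<kappa>" "xjk - ykl \<le> 5*\<kappa>" "ykl - xjk \<le> 5*\<kappa>"
      using ultra_gap2[OF ti' 2] ultra_gap2[OF tj' 2] by linarith+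
    show ?thesis
      by (rule near_modelI[of _ "ail" "xjk" "d-bijk-bijl+aij" "aij-aik" "0" "aik-ail" "0"
          "xjl-xjk" "0" "0" "0" "0"];
        use 2 e e2 s1 ij(1,3) dij k a0 n(1) in \<open>unfold D, argo\<close>)
  next
    case 3
    have e2: "xkl \<ge> xjk - 10*\<kappa>" "ykl \<ge> xjk - 10*\<kappa>"
      using ultra_low[OF ti'] ultra_low[OF tj'] 3 by linarith+
    \<comment> \<open>Here the plane configurations with \<open>i\<close> and \<open>j\<close> parallel occur; the tree given \<open>k\<close> decides
        between them.\<close>
    consider "xkl > ykl + 5*\<kappa>" | "ykl > xkl + 5*\<kappa>" | "xkl - ykl \<le> 5*\<kappa>" "ykl - xkl \<le> 5*\<kappa>"
      by linarith
    then show ?thesis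
    proof cases
      case q: 1
      have e4: "zij - ykl \<le> 5*\<kappa>" "ykl - zij \<le> 5*\<kappa>"
        using ultra_gap3[OF tk' q] by linarith+
      show ?thesis
        by (rule near_modelI[of _ "ail" "xjk" "d-bijk-bikl+aik" "0" "0" "aik-ail" "0" "0"
            "xkl-xjk-(aij-aik)" "0" "aij-aik" "0"];
        use 3 q e e2 e4 s1 ij(1,3) dik k a0 n(1) in \<open>unfold D, argo\<close>)
    next
      case q: 2
      have e4: "zij - xkl \<le> 5*\<kappa>" "xkl - zij \<le> 5*\<kappa>"
        using ultra_gap4[OF tk' q] by linarith+
      show ?thesis
      by (rule near_modelI[of _ "ail" "xjk" "d-bijk-bjkl+ajk" "0" "0" "aik-ail" "0" "0" "0"
          "ykl-xjk-(aij-aik)" "aij-aik" "0"];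
        use 3 q e e2 e4 s1 ij(1,3) djk k a0 n(1) in \<open>unfold D, argo\<close>)
    next
      case q: 3
      have e4: "zij \<ge> ykl - 10*\<kappa>"
        using ultra_low2[OF tk'] q by linarith
      show ?thesis
      by (rule near_modelI[of _ "ail" "xjk" "d-bijl-bjkl+ajl" "aij-aik-(ykl-xjk)" "0" "aik-ail"
          "0" "0" "0" "0" "ykl-xjk" "0"];
        use 3 q e e2 e4 s1 ij(1,3) djl k a0 n(1) in \<open>unfold D, argo\<close>)
    qed
  qed
next
  assume s: "akl \<ge> aik \<and> akl \<ge> ajk \<and> akl \<ge> ail \<and> akl \<ge> ajl"
  have e: "aik - ajk \<le> \<kappa>" "ajk - aik \<le> \<kappa>" "ail - ajl \<le> \<kappa>" "ajl - ail \<le> \<kappa>" "aik - ail \<le> \<kappa>"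
      "ail - aik \<le> \<kappa>" "ajk - ajl \<le> \<kappa>" "ajl - ajk \<le> \<kappa>"
    using ultra_two[OF t(1)] ultra_two[OF t(2)] ultra_two[OF t(3)] ultra_two[OF ultra_rotate[OF
        t(3)]] ultra_two[OF ultra_rotate[OF t(4)]] s ij by (simp_all add: abs_le_iff)
  have s1: "ail \<le> akl" using s by simp
  \<comment> \<open>The conditional values are \<open>s0, s1, t0+q\<close> given \<open>i\<close>, \<open>s0, s1, t1+q\<close> given \<open>j\<close>, \<open>t0, t1, s0+p\<close>
      given \<open>k\<close> and \<open>t0, t1, s1+p\<close> given \<open>l\<close>, up to multiples of \<open>\<kappa>\<close>.\<close>
  define p q s0 s1 t0 t1 where "p = aij - ail" and "q = akl - ail" and "s0 = bijk - aij - aik"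
      and "s1 = bijl - aij - ail"
    and "t0 = bikl - ail - akl" and "t1 = bjkl - ajl - akl"
  note D = this
  have ti': "almost_ultrametric (5*\<kappa>) s0 s1 (t0+q)"
    by (rule ultra_shift[OF ti]; use e k in \<open>unfold D, argo\<close>)
  have tj': "almost_ultrametric (5*\<kappa>) s0 s1 (t1+q)"
    by (rule ultra_shift[OF tj]; use e k in \<open>unfold D, argo\<close>)
  have tk': "almost_ultrametric (5*\<kappa>) t0 t1 (s0+p)"
    by (rule ultra_shift[OF ultra_rotate[OF ultra_rotate[OF tk]]]; use e k in \<open>unfold D, argo\<close>)
  have tl': "almost_ultrametric (5*\<kappa>) t0 t1 (s1+p)"
    by (rule ultra_shift[OF ultra_rotate[OF ultra_rotate[OF tl]]]; use e k in \<open>unfold D, argo\<close>)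
  consider "s0 > s1 + 5*\<kappa>" | "s1 > s0 + 5*\<kappa>" | "t0 > t1 + 5*\<kappa>" | "t1 > t0 + 5*\<kappa>" | "s0 - s1 \<le> 5*\<kappa>"
      "s1 - s0 \<le> 5*\<kappa>" "t0 - t1 \<le> 5*\<kappa>" "t1 - t0 \<le> 5*\<kappa>"
    by linarith
  then show ?thesis
  proof cases
    case 1
    have e2: "s1 - (t0+q) \<le> 5*\<kappa>" "(t0+q) - s1 \<le> 5*\<kappa>" "s1 - (t1+q) \<le> 5*\<kappa>" "(t1+q) - s1 \<le> 5*\<kappa>"
      using ultra_gap[OF ti' 1] ultra_gap[OF tj' 1] by linarith+
    show ?thesis
      by (rule near_modelI[of _ "ail" "t0" "d-bijk-bjkl+ajk" "p" "0" "0" "s0-t0-q" "0" "0" "0" "0"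
          "q"];
        use 1 e e2 s1 ij(1,3) djk k a0 n(3) in \<open>unfold D, argo\<close>)
  next
    case 2
    have e2: "s0 - (t0+q) \<le> 5*\<kappa>" "(t0+q) - s0 \<le> 5*\<kappa>" "s0 - (t1+q) \<le> 5*\<kappa>" "(t1+q) - s0 \<le> 5*\<kappa>"
      using ultra_gap2[OF ti' 2] ultra_gap2[OF tj' 2] by linarith+
    show ?thesis
      by (rule near_modelI[of _ "ail" "t0" "d-bijl-bjkl+ajl" "p" "0" "0" "0" "s1-t0-q" "0" "0" "0"
          "q"];
        use 2 e e2 s1 ij(1,3) djl k a0 n(3) in \<open>unfold D, argo\<close>)
  next
    case 3
    have e2: "t1 - (s0+p) \<le> 5*\<kappa>" "(s0+p) - t1 \<le> 5*\<kappa>" "t1 - (s1+p) \<le> 5*\<kappa>" "(s1+p) - t1 \<le> 5*\<kappa>"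
      using ultra_gap[OF tk' 3] ultra_gap[OF tl' 3] by linarith+
    show ?thesis
      by (rule near_modelI[of _ "ail" "s0" "d-bijl-bikl+ail" "0" "q" "0" "0" "0" "t0-s0-p" "0" "p"
          "0"];
        use 3 e e2 s1 ij(1,3) dil k a0 n(1) in \<open>unfold D, argo\<close>)
  next
    case 4
    have e2: "t0 - (s0+p) \<le> 5*\<kappa>" "(s0+p) - t0 \<le> 5*\<kappa>" "t0 - (s1+p) \<le> 5*\<kappa>" "(s1+p) - t0 \<le> 5*\<kappa>"
      using ultra_gap2[OF tk' 4] ultra_gap2[OF tl' 4] by linarith+
    show ?thesis
      by (rule near_modelI[of _ "ail" "s0" "d-bijk-bjkl+ajk" "0" "q" "0" "0" "0" "0" "t1-s0-p" "p"
          "0"];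
        use 4 e e2 s1 ij(1,3) djk k a0 n(1) in \<open>unfold D, argo\<close>)
  next
    case 5
    have e2: "t0 + q \<ge> s0 - 10*\<kappa>" "s0 + p \<ge> t0 - 10*\<kappa>"
      using ultra_low[OF ti'] ultra_low[OF tk'] 5 by linarith+
    show ?thesis
    proof (cases "s0 \<ge> t0")
      case True
      show ?thesis
      by (rule near_modelI[of _ "ail" "t0" "d-bijl-bjkl+ajl" "p" "q-(s0-t0)" "0" "0" "0" "0" "0"
          "0" "s0-t0"];
        use True 5 e e2 s1 ij(1,3) djl k a0 n(3) in \<open>unfold D, argo\<close>)
    next
      case False
      show ?thesis
      by (rule near_modelI[of _ "ail" "s0" "d-bijl-bjkl+ajl" "p-(t0-s0)" "q" "0" "0" "0" "0" "0"
          "t0-s0" "0"];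
        use False 5 e e2 s1 ij(1,3) djl k a0 n(1) in \<open>unfold D, argo\<close>)
    qed
  qed
qed

section \<open>The deficit of a positive definite matrix\<close>

lemma pos_def_minor_ineqs3:
  assumes pd: "pos_def_mat n A" and n: "i < n" "j < n" "k < n" and d: "distinct [i,j,k]"
  shows "principal_minor A {i,j} \<le> principal_minor A {i} * principal_minor A {j}"
    and "principal_minor A {i,j,k} * principal_minor A {k}
        \<le> principal_minor A {i,k} * principal_minor A {j,k}"
    and "principal_minor A {i,j} * principal_minor A {k} \<le>
      2 * (principal_minor A {i,k} * principal_minor A {j}
          + principal_minor A {j,k} * principal_minor A {i})"
proof -
  have A: "A \<in> carrier_mat n n" and adj: "mat_adjoint A = A" using pd
      by (auto simp: pos_def_mat_def)
  note m = hermitian_minors[OF A adj]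
  have e: "principal_minor A {i} = Re (A $$ (i,i))" "principal_minor A {j} = Re (A $$ (j,j))"
      "principal_minor A {k} = Re (A $$ (k,k))"
    "principal_minor A {i,j} = herm2 (Re (A $$ (i,i))) (Re (A $$ (j,j))) (A $$ (i,j))"
    "principal_minor A {i,k} = herm2 (Re (A $$ (i,i))) (Re (A $$ (k,k))) (A $$ (i,k))"
    "principal_minor A {j,k} = herm2 (Re (A $$ (j,j))) (Re (A $$ (k,k))) (A $$ (j,k))"
    "principal_minor A {i,j,k} = herm3 (Re (A $$ (i,i))) (Re (A $$ (j,j))) (Re (A $$ (k,k))) (A $$
        (i,j)) (A $$ (i,k)) (A $$ (j,k))"
    using n d by (simp_all add: m(1) m(2) m(3))
  have "principal_minor A S > 0" if "S \<subseteq> {i,j,k}" for S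
    using that n by (intro principal_minor_pos[OF pd]) auto
  then have "principal_minor A {i} > 0" "principal_minor A {j} > 0" "principal_minor A {k} > 0"
      "principal_minor A {i,k} > 0" "principal_minor A {j,k} > 0" "principal_minor A {i,j,k} > 0"
    by simp_all
  note h = herm3_ineqs[OF this[unfolded e]]
  show "principal_minor A {i,j,k} * principal_minor A {k}
      \<le> principal_minor A {i,k} * principal_minor A {j,k}"
    unfolding e by (rule h(1))
  show "principal_minor A {i,j} * principal_minor A {k} \<le>
      2 * (principal_minor A {i,k} * principal_minor A {j}
          + principal_minor A {j,k} * principal_minor A {i})"
    unfolding e by (rule h(2))
  show "principal_minor A {i,j} \<le> principal_minor A {i} * principal_minor A {j}"
    unfolding e by (simp add: herm2_def)
qed

text \<open>These are the inequalities of \<open>herm3_ineqs\<close> for the Schur complement of the entry at \<open>l\<close>,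
  multiplied by the square of that entry.\<close>
lemma pos_def_minor_ineqs4:
  assumes pd: "pos_def_mat n A" and n: "i < n" "j < n" "k < n" "l < n" and d: "distinct [i,j,k,l]"
  shows "principal_minor A {i,j,k,l} * principal_minor A {k,l}
      \<le> principal_minor A {i,k,l} * principal_minor A {j,k,l}"
    and "principal_minor A {i,j,l} * principal_minor A {k,l} \<le>
      2 * (principal_minor A {i,k,l} * principal_minor A {j,l}
          + principal_minor A {j,k,l} * principal_minor A {i,l})"
proof -
  have A: "A \<in> carrier_mat n n" and adj: "mat_adjoint A = A" using pd
      by (auto simp: pos_def_mat_def)
  note m = hermitian_minors[OF A adj]
  have P: "principal_minor A S > 0" if "S \<subseteq> {i,j,k,l}" for S
    using that n by (intro principal_minor_pos[OF pd]) auto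
  define x where "x = Re (A $$ (l,l))"
  have x: "x > 0" using P[of "{l}"] m(1)[of l] n by (simp add: x_def)
  define Y where "Y a = Re (A $$ (a,a)) - (cmod (A $$ (l,a)))\<^sup>2 / x" for a
  define S where "S a b = A $$ (a,b) - cnj (A $$ (l,a)) * A $$ (l,b) / of_real x" for a b
  have e2: "principal_minor A {a,l} = x * Y a" if "a \<in> {i,j,k}" for a
  proof -
    have "principal_minor A {l,a} = x * Y a"
      using that n d x by (subst m(2)) (auto simp: herm2_schur x_def[symmetric] Y_def)
    then show ?thesis by (simp add: insert_commute)
  qed
  have e3: "principal_minor A {a,b,l} = x * herm2 (Y a) (Y b) (S a b)" if "a \<in> {i,j,k}"
      "b \<in> {i,j,k}" "a \<noteq> b" for a b
  proof -
    have "principal_minor A {l,a,b} = x * herm2 (Y a) (Y b) (S a b)"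
      using that n d x by (subst m(3)) (auto simp: herm3_schur x_def[symmetric] Y_def S_def)
    moreover have "{l,a,b} = {a,b,l}" by auto
    ultimately show ?thesis by simp
  qed
  have e4: "principal_minor A {i,j,k,l} = x * herm3 (Y i) (Y j) (Y k) (S i j) (S i k) (S j k)"
  proof -
    have "principal_minor A {l,i,j,k} = x * herm3 (Y i) (Y j) (Y k) (S i j) (S i k) (S j k)"
      using n d x by (subst m(4)) (auto simp: herm4_def x_def[symmetric] Y_def S_def)
    moreover have "{l,i,j,k} = {i,j,k,l}" by auto
    ultimately show ?thesis by simp
  qed
  have e: "principal_minor A {i,l} = x * Y i" "principal_minor A {j,l} = x * Y j"
      "principal_minor A {k,l} = x * Y k"
    "principal_minor A {i,j,l} = x * herm2 (Y i) (Y j) (S i j)"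
        "principal_minor A {i,k,l} = x * herm2 (Y i) (Y k) (S i k)"
    "principal_minor A {j,k,l} = x * herm2 (Y j) (Y k) (S j k)"
    using d by (auto intro!: e2 e3)
  have "0 < x * Y i" "0 < x * Y j" "0 < x * Y k" "0 < x * herm2 (Y i) (Y k) (S i k)"
      "0 < x * herm2 (Y j) (Y k) (S j k)"
    "0 < x * herm3 (Y i) (Y j) (Y k) (S i j) (S i k) (S j k)"
    unfolding e[symmetric] e4[symmetric] by (rule P; blast)+
  then have "0 < Y i" "0 < Y j" "0 < Y k" "0 < herm2 (Y i) (Y k) (S i k)"
      "0 < herm2 (Y j) (Y k) (S j k)"
    "0 < herm3 (Y i) (Y j) (Y k) (S i j) (S i k) (S j k)"
    using x by (simp_all add: zero_less_mult_iff)
  note h = herm3_ineqs[OF this]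
  have xx: "0 \<le> x * x" using x by simp
  show "principal_minor A {i,j,k,l} * principal_minor A {k,l}
      \<le> principal_minor A {i,k,l} * principal_minor A {j,k,l}"
    unfolding e e4 using mult_left_mono[OF h(1) xx] by (simp add: mult_ac)
  show "principal_minor A {i,j,l} * principal_minor A {k,l} \<le>
      2 * (principal_minor A {i,k,l} * principal_minor A {j,l}
          + principal_minor A {j,k,l} * principal_minor A {i,l})"
    unfolding e using mult_left_mono[OF h(2) xx] by (simp add: algebra_simps)
qed

definition log_minor :: "complex mat \<Rightarrow> nat set \<Rightarrow> real" where
  "log_minor A S = ln (principal_minor A S)"

text \<open>Up to a factor, this is the total correlation of the components in \<open>S\<close> of a Gaussian vector
  with covariance \<open>A\<close>. It is invariant under diagonal scaling and vanishes on diagonal matrices.\<close>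
definition deficit :: "complex mat \<Rightarrow> nat set \<Rightarrow> real" where
  "deficit A S = (\<Sum>i\<in>S. log_minor A {i}) - log_minor A S"

lemma ln_mult_le:
  fixes a b c d :: real
  shows "a > 0 \<Longrightarrow> b > 0 \<Longrightarrow> c > 0 \<Longrightarrow> d > 0 \<Longrightarrow> a * b \<le> c * d \<Longrightarrow> ln a + ln b \<le> ln c + ln d"
  by (metis ln_le_cancel_iff ln_mult_pos mult_pos_pos)

text \<open>A sum of two terms is at most twice the larger one; together with the factor 2 in the
  hypothesis this gives \<open>ln 4\<close>.\<close>
lemma ln_mult_le_max:
  fixes a b c d e f :: real
  assumes p: "a > 0" "b > 0" "c > 0" "d > 0" "e > 0" "f > 0" and le: "a * b \<le> 2 * (c * d + e * f)"
  shows "ln a + ln b \<le> ln 4 + max (ln c + ln d) (ln e + ln f)"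
proof -
  have "a * b \<le> 4 * max (c * d) (e * f)" using le by simp
  then have "ln (a * b) \<le> ln (4 * max (c * d) (e * f))"
    using p by (intro ln_mono) (auto simp: less_max_iff_disj)
  also have "\<dots> = ln 4 + ln (max (c * d) (e * f))"
    using p by (intro ln_mult_pos) (auto simp: less_max_iff_disj)
  also have "ln (max (c * d) (e * f)) \<le> max (ln (c * d)) (ln (e * f))" by (simp add: max_def)
  finally show ?thesis using p by (simp add: ln_mult_pos)
qed

context
  fixes A n
  assumes pd: "pos_def_mat n A"
begin

lemma deficit_simps:
  "deficit A {i} = 0"
  "i \<noteq> j \<Longrightarrow> deficit A {i,j} = log_minor A {i} + log_minor A {j} - log_minor A {i,j}"
  "distinct [i,j,k] \<Longrightarrow> deficit A {i,j,k} = log_minor A {i} + log_minor A {j} + log_minor A {k}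
      - log_minor A {i,j,k}"
  "distinct [i,j,k,l] \<Longrightarrow> deficit A {i,j,k,l} =
    log_minor A {i} + log_minor A {j} + log_minor A {k} + log_minor A {l} - log_minor A {i,j,k,l}"
  by (auto simp: deficit_def)

lemma minor_pos: "S \<subseteq> {..<n} \<Longrightarrow> principal_minor A S > 0"
  by (rule principal_minor_pos[OF pd])

lemma deficit_ineqs3:
  assumes n: "i < n" "j < n" "k < n" and d: "distinct [i,j,k]"
  shows "0 \<le> deficit A {i,j}"
    and "0 \<le> deficit A {i,j,k} - deficit A {i,k} - deficit A {j,k}"
    and "min (deficit A {i,k}) (deficit A {j,k}) - ln 4 \<le> deficit A {i,j}"
proof -
  note m = pos_def_minor_ineqs3[OF pd n d]
  have P: "principal_minor A S > 0" if "S \<subseteq> {i,j,k}" for S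
    using that n by (intro minor_pos) auto
  have p: "principal_minor A {i} > 0" "principal_minor A {j} > 0" "principal_minor A {k} > 0"
      "principal_minor A {i,j} > 0"
      "principal_minor A {i,k} > 0" "principal_minor A {j,k} > 0" "principal_minor A {i,j,k} > 0"
    by (rule P; blast)+
  have dd: "i \<noteq> j" "i \<noteq> k" "j \<noteq> k" using d by auto
  note s = deficit_simps(2)[OF dd(1)] deficit_simps(2)[OF dd(2)] deficit_simps(2)[OF dd(3)]
      deficit_simps(3)[OF d] log_minor_def
  have "ln (principal_minor A {i,j}) \<le> ln (principal_minor A {i}) + ln (principal_minor A {j})"
    using ln_mult_le[of "principal_minor A {i,j}" 1 "principal_minor A {i}" "principal_minor A
        {j}"] p m(1) by simp
  then show "0 \<le> deficit A {i,j}" unfolding s by linarith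
  show "0 \<le> deficit A {i,j,k} - deficit A {i,k} - deficit A {j,k}"
    using ln_mult_le[OF p(7,3,5,6) m(2)] unfolding s by linarith
  show "min (deficit A {i,k}) (deficit A {j,k}) - ln 4 \<le> deficit A {i,j}"
    using ln_mult_le_max[OF p(4,3,5,2,6,1) m(3)] unfolding s by linarith
qed

lemma deficit_ineqs4:
  assumes n: "i < n" "j < n" "k < n" "l < n" and d: "distinct [i,j,k,l]"
  shows "0 \<le> deficit A {i,j,k,l} - deficit A {i,k,l} - deficit A {j,k,l} + deficit A {k,l}"
    and "min (deficit A {i,k,l} - deficit A {i,l} - deficit A {k,l}) (deficit A {j,k,l}
        - deficit A {j,l} - deficit A {k,l}) - ln 4
      \<le> deficit A {i,j,l} - deficit A {i,l} - deficit A {j,l}"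
proof -
  note m = pos_def_minor_ineqs4[OF pd n d]
  have P: "principal_minor A S > 0" if "S \<subseteq> {i,j,k,l}" for S
    using that n by (intro minor_pos) auto
  have p: "principal_minor A {i,l} > 0" "principal_minor A {j,l} > 0"
      "principal_minor A {k,l} > 0" "principal_minor A {i,j,l} > 0"
      "principal_minor A {i,k,l} > 0" "principal_minor A {j,k,l} > 0"
          "principal_minor A {i,j,k,l} > 0"
    by (rule P; blast)+
  have dd: "i \<noteq> l" "j \<noteq> l" "k \<noteq> l" "distinct [i,j,l]" "distinct [i,k,l]" "distinct [j,k,l]"
      using d by auto
  note s = deficit_simps(2)[OF dd(1)] deficit_simps(2)[OF dd(2)] deficit_simps(2)[OF dd(3)]
    deficit_simps(3)[OF dd(4)] deficit_simps(3)[OF dd(5)] deficit_simps(3)[OF dd(6)]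
        deficit_simps(4)[OF d] log_minor_def
  show "0 \<le> deficit A {i,j,k,l} - deficit A {i,k,l} - deficit A {j,k,l} + deficit A {k,l}"
    using ln_mult_le[OF p(7,3,5,6) m(1)] unfolding s by linarith
  show "min (deficit A {i,k,l} - deficit A {i,l} - deficit A {k,l}) (deficit A {j,k,l}
      - deficit A {j,l} - deficit A {k,l}) - ln 4
      \<le> deficit A {i,j,l} - deficit A {i,l} - deficit A {j,l}"
    using ln_mult_le_max[OF p(4,3,5,2,6,1) m(2)] unfolding s by linarith
qed

lemma deficit_ultra3:
  assumes n: "i < n" "j < n" "k < n" and d: "distinct [i,j,k]"
  shows "almost_ultrametric (ln 4) (deficit A {i,j}) (deficit A {i,k}) (deficit A {j,k})"
proof -
  have d2: "distinct [i,k,j]" "distinct [j,k,i]" using d by auto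
  show ?thesis
    using deficit_ineqs3(3)[OF n d] deficit_ineqs3(3)[OF n(1,3,2) d2(1)] deficit_ineqs3(3)[OF
        n(2,3,1) d2(2)]
    unfolding almost_ultrametric_def insert_commute[of j i] insert_commute[of k i]
        insert_commute[of k j]
    by (simp add: min.commute)
qed

lemma deficit_ultra4:
  assumes n: "i < n" "j < n" "k < n" "l < n" and d: "distinct [i,j,k,l]"
  shows "almost_ultrametric (ln 4) (deficit A {i,j,l} - deficit A {i,l} - deficit A {j,l})
     (deficit A {i,k,l} - deficit A {i,l} - deficit A {k,l}) (deficit A {j,k,l} - deficit A {j,l}
         - deficit A {k,l})"
proof -
  have d2: "distinct [i,k,j,l]" "distinct [j,k,i,l]" using d by auto
  have c: "{j,i,l} = {i,j,l}" "{k,i,l} = {i,k,l}" "{k,j,l} = {j,k,l}" by auto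
  show ?thesis
    using deficit_ineqs4(2)[OF n d] deficit_ineqs4(2)[OF n(1,3,2,4) d2(1)] deficit_ineqs4(2)[OF
        n(2,3,1,4) d2(2)]
    unfolding almost_ultrametric_def c by (simp add: min.commute algebra_simps)
qed

end

lemma near_model_deficit:
  assumes pd: "pos_def_mat n A" and n: "i < n" "j < n" "k < n" "l < n" and d: "distinct [i,j,k,l]"
  and ord: "deficit A {i,j} \<ge> deficit A {i,k}" "deficit A {i,j} \<ge> deficit A {j,k}"
    "deficit A {i,j} \<ge> deficit A {i,l}" "deficit A {i,j} \<ge> deficit A {j,l}"
  and shape: "(\<forall>S \<in> {{j,k},{i,l},{j,l},{k,l}}. deficit A S \<le> deficit A {i,k}) \<or>
     (\<forall>S \<in> {{i,k},{j,k},{i,l},{j,l}}. deficit A S \<le> deficit A {k,l})"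
  shows "near_model (30 * ln 4) (deficit A {i,j}) (deficit A {i,k}) (deficit A {j,k}) (deficit A
      {i,l}) (deficit A {j,l})
     (deficit A {k,l}) (deficit A {i,j,k}) (deficit A {i,j,l}) (deficit A {i,k,l}) (deficit A
         {j,k,l}) (deficit A {i,j,k,l})"
proof -
  have dd: "i \<noteq> j" "i \<noteq> k" "i \<noteq> l" "j \<noteq> k" "j \<noteq> l" "k \<noteq> l" using d by auto
  have c2: "{j,i} = {i,j}" "{k,i} = {i,k}" "{l,i} = {i,l}" "{k,j} = {j,k}" "{l,j} = {j,l}"
      "{l,k} = {k,l}" by auto
  have c3: "{i,k,j} = {i,j,k}" "{j,i,k} = {i,j,k}" "{j,k,i} = {i,j,k}" "{k,i,j} = {i,j,k}"
      "{k,j,i} = {i,j,k}"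
    "{i,l,j} = {i,j,l}" "{j,i,l} = {i,j,l}" "{j,l,i} = {i,j,l}" "{l,i,j} = {i,j,l}"
        "{l,j,i} = {i,j,l}"
    "{i,l,k} = {i,k,l}" "{k,i,l} = {i,k,l}" "{k,l,i} = {i,k,l}" "{l,i,k} = {i,k,l}"
        "{l,k,i} = {i,k,l}"
    "{j,l,k} = {j,k,l}" "{k,j,l} = {j,k,l}" "{k,l,j} = {j,k,l}" "{l,j,k} = {j,k,l}"
        "{l,k,j} = {j,k,l}" by auto
  have c4: "{l,i,j,k} = {i,j,k,l}" "{k,i,j,l} = {i,j,k,l}" "{j,i,k,l} = {i,j,k,l}"
      "{i,k,j,l} = {i,j,k,l}" "{i,l,j,k} = {i,j,k,l}" "{j,k,i,l} = {i,j,k,l}"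
      "{j,l,i,k} = {i,j,k,l}" "{k,l,i,j} = {i,j,k,l}"
    "{j,k,l,i} = {i,j,k,l}" "{i,k,l,j} = {i,j,k,l}" "{i,j,l,k} = {i,j,k,l}"
        "{i,l,k,j} = {i,j,k,l}" by auto
  note c = c2 c3 c4
  note q4 = deficit_ineqs4(1)[OF pd] and q3 = deficit_ineqs3(2)[OF pd]
      and u3 = deficit_ultra3[OF pd] and u4 = deficit_ultra4[OF pd]
  show ?thesis
  proof (rule near_model_of_ultrametrics)
    show "0 \<le> ln (4::real)" by simp
    show "deficit A {i, j, k, l} - deficit A {i,j,l} - deficit A {i,j,k} + deficit A {i,j} \<ge> 0"
      using q4[of k l i j] n dd unfolding c by (simp add: algebra_simps)
    show "deficit A {i, j, k, l} - deficit A {i,j,k} - deficit A {i,k,l} + deficit A {i,k} \<ge> 0"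
      using q4[of j l i k] n dd unfolding c by (simp add: algebra_simps)
    show "deficit A {i, j, k, l} - deficit A {i,j,k} - deficit A {j,k,l} + deficit A {j,k} \<ge> 0"
      using q4[of i l j k] n dd unfolding c by (simp add: algebra_simps)
    show "deficit A {i, j, k, l} - deficit A {i,j,l} - deficit A {i,k,l} + deficit A {i,l} \<ge> 0"
      using q4[of j k i l] n dd unfolding c by (simp add: algebra_simps)
    show "deficit A {i, j, k, l} - deficit A {i,j,l} - deficit A {j,k,l} + deficit A {j,l} \<ge> 0"
      using q4[of i k j l] n dd unfolding c by (simp add: algebra_simps)
    show "deficit A {i,l} \<ge> 0" using deficit_ineqs3(1)[OF pd, of i l j] n dd by simp
    show "0 \<le> deficit A {i,j,k} - deficit A {i,j} - deficit A {i,k}" using q3[of j k i] n dd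
        unfolding c by simp
    show "0 \<le> deficit A {i,j,l} - deficit A {i,j} - deficit A {i,l}" using q3[of j l i] n dd
        unfolding c by simp
    show "0 \<le> deficit A {i,k,l} - deficit A {i,l} - deficit A {k,l}" using q3[of i k l] n dd
        unfolding c by simp
    show "almost_ultrametric (ln 4) (deficit A {i,j}) (deficit A {i,k}) (deficit A {j,k})"
        using u3[of i j k] n dd by simp
    show "almost_ultrametric (ln 4) (deficit A {i,j}) (deficit A {i,l}) (deficit A {j,l})"
        using u3[of i j l] n dd by simp
    show "almost_ultrametric (ln 4) (deficit A {i,k}) (deficit A {i,l}) (deficit A {k,l})"
        using u3[of i k l] n dd by simp
    show "almost_ultrametric (ln 4) (deficit A {j,k}) (deficit A {j,l}) (deficit A {k,l})"
        using u3[of j k l] n dd by simp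
    show "almost_ultrametric (ln 4) (deficit A {i,j,k} - deficit A {i,j} - deficit A {i,k})
       (deficit A {i,j,l} - deficit A {i,j} - deficit A {i,l}) (deficit A {i,k,l}
           - deficit A {i,k} - deficit A {i,l})"
      using u4[of j k l i] n dd unfolding c by simp
    show "almost_ultrametric (ln 4) (deficit A {i,j,k} - deficit A {i,j} - deficit A {j,k})
       (deficit A {i,j,l} - deficit A {i,j} - deficit A {j,l}) (deficit A {j,k,l}
           - deficit A {j,k} - deficit A {j,l})"
      using u4[of i k l j] n dd unfolding c by simp
    show "almost_ultrametric (ln 4) (deficit A {i,j,k} - deficit A {i,k} - deficit A {j,k})
       (deficit A {i,k,l} - deficit A {i,k} - deficit A {k,l}) (deficit A {j,k,l}
           - deficit A {j,k} - deficit A {k,l})"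
      using u4[of i j l k] n dd unfolding c by simp
    show "almost_ultrametric (ln 4) (deficit A {i,j,l} - deficit A {i,l} - deficit A {j,l})
       (deficit A {i,k,l} - deficit A {i,l} - deficit A {k,l}) (deficit A {j,k,l}
           - deficit A {j,l} - deficit A {k,l})"
      using u4[of i j k l] n dd unfolding c by simp
    show "deficit A {i,k} \<le> deficit A {i,j}" "deficit A {j,k} \<le> deficit A {i,j}"
        "deficit A {i,l} \<le> deficit A {i,j}" "deficit A {j,l} \<le> deficit A {i,j}"
      using ord by auto
    show "deficit A {j, k} \<le> deficit A {i, k} \<and> deficit A {i, l} \<le> deficit A {i, k} \<and>
        deficit A {j, l} \<le> deficit A {i, k} \<and> deficit A {k, l} \<le> deficit A {i, k} \<or>
      deficit A {i, k} \<le> deficit A {k, l} \<and> deficit A {j, k} \<le> deficit A {k, l} \<and>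
          deficit A {i, l} \<le> deficit A {k, l} \<and> deficit A {j, l} \<le> deficit A {k, l}"
      using shape by auto
  qed
qed

section \<open>Nullity types of configurations of four vectors\<close>

definition dot3 :: "real list \<Rightarrow> real list \<Rightarrow> real" where
  "dot3 a b = (\<Sum>r<3. a ! r * b ! r)"

text \<open>The columns are the vectors \<open>a, b, c\<close> in the places \<open>i, j, k\<close> and \<open>d\<close> in the remaining
  place.\<close>
definition config_mat :: "nat \<Rightarrow> nat \<Rightarrow> nat \<Rightarrow> real list \<Rightarrow> real list \<Rightarrow> real list \<Rightarrow> real list \<Rightarrow>
    complex mat" where
  "config_mat i j k a b c d =
     mat 3 4 (\<lambda>(r, s). complex_of_real ((if s = i then a else if s = j then b else
         if s = k then c else d) ! r))"

lemma config_mat_dim [simp]: "dim_row (config_mat i j k a b c d) = 3"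
    "dim_col (config_mat i j k a b c d) = 4"
  by (simp_all add: config_mat_def)

lemma herm2_of_real: "herm2 x y (of_real p) = x * y - p\<^sup>2"
  by (simp add: herm2_def)

lemma herm3_of_real: "herm3 x y z (of_real p) (of_real q) (of_real r)
    = x * y * z + 2 * (p * q * r) - x * r\<^sup>2 - y * q\<^sup>2 - z * p\<^sup>2"
  by (simp add: herm3_def)

text \<open>The determinant of the real symmetric matrix with diagonal \<open>x, y, z, w\<close> and the upper
  entries \<open>p, q, r\<close>, \<open>s, t\<close>, \<open>u\<close> row by row.\<close>
definition det4 :: "real \<Rightarrow> real \<Rightarrow> real \<Rightarrow> real \<Rightarrow> real \<Rightarrow> real \<Rightarrow> real \<Rightarrow> real \<Rightarrow> real \<Rightarrow> real \<Rightarrow>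
    real" where
  "det4 x y z w p q r s t u = x * y * z * w - x * y * u\<^sup>2 - x * z * t\<^sup>2 - x * w * s\<^sup>2 - y * z * r\<^sup>2
      - y * w * q\<^sup>2 - z * w * p\<^sup>2
     + (p * u)\<^sup>2 + (q * t)\<^sup>2 + (r * s)\<^sup>2 + 2 * (x * s * t * u + y * q * r * u + z * p * r * t
         + w * p * q * s)
     - 2 * (p * s * u * r + p * t * u * q + q * s * t * r)"

lemma herm4_of_real:
  assumes "x \<noteq> 0"
  shows "herm4 x y z w (of_real p) (of_real q) (of_real r) (of_real s) (of_real t) (of_real u)
      = det4 x y z w p q r s t u"
proof -
  have e: "complex_of_real a - cnj (of_real b) * of_real c / of_real x = of_real (a - b * c / x)"
      for a b c by simp
  define P Q R where "P = p / x" and "Q = q / x" and "R = r / x"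
  have P: "p = x * P" and Q: "q = x * Q" and R: "r = x * R" using assms
      by (simp_all add: P_def Q_def R_def)
  have f: "(x * a)\<^sup>2 / x = x * a\<^sup>2" "(x * a) * (x * b) / x = x * a * b" for a b
    using assms by (simp_all add: power2_eq_square)
  show ?thesis
    unfolding herm4_def e herm3_of_real norm_of_real power2_abs unfolding P Q R f
    by (simp add: det4_def power2_eq_square algebra_simps)
qed

lemma set_four:
  assumes "i < 4" "j < 4" "k < 4" "l < (4::nat)" "distinct [i,j,k,l]"
  shows "{..<4} = {i,j,k,l}"
  using assms by (intro card_subset_eq[symmetric]) auto

lemma sum_Pow_insert:
  assumes "finite A" "a \<notin> A"
  shows "(\<Sum>S\<in>Pow (insert a A). h S) = (\<Sum>S\<in>Pow A. h S) + (\<Sum>S\<in>Pow A. h (insert a S))"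
proof -
  have "inj_on (insert a) (Pow A)" using assms(2) by (auto simp: inj_on_def)
  then show ?thesis
    unfolding Pow_insert using assms by (subst sum.union_disjoint) (auto simp: sum.reindex)
qed

lemma sum_Pow_four:
  fixes h :: "nat set \<Rightarrow> real"
  assumes "distinct [i,j,k,l]"
  shows "(\<Sum>S\<in>Pow {i,j,k,l}. h S) = h {} + h {i} + h {j} + h {k} + h {l}
    + h {i,j} + h {i,k} + h {j,k} + h {i,l} + h {j,l} + h {k,l}
    + h {i,j,k} + h {i,j,l} + h {i,k,l} + h {j,k,l} + h {i,j,k,l}"
  using assms by (simp add: sum_Pow_insert)

text \<open>The exponent of the leading power of \<open>\<epsilon>\<close> is unique, so a nullity can be read off from any
  expression for the minor.\<close>
lemma nullity_type_from_limit:
  assumes T: "T \<subseteq> {..<dim_col M}"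
    and eq: "\<And>\<epsilon>. \<epsilon> > 0 \<Longrightarrow> principal_minor (gram_mat M \<epsilon>) T = f \<epsilon>"
    and lim: "((\<lambda>\<epsilon>. f \<epsilon> / \<epsilon> ^ n) \<longlongrightarrow> L) (at_right 0)" and L: "L > 0"
  shows "nullity_type M T = real n"
proof -
  obtain k es where k: "nullity_type M T = real k" and es: "\<forall>e\<in>set es. e > 0"
    and m: "\<And>\<epsilon>. principal_minor (gram_mat M \<epsilon>) T = \<epsilon> ^ k * (\<Prod>e\<leftarrow>es. e + \<epsilon>)"
    using principal_minor_gram_mat[OF T] by metis
  define R where "R = (\<lambda>\<epsilon>::real. \<Prod>e\<leftarrow>es. e + \<epsilon>)"
  have "(R \<longlongrightarrow> prod_list es) (at_right 0)"
    unfolding R_def by (induction es) (auto intro!: tendsto_eq_intros)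
  moreover have "prod_list es > 0" using es by (induction es) auto
  ultimately have R: "(R \<longlongrightarrow> prod_list es) (at_right 0)" and R0: "prod_list es > 0" .
  have lim2: "((\<lambda>\<epsilon>. \<epsilon> ^ k * R \<epsilon> / \<epsilon> ^ n) \<longlongrightarrow> L) (at_right 0)"
    by (rule Lim_transform_eventually[OF lim])
      (auto simp: eventually_at_right_less R_def m[symmetric] eq intro: eventually_mono[OF
          eventually_at_right_less])
  consider "k = n" | "n < k" | "k < n" by linarith
  then have "k = n"
  proof cases
    case 2
    have "((\<lambda>\<epsilon>. \<epsilon> ^ (k - n) * R \<epsilon>) \<longlongrightarrow> 0 ^ (k - n) * prod_list es) (at_right 0)"
      by (intro tendsto_intros R)
    moreover have "((\<lambda>\<epsilon>. \<epsilon> ^ (k - n) * R \<epsilon>) \<longlongrightarrow> L) (at_right 0)"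
      by (rule Lim_transform_eventually[OF lim2])
        (use 2 in \<open>auto simp: power_diff intro!: eventually_mono[OF eventually_at_right_less]\<close>)
    ultimately have "L = 0 ^ (k - n) * prod_list es"
        by (intro tendsto_unique[of "at_right 0"]) auto
    then show ?thesis using 2 L by (simp add: power_0_left)
  next
    case 3
    have "((\<lambda>\<epsilon>. \<epsilon> ^ (n - k) * (\<epsilon> ^ k * R \<epsilon> / \<epsilon> ^ n)) \<longlongrightarrow> 0 ^ (n - k) * L) (at_right 0)"
      by (intro tendsto_intros lim2)
    moreover have "((\<lambda>\<epsilon>. \<epsilon> ^ (n - k) * (\<epsilon> ^ k * R \<epsilon> / \<epsilon> ^ n)) \<longlongrightarrow> prod_list es) (at_right 0)"
      by (rule Lim_transform_eventually[OF R])
        (use 3 in \<open>auto simp: power_diff intro!: eventually_mono[OF eventually_at_right_less]\<close>)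
    ultimately have "prod_list es = 0 ^ (n - k) * L"
        by (intro tendsto_unique[of "at_right 0"]) auto
    then show ?thesis using 3 R0 by (simp add: power_0_left del: prod_list_zero_iff)
  qed
  then show ?thesis using k by simp
qed

context
  fixes i j k l :: nat and a b c d :: "real list"
  assumes lt: "i < 4" "j < 4" "k < 4" "l < 4" and dist: "distinct [i,j,k,l]"
begin

lemma gram_config_index:
  fixes v
  defines "v \<equiv> \<lambda>s. if s = i then a else if s = j then b else if s = k then c else d"
  assumes "s < 4" "t < 4"
  shows "gram_mat (config_mat i j k a b c d) \<epsilon> $$ (s, t)
      = complex_of_real (dot3 (v s) (v t) + (if s = t then \<epsilon> else 0))"
  using assms by (simp add: gram_mat_index dot3_def v_def config_mat_def)

lemma gram_config_minors:
  fixes \<epsilon> :: real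
  defines "G \<equiv> gram_mat (config_mat i j k a b c d) \<epsilon>"
  shows "principal_minor G {i} = dot3 a a + \<epsilon>" "principal_minor G {j} = dot3 b b + \<epsilon>"
    "principal_minor G {k} = dot3 c c + \<epsilon>" "principal_minor G {l} = dot3 d d + \<epsilon>"
    "principal_minor G {i,j} = (dot3 a a + \<epsilon>) * (dot3 b b + \<epsilon>) - (dot3 a b)\<^sup>2"
    "principal_minor G {i,k} = (dot3 a a + \<epsilon>) * (dot3 c c + \<epsilon>) - (dot3 a c)\<^sup>2"
    "principal_minor G {j,k} = (dot3 b b + \<epsilon>) * (dot3 c c + \<epsilon>) - (dot3 b c)\<^sup>2"
    "principal_minor G {i,l} = (dot3 a a + \<epsilon>) * (dot3 d d + \<epsilon>) - (dot3 a d)\<^sup>2"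
    "principal_minor G {j,l} = (dot3 b b + \<epsilon>) * (dot3 d d + \<epsilon>) - (dot3 b d)\<^sup>2"
    "principal_minor G {k,l} = (dot3 c c + \<epsilon>) * (dot3 d d + \<epsilon>) - (dot3 c d)\<^sup>2"
    "principal_minor G {i,j,k} = (dot3 a a + \<epsilon>) * (dot3 b b + \<epsilon>) * (dot3 c c + \<epsilon>)
        + 2 * (dot3 a b * dot3 a c * dot3 b c)
      - (dot3 a a + \<epsilon>) * (dot3 b c)\<^sup>2 - (dot3 b b + \<epsilon>) * (dot3 a c)\<^sup>2 - (dot3 c c
          + \<epsilon>) * (dot3 a b)\<^sup>2"
    "principal_minor G {i,j,l} = (dot3 a a + \<epsilon>) * (dot3 b b + \<epsilon>) * (dot3 d d + \<epsilon>)
        + 2 * (dot3 a b * dot3 a d * dot3 b d)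
      - (dot3 a a + \<epsilon>) * (dot3 b d)\<^sup>2 - (dot3 b b + \<epsilon>) * (dot3 a d)\<^sup>2 - (dot3 d d
          + \<epsilon>) * (dot3 a b)\<^sup>2"
    "principal_minor G {i,k,l} = (dot3 a a + \<epsilon>) * (dot3 c c + \<epsilon>) * (dot3 d d + \<epsilon>)
        + 2 * (dot3 a c * dot3 a d * dot3 c d)
      - (dot3 a a + \<epsilon>) * (dot3 c d)\<^sup>2 - (dot3 c c + \<epsilon>) * (dot3 a d)\<^sup>2 - (dot3 d d
          + \<epsilon>) * (dot3 a c)\<^sup>2"
    "principal_minor G {j,k,l} = (dot3 b b + \<epsilon>) * (dot3 c c + \<epsilon>) * (dot3 d d + \<epsilon>)
        + 2 * (dot3 b c * dot3 b d * dot3 c d)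
      - (dot3 b b + \<epsilon>) * (dot3 c d)\<^sup>2 - (dot3 c c + \<epsilon>) * (dot3 b d)\<^sup>2 - (dot3 d d
          + \<epsilon>) * (dot3 b c)\<^sup>2"
    "\<epsilon> > 0 \<Longrightarrow> dot3 a a \<ge> 0 \<Longrightarrow> principal_minor G {i,j,k,l}
        = det4 (dot3 a a + \<epsilon>) (dot3 b b + \<epsilon>) (dot3 c c + \<epsilon>) (dot3 d d + \<epsilon>)
      (dot3 a b) (dot3 a c) (dot3 a d) (dot3 b c) (dot3 b d) (dot3 c d)"
proof -
  have G: "G \<in> carrier_mat 4 4" using gram_mat_carrier[of "config_mat i j k a b c d" \<epsilon>]
      by (simp add: G_def)
  have adj: "mat_adjoint G = G"
    by (rule mat_adjoint_eqI[OF G]) (auto simp: G_def gram_config_index dot3_def mult.commute)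
  note m = hermitian_minors[OF G adj]
  have e: "G $$ (i,i) = of_real (dot3 a a + \<epsilon>)" "G $$ (j,j) = of_real (dot3 b b + \<epsilon>)"
    "G $$ (k,k) = of_real (dot3 c c + \<epsilon>)" "G $$ (l,l) = of_real (dot3 d d + \<epsilon>)"
    "G $$ (i,j) = of_real (dot3 a b)" "G $$ (i,k) = of_real (dot3 a c)"
        "G $$ (i,l) = of_real (dot3 a d)"
    "G $$ (j,k) = of_real (dot3 b c)" "G $$ (j,l) = of_real (dot3 b d)"
        "G $$ (k,l) = of_real (dot3 c d)"
    using lt dist by (auto simp: G_def gram_config_index)
  show "principal_minor G {i} = dot3 a a + \<epsilon>" using lt by (simp add: m(1) e)
  show "principal_minor G {j} = dot3 b b + \<epsilon>" using lt by (simp add: m(1) e)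
  show "principal_minor G {k} = dot3 c c + \<epsilon>" using lt by (simp add: m(1) e)
  show "principal_minor G {l} = dot3 d d + \<epsilon>" using lt by (simp add: m(1) e)
  show "principal_minor G {i,j} = (dot3 a a + \<epsilon>) * (dot3 b b + \<epsilon>) - (dot3 a b)\<^sup>2"
    using lt dist by (simp add: m(2) e herm2_of_real del: of_real_add)
  show "principal_minor G {i,k} = (dot3 a a + \<epsilon>) * (dot3 c c + \<epsilon>) - (dot3 a c)\<^sup>2"
    using lt dist by (simp add: m(2) e herm2_of_real del: of_real_add)
  show "principal_minor G {j,k} = (dot3 b b + \<epsilon>) * (dot3 c c + \<epsilon>) - (dot3 b c)\<^sup>2"
    using lt dist by (simp add: m(2) e herm2_of_real del: of_real_add)
  show "principal_minor G {i,l} = (dot3 a a + \<epsilon>) * (dot3 d d + \<epsilon>) - (dot3 a d)\<^sup>2"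
    using lt dist by (simp add: m(2) e herm2_of_real del: of_real_add)
  show "principal_minor G {j,l} = (dot3 b b + \<epsilon>) * (dot3 d d + \<epsilon>) - (dot3 b d)\<^sup>2"
    using lt dist by (simp add: m(2) e herm2_of_real del: of_real_add)
  show "principal_minor G {k,l} = (dot3 c c + \<epsilon>) * (dot3 d d + \<epsilon>) - (dot3 c d)\<^sup>2"
    using lt dist by (simp add: m(2) e herm2_of_real del: of_real_add)
  show "principal_minor G {i,j,k} = (dot3 a a + \<epsilon>) * (dot3 b b + \<epsilon>) * (dot3 c c + \<epsilon>)
      + 2 * (dot3 a b * dot3 a c * dot3 b c)
      - (dot3 a a + \<epsilon>) * (dot3 b c)\<^sup>2 - (dot3 b b + \<epsilon>) * (dot3 a c)\<^sup>2 - (dot3 c c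
          + \<epsilon>) * (dot3 a b)\<^sup>2"
    using lt dist by (simp add: m(3) e herm3_of_real del: of_real_add)
  show "principal_minor G {i,j,l} = (dot3 a a + \<epsilon>) * (dot3 b b + \<epsilon>) * (dot3 d d + \<epsilon>)
      + 2 * (dot3 a b * dot3 a d * dot3 b d)
      - (dot3 a a + \<epsilon>) * (dot3 b d)\<^sup>2 - (dot3 b b + \<epsilon>) * (dot3 a d)\<^sup>2 - (dot3 d d
          + \<epsilon>) * (dot3 a b)\<^sup>2"
    using lt dist by (simp add: m(3) e herm3_of_real del: of_real_add)
  show "principal_minor G {i,k,l} = (dot3 a a + \<epsilon>) * (dot3 c c + \<epsilon>) * (dot3 d d + \<epsilon>)
      + 2 * (dot3 a c * dot3 a d * dot3 c d)
      - (dot3 a a + \<epsilon>) * (dot3 c d)\<^sup>2 - (dot3 c c + \<epsilon>) * (dot3 a d)\<^sup>2 - (dot3 d d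
          + \<epsilon>) * (dot3 a c)\<^sup>2"
    using lt dist by (simp add: m(3) e herm3_of_real del: of_real_add)
  show "principal_minor G {j,k,l} = (dot3 b b + \<epsilon>) * (dot3 c c + \<epsilon>) * (dot3 d d + \<epsilon>)
      + 2 * (dot3 b c * dot3 b d * dot3 c d)
      - (dot3 b b + \<epsilon>) * (dot3 c d)\<^sup>2 - (dot3 c c + \<epsilon>) * (dot3 b d)\<^sup>2 - (dot3 d d
          + \<epsilon>) * (dot3 b c)\<^sup>2"
    using lt dist by (simp add: m(3) e herm3_of_real del: of_real_add)
  show "principal_minor G {i,j,k,l} = det4 (dot3 a a + \<epsilon>) (dot3 b b + \<epsilon>) (dot3 c c + \<epsilon>) (dot3 d d
      + \<epsilon>)
      (dot3 a b) (dot3 a c) (dot3 a d) (dot3 b c) (dot3 b d) (dot3 c d)"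
    if "\<epsilon> > 0" "dot3 a a \<ge> 0"
    using lt dist that by (simp add: m(4) e herm4_of_real del: of_real_add)
qed

text \<open>The numbers \<open>n\<close> are the nullities of the configuration and the numbers \<open>L\<close> are the leading
  coefficients of its minors as \<open>\<epsilon> \<rightarrow> 0\<close>.\<close>
lemma config_pairing:
  fixes w :: "nat set \<Rightarrow> real"
  assumes nonneg: "\<And>M. dim_col M = 4 \<Longrightarrow> 0 \<le> (\<Sum>T\<in>Pow {..<4}. w T * nullity_type M T)"
    and pos: "dot3 a a > 0" "dot3 b b > 0" "dot3 c c > 0" "dot3 d d > 0"
    and Lij: "((\<lambda>\<epsilon>. ((dot3 a a + \<epsilon>) * (dot3 b b + \<epsilon>)
        - (dot3 a b)\<^sup>2) / \<epsilon> ^ nij) \<longlongrightarrow> Lij) (at_right 0)" "Lij > 0"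
    and Lik: "((\<lambda>\<epsilon>. ((dot3 a a + \<epsilon>) * (dot3 c c + \<epsilon>)
        - (dot3 a c)\<^sup>2) / \<epsilon> ^ nik) \<longlongrightarrow> Lik) (at_right 0)" "Lik > 0"
    and Ljk: "((\<lambda>\<epsilon>. ((dot3 b b + \<epsilon>) * (dot3 c c + \<epsilon>)
        - (dot3 b c)\<^sup>2) / \<epsilon> ^ njk) \<longlongrightarrow> Ljk) (at_right 0)" "Ljk > 0"
    and Lil: "((\<lambda>\<epsilon>. ((dot3 a a + \<epsilon>) * (dot3 d d + \<epsilon>)
        - (dot3 a d)\<^sup>2) / \<epsilon> ^ nil) \<longlongrightarrow> Lil) (at_right 0)" "Lil > 0"
    and Ljl: "((\<lambda>\<epsilon>. ((dot3 b b + \<epsilon>) * (dot3 d d + \<epsilon>)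
        - (dot3 b d)\<^sup>2) / \<epsilon> ^ njl) \<longlongrightarrow> Ljl) (at_right 0)" "Ljl > 0"
    and Lkl: "((\<lambda>\<epsilon>. ((dot3 c c + \<epsilon>) * (dot3 d d + \<epsilon>)
        - (dot3 c d)\<^sup>2) / \<epsilon> ^ nkl) \<longlongrightarrow> Lkl) (at_right 0)" "Lkl > 0"
    and Lijk: "((\<lambda>\<epsilon>. ((dot3 a a + \<epsilon>) * (dot3 b b + \<epsilon>) * (dot3 c c + \<epsilon>)
        + 2 * (dot3 a b * dot3 a c * dot3 b c)
      - (dot3 a a + \<epsilon>) * (dot3 b c)\<^sup>2 - (dot3 b b + \<epsilon>) * (dot3 a c)\<^sup>2 - (dot3 c c
          + \<epsilon>) * (dot3 a b)\<^sup>2) / \<epsilon> ^ nijk) \<longlongrightarrow> Lijk) (at_right 0)" "Lijk > 0"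
    and Lijl: "((\<lambda>\<epsilon>. ((dot3 a a + \<epsilon>) * (dot3 b b + \<epsilon>) * (dot3 d d + \<epsilon>)
        + 2 * (dot3 a b * dot3 a d * dot3 b d)
      - (dot3 a a + \<epsilon>) * (dot3 b d)\<^sup>2 - (dot3 b b + \<epsilon>) * (dot3 a d)\<^sup>2 - (dot3 d d
          + \<epsilon>) * (dot3 a b)\<^sup>2) / \<epsilon> ^ nijl) \<longlongrightarrow> Lijl) (at_right 0)" "Lijl > 0"
    and Likl: "((\<lambda>\<epsilon>. ((dot3 a a + \<epsilon>) * (dot3 c c + \<epsilon>) * (dot3 d d + \<epsilon>)
        + 2 * (dot3 a c * dot3 a d * dot3 c d)
      - (dot3 a a + \<epsilon>) * (dot3 c d)\<^sup>2 - (dot3 c c + \<epsilon>) * (dot3 a d)\<^sup>2 - (dot3 d d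
          + \<epsilon>) * (dot3 a c)\<^sup>2) / \<epsilon> ^ nikl) \<longlongrightarrow> Likl) (at_right 0)" "Likl > 0"
    and Ljkl: "((\<lambda>\<epsilon>. ((dot3 b b + \<epsilon>) * (dot3 c c + \<epsilon>) * (dot3 d d + \<epsilon>)
        + 2 * (dot3 b c * dot3 b d * dot3 c d)
      - (dot3 b b + \<epsilon>) * (dot3 c d)\<^sup>2 - (dot3 c c + \<epsilon>) * (dot3 b d)\<^sup>2 - (dot3 d d
          + \<epsilon>) * (dot3 b c)\<^sup>2) / \<epsilon> ^ njkl) \<longlongrightarrow> Ljkl) (at_right 0)" "Ljkl > 0"
    and Lijkl: "((\<lambda>\<epsilon>. (det4 (dot3 a a + \<epsilon>) (dot3 b b + \<epsilon>) (dot3 c c + \<epsilon>) (dot3 d d + \<epsilon>)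
      (dot3 a b) (dot3 a c) (dot3 a d) (dot3 b c) (dot3 b d) (dot3 c d)) / \<epsilon> ^ nijkl) \<longlongrightarrow> Lijkl)
          (at_right 0)" "Lijkl > 0"
  shows "0 \<le> real nij * w {i,j} + real nik * w {i,k} + real njk * w {j,k} + real nil * w {i,l}
      + real njl * w {j,l} + real nkl * w {k,l} + real nijk * w {i,j,k} + real nijl * w {i,j,l}
      + real nikl * w {i,k,l} + real njkl * w {j,k,l} + real nijkl * w {i,j,k,l}"
proof -
  let ?M = "config_mat i j k a b c d"
  note gm = gram_config_minors
  have dd: "dot3 a a \<ge> 0" using pos by simp
  have "((\<lambda>\<epsilon>. (dot3 a a + \<epsilon>) / \<epsilon> ^ 0) \<longlongrightarrow> dot3 a a) (at_right 0)"
    by (auto intro!: tendsto_eq_intros)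
  then have ni: "nullity_type ?M {i} = real 0"
    by (rule nullity_type_from_limit[OF _ gm(1) _ pos(1), rotated]) (use lt in auto)
  have "((\<lambda>\<epsilon>. (dot3 b b + \<epsilon>) / \<epsilon> ^ 0) \<longlongrightarrow> dot3 b b) (at_right 0)"
    by (auto intro!: tendsto_eq_intros)
  then have nj: "nullity_type ?M {j} = real 0"
    by (rule nullity_type_from_limit[OF _ gm(2) _ pos(2), rotated]) (use lt in auto)
  have "((\<lambda>\<epsilon>. (dot3 c c + \<epsilon>) / \<epsilon> ^ 0) \<longlongrightarrow> dot3 c c) (at_right 0)"
    by (auto intro!: tendsto_eq_intros)
  then have nk: "nullity_type ?M {k} = real 0"
    by (rule nullity_type_from_limit[OF _ gm(3) _ pos(3), rotated]) (use lt in auto)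
  have "((\<lambda>\<epsilon>. (dot3 d d + \<epsilon>) / \<epsilon> ^ 0) \<longlongrightarrow> dot3 d d) (at_right 0)"
    by (auto intro!: tendsto_eq_intros)
  then have nl: "nullity_type ?M {l} = real 0"
    by (rule nullity_type_from_limit[OF _ gm(4) _ pos(4), rotated]) (use lt in auto)
  have mij: "nullity_type ?M {i,j} = real nij"
    by (rule nullity_type_from_limit[OF _ gm(5) Lij]) (use lt in auto)
  have mik: "nullity_type ?M {i,k} = real nik"
    by (rule nullity_type_from_limit[OF _ gm(6) Lik]) (use lt in auto)
  have mjk: "nullity_type ?M {j,k} = real njk"
    by (rule nullity_type_from_limit[OF _ gm(7) Ljk]) (use lt in auto)
  have mil: "nullity_type ?M {i,l} = real nil"
    by (rule nullity_type_from_limit[OF _ gm(8) Lil]) (use lt in auto)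
  have mjl: "nullity_type ?M {j,l} = real njl"
    by (rule nullity_type_from_limit[OF _ gm(9) Ljl]) (use lt in auto)
  have mkl: "nullity_type ?M {k,l} = real nkl"
    by (rule nullity_type_from_limit[OF _ gm(10) Lkl]) (use lt in auto)
  have mijk: "nullity_type ?M {i,j,k} = real nijk"
    by (rule nullity_type_from_limit[OF _ gm(11) Lijk]) (use lt in auto)
  have mijl: "nullity_type ?M {i,j,l} = real nijl"
    by (rule nullity_type_from_limit[OF _ gm(12) Lijl]) (use lt in auto)
  have mikl: "nullity_type ?M {i,k,l} = real nikl"
    by (rule nullity_type_from_limit[OF _ gm(13) Likl]) (use lt in auto)
  have mjkl: "nullity_type ?M {j,k,l} = real njkl"
    by (rule nullity_type_from_limit[OF _ gm(14) Ljkl]) (use lt in auto)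
  have mijkl: "nullity_type ?M {i,j,k,l} = real nijkl"
    by (rule nullity_type_from_limit[OF _ gm(15)[OF _ dd] Lijkl]) (use lt in auto)
  have "0 \<le> (\<Sum>T\<in>Pow {i,j,k,l}. w T * nullity_type ?M T)"
    using nonneg[of ?M] unfolding set_four[OF lt dist] by simp
  also have "nullity_type ?M {} = 0" by (simp add: nullity_type_def)
  then have "(\<Sum>T\<in>Pow {i,j,k,l}. w T * nullity_type ?M T)
      = real nij * w {i,j} + real nik * w {i,k} + real njk * w {j,k} + real nil * w {i,l}
      + real njl * w {j,l} + real nkl * w {k,l} + real nijk * w {i,j,k} + real nijl * w {i,j,l}
      + real nikl * w {i,k,l} + real njkl * w {j,k,l} + real nijkl * w {i,j,k,l}"
    unfolding sum_Pow_four[OF dist] ni nj nk nl mij mik mjk mil mjl mkl mijk mijl mikl mjkl mijkl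
        by simp
  finally show ?thesis .
qed

end

text \<open>This lemma and the next six evaluate the pairing of \<open>w\<close> with the nullity types that occur in
  \<open>near_model\<close>; the vectors realise the configuration, and the limits are the leading coefficients
  of the polynomial determinants.\<close>
lemma parallel_pair_pairing:
  assumes "i < 4" "j < 4" "k < 4" "l < 4" "distinct [i,j,k,l]"
    and "\<And>M. dim_col M = 4 \<Longrightarrow> 0 \<le> (\<Sum>T\<in>Pow {..<4}. w T * nullity_type M T)"
  shows "0 \<le> w {i,j} + w {i,j,k} + w {i,j,l} + w {i,j,k,l}"
proof -
  have "0 \<le> real 1 * w {i,j} + real 0 * w {i,k} + real 0 * w {j,k} + real 0 * w {i,l}
      + real 0 * w {j,l} + real 0 * w {k,l} + real 1 * w {i,j,k} + real 1 * w {i,j,l}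
      + real 0 * w {i,k,l} + real 0 * w {j,k,l} + real 1 * w {i,j,k,l}"
    by (rule config_pairing[OF assms, where a = "[1,0,0]" and b = "[1,0,0]" and c = "[0,1,0]"
        and d = "[0,0,1]"
      and Lij = 2 and Lik = 1 and Ljk = 1 and Lil = 1 and Ljl = 1 and Lkl = 1 and Lijk = 2
          and Lijl = 2 and Likl = 1 and Ljkl = 1 and Lijkl = 2];
      (simp add: dot3_def eval_nat_numeral det4_def;
          fail | (simp add: dot3_def eval_nat_numeral det4_def)?, real_asymp))
  then show ?thesis by simp
qed

lemma parallel_triple_pairing:
  assumes "i < 4" "j < 4" "k < 4" "l < 4" "distinct [i,j,k,l]"
    and "\<And>M. dim_col M = 4 \<Longrightarrow> 0 \<le> (\<Sum>T\<in>Pow {..<4}. w T * nullity_type M T)"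
  shows "0 \<le> w {i,j} + w {i,k} + w {j,k} + 2 * w {i,j,k} + w {i,j,l} + w {i,k,l} + w {j,k,l}
      + 2 * w {i,j,k,l}"
proof -
  have "0 \<le> real 1 * w {i,j} + real 1 * w {i,k} + real 1 * w {j,k} + real 0 * w {i,l}
      + real 0 * w {j,l} + real 0 * w {k,l} + real 2 * w {i,j,k} + real 1 * w {i,j,l}
      + real 1 * w {i,k,l} + real 1 * w {j,k,l} + real 2 * w {i,j,k,l}"
    by (rule config_pairing[OF assms, where a = "[1,0,0]" and b = "[1,0,0]" and c = "[1,0,0]"
        and d = "[0,1,0]"
      and Lij = 2 and Lik = 2 and Ljk = 2 and Lil = 1 and Ljl = 1 and Lkl = 1 and Lijk = 3
          and Lijl = 2 and Likl = 2 and Ljkl = 2 and Lijkl = 3];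
      (simp add: dot3_def eval_nat_numeral det4_def;
          fail | (simp add: dot3_def eval_nat_numeral det4_def)?, real_asymp))
  then show ?thesis by simp
qed

lemma circuit_triple_pairing:
  assumes "i < 4" "j < 4" "k < 4" "l < 4" "distinct [i,j,k,l]"
    and "\<And>M. dim_col M = 4 \<Longrightarrow> 0 \<le> (\<Sum>T\<in>Pow {..<4}. w T * nullity_type M T)"
  shows "0 \<le> w {i,j,k} + w {i,j,k,l}"
proof -
  have "0 \<le> real 0 * w {i,j} + real 0 * w {i,k} + real 0 * w {j,k} + real 0 * w {i,l}
      + real 0 * w {j,l} + real 0 * w {k,l} + real 1 * w {i,j,k} + real 0 * w {i,j,l}
      + real 0 * w {i,k,l} + real 0 * w {j,k,l} + real 1 * w {i,j,k,l}"
    by (rule config_pairing[OF assms, where a = "[1,0,0]" and b = "[0,1,0]" and c = "[1,1,0]"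
        and d = "[0,0,1]"
      and Lij = 1 and Lik = 1 and Ljk = 1 and Lil = 1 and Ljl = 1 and Lkl = 2 and Lijk = 3
          and Lijl = 1 and Likl = 1 and Ljkl = 1 and Lijkl = 3];
      (simp add: dot3_def eval_nat_numeral det4_def;
          fail | (simp add: dot3_def eval_nat_numeral det4_def)?, real_asymp))
  then show ?thesis by simp
qed

lemma rank_one_pairing:
  assumes "i < 4" "j < 4" "k < 4" "l < 4" "distinct [i,j,k,l]"
    and "\<And>M. dim_col M = 4 \<Longrightarrow> 0 \<le> (\<Sum>T\<in>Pow {..<4}. w T * nullity_type M T)"
  shows "0 \<le> w {i,j} + w {i,k} + w {j,k} + w {i,l} + w {j,l} + w {k,l} + 2 * w {i,j,k}
      + 2 * w {i,j,l} + 2 * w {i,k,l} + 2 * w {j,k,l} + 3 * w {i,j,k,l}"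
proof -
  have "0 \<le> real 1 * w {i,j} + real 1 * w {i,k} + real 1 * w {j,k} + real 1 * w {i,l}
      + real 1 * w {j,l} + real 1 * w {k,l} + real 2 * w {i,j,k} + real 2 * w {i,j,l}
      + real 2 * w {i,k,l} + real 2 * w {j,k,l} + real 3 * w {i,j,k,l}"
    by (rule config_pairing[OF assms, where a = "[1,0,0]" and b = "[1,0,0]" and c = "[1,0,0]"
        and d = "[1,0,0]"
      and Lij = 2 and Lik = 2 and Ljk = 2 and Lil = 2 and Ljl = 2 and Lkl = 2 and Lijk = 3
          and Lijl = 3 and Likl = 3 and Ljkl = 3 and Lijkl = 4];
      (simp add: dot3_def eval_nat_numeral det4_def;
          fail | (simp add: dot3_def eval_nat_numeral det4_def)?, real_asymp))
  then show ?thesis by simp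
qed

lemma rank_two_pairing:
  assumes "i < 4" "j < 4" "k < 4" "l < 4" "distinct [i,j,k,l]"
    and "\<And>M. dim_col M = 4 \<Longrightarrow> 0 \<le> (\<Sum>T\<in>Pow {..<4}. w T * nullity_type M T)"
  shows "0 \<le> w {i,j,k} + w {i,j,l} + w {i,k,l} + w {j,k,l} + 2 * w {i,j,k,l}"
proof -
  have "0 \<le> real 0 * w {i,j} + real 0 * w {i,k} + real 0 * w {j,k} + real 0 * w {i,l}
      + real 0 * w {j,l} + real 0 * w {k,l} + real 1 * w {i,j,k} + real 1 * w {i,j,l}
      + real 1 * w {i,k,l} + real 1 * w {j,k,l} + real 2 * w {i,j,k,l}"
    by (rule config_pairing[OF assms, where a = "[1,0,0]" and b = "[0,1,0]" and c = "[1,1,0]"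
        and d = "[1,-1,0]"
      and Lij = 1 and Lik = 1 and Ljk = 1 and Lil = 1 and Ljl = 1 and Lkl = 4 and Lijk = 3
          and Lijl = 3 and Likl = 6 and Ljkl = 6 and Lijkl = 9];
      (simp add: dot3_def eval_nat_numeral det4_def;
          fail | (simp add: dot3_def eval_nat_numeral det4_def)?, real_asymp))
  then show ?thesis by simp
qed

lemma rank_three_pairing:
  assumes "i < 4" "j < 4" "k < 4" "l < 4" "distinct [i,j,k,l]"
    and "\<And>M. dim_col M = 4 \<Longrightarrow> 0 \<le> (\<Sum>T\<in>Pow {..<4}. w T * nullity_type M T)"
  shows "0 \<le> w {i,j,k,l}"
proof -
  have "0 \<le> real 0 * w {i,j} + real 0 * w {i,k} + real 0 * w {j,k} + real 0 * w {i,l}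
      + real 0 * w {j,l} + real 0 * w {k,l} + real 0 * w {i,j,k} + real 0 * w {i,j,l}
      + real 0 * w {i,k,l} + real 0 * w {j,k,l} + real 1 * w {i,j,k,l}"
    by (rule config_pairing[OF assms, where a = "[1,0,0]" and b = "[0,1,0]" and c = "[0,0,1]"
        and d = "[1,1,1]"
      and Lij = 1 and Lik = 1 and Ljk = 1 and Lil = 2 and Ljl = 2 and Lkl = 2 and Lijk = 1
          and Lijl = 1 and Likl = 1 and Ljkl = 1 and Lijkl = 4];
      (simp add: dot3_def eval_nat_numeral det4_def;
          fail | (simp add: dot3_def eval_nat_numeral det4_def)?, real_asymp))
  then show ?thesis by simp
qed

lemma rank_two_pair_pairing:
  assumes "i < 4" "j < 4" "k < 4" "l < 4" "distinct [i,j,k,l]"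
    and "\<And>M. dim_col M = 4 \<Longrightarrow> 0 \<le> (\<Sum>T\<in>Pow {..<4}. w T * nullity_type M T)"
  shows "0 \<le> w {i,j} + w {i,j,k} + w {i,j,l} + w {i,k,l} + w {j,k,l} + 2 * w {i,j,k,l}"
proof -
  have "0 \<le> real 1 * w {i,j} + real 0 * w {i,k} + real 0 * w {j,k} + real 0 * w {i,l}
      + real 0 * w {j,l} + real 0 * w {k,l} + real 1 * w {i,j,k} + real 1 * w {i,j,l}
      + real 1 * w {i,k,l} + real 1 * w {j,k,l} + real 2 * w {i,j,k,l}"
    by (rule config_pairing[OF assms, where a = "[1,0,0]" and b = "[1,0,0]" and c = "[0,1,0]"
        and d = "[1,1,0]"
      and Lij = 2 and Lik = 1 and Ljk = 1 and Lil = 1 and Ljl = 1 and Lkl = 1 and Lijk = 2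
          and Lijl = 2 and Likl = 3 and Ljkl = 3 and Lijkl = 5];
      (simp add: dot3_def eval_nat_numeral det4_def;
          fail | (simp add: dot3_def eval_nat_numeral det4_def)?, real_asymp))
  then show ?thesis by simp
qed

section \<open>A lower bound for pairings with deficits\<close>

text \<open>Each of the twelve sums in the hypotheses is the pairing of \<open>w\<close> with one nullity type. It is
  at most \<open>17 C\<close>, because the entries of a nullity type add up to at most \<open>6 + 2 \<sqdot> 4 + 3 = 17\<close>.
  The twelve coefficients that are at least \<open>-K\<close> and the eleven errors therefore cost at most \<open>12
  \<sqdot> 17 + 11 \<le> 250\<close> times \<open>K C\<close>.\<close>
lemma near_model_lower_bound:
  fixes C :: real
  assumes K: "0 \<le> K" and near: "near_model K gij gik gjk gil gjl gkl gijk gijl gikl gjkl gijkl"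
    and w: "\<bar>wij\<bar> \<le> C" "\<bar>wik\<bar> \<le> C" "\<bar>wjk\<bar> \<le> C" "\<bar>wil\<bar> \<le> C" "\<bar>wjl\<bar> \<le> C" "\<bar>wkl\<bar> \<le> C" "\<bar>wijk\<bar> \<le> C"
        "\<bar>wijl\<bar> \<le> C" "\<bar>wikl\<bar> \<le> C" "\<bar>wjkl\<bar> \<le> C" "\<bar>wijkl\<bar> \<le> C"
    and nonneg: "0 \<le> wij + wik + wjk + wil + wjl + wkl + 2 * wijk + 2 * wijl + 2 * wikl + 2 * wjkl
        + 3 * wijkl"
      "0 \<le> wijk + wijl + wikl + wjkl + 2 * wijkl"
      "0 \<le> wijkl"
      "0 \<le> wij + wijk + wijl + wijkl"
      "0 \<le> wkl + wikl + wjkl + wijkl"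
      "0 \<le> wij + wik + wjk + 2 * wijk + wijl + wikl + wjkl + 2 * wijkl"
      "0 \<le> wijk + wijkl"
      "0 \<le> wijl + wijkl"
      "0 \<le> wikl + wijkl"
      "0 \<le> wjkl + wijkl"
      "0 \<le> wij + wijk + wijl + wikl + wjkl + 2 * wijkl"
      "0 \<le> wkl + wijk + wijl + wikl + wjkl + 2 * wijkl"
  shows "- (250 * (K * C)) \<le> wij * gij + wik * gik + wjk * gjk + wil * gil + wjl * gjl + wkl * gkl
      + wijk * gijk + wijl * gijl + wikl * gikl + wjkl * gjkl + wijkl * gijkl"
proof -
  have product: "w * f - K * C \<le> w * g" if "\<bar>w\<bar> \<le> C" "g \<le> f + K" "f \<le> g + K" for w f g :: real
  proof -
    have "\<bar>w * (f - g)\<bar> \<le> C * K" unfolding abs_mult using that by (intro mult_mono) auto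
    then show ?thesis by (simp add: algebra_simps abs_le_iff)
  qed
  have gen: "- (17 * (K * C)) \<le> x * v" if "- K \<le> x" "0 \<le> v" "v \<le> 17 * C" for x v :: real
  proof -
    have "0 \<le> (x + K) * v" using that by simp
    moreover have "K * v \<le> K * (17 * C)" using that K by (intro mult_left_mono)
    ultimately show ?thesis by (simp add: algebra_simps)
  qed
  obtain u1 u2 u3 pij pkl a cl ck cj ci mij mkl where
    lam: "- K \<le> u1" "- K \<le> u2" "- K \<le> u3" "- K \<le> pij" "- K \<le> pkl" "- K \<le> a" "- K \<le> cl" "- K \<le> ck"
        "- K \<le> cj" "- K \<le> ci" "- K \<le> mij" "- K \<le> mkl" and
    close: "gij \<le> u1 + pij + a + mij + K" "u1 + pij + a + mij \<le> gij + K"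
      "gik \<le> u1 + a + K" "u1 + a \<le> gik + K"
      "gjk \<le> u1 + a + K" "u1 + a \<le> gjk + K"
      "gil \<le> u1 + K" "u1 \<le> gil + K"
      "gjl \<le> u1 + K" "u1 \<le> gjl + K"
      "gkl \<le> u1 + pkl + mkl + K" "u1 + pkl + mkl \<le> gkl + K"
      "gijk \<le> u1 + u1 + u2 + pij + a + a + cl + mij + mkl + K"
          "u1 + u1 + u2 + pij + a + a + cl + mij + mkl \<le> gijk + K"
      "gijl \<le> u1 + u1 + u2 + pij + a + ck + mij + mkl + K"
          "u1 + u1 + u2 + pij + a + ck + mij + mkl \<le> gijl + K"
      "gikl \<le> u1 + u1 + u2 + pkl + a + cj + mij + mkl + K"
          "u1 + u1 + u2 + pkl + a + cj + mij + mkl \<le> gikl + K"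
      "gjkl \<le> u1 + u1 + u2 + pkl + a + ci + mij + mkl + K"
          "u1 + u1 + u2 + pkl + a + ci + mij + mkl \<le> gjkl + K"
      "gijkl \<le> u1 + u1 + u1 + u2 + u2 + u3 + pij + pkl + a + a + cl + ck + cj + ci + mij + mij
          + mkl + mkl + K" "u1 + u1 + u1 + u2 + u2 + u3 + pij + pkl + a + a + cl + ck + cj + ci
          + mij + mij + mkl + mkl \<le> gijkl + K"
    using near unfolding near_model_def by (elim exE conjE) (rule that; assumption)
  define fij where "fij = u1 + pij + a + mij"
  define fik where "fik = u1 + a"
  define fjk where "fjk = u1 + a"
  define fil where "fil = u1"
  define fjl where "fjl = u1"
  define fkl where "fkl = u1 + pkl + mkl"
  define fijk where "fijk = u1 + u1 + u2 + pij + a + a + cl + mij + mkl"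
  define fijl where "fijl = u1 + u1 + u2 + pij + a + ck + mij + mkl"
  define fikl where "fikl = u1 + u1 + u2 + pkl + a + cj + mij + mkl"
  define fjkl where "fjkl = u1 + u1 + u2 + pkl + a + ci + mij + mkl"
  define fijkl where "fijkl = u1 + u1 + u1 + u2 + u2 + u3 + pij + pkl + a + a + cl + ck + cj + ci
      + mij + mij + mkl + mkl"
  note f_defs = fij_def fik_def fjk_def fil_def fjl_def fkl_def fijk_def fijl_def fikl_def
      fjkl_def fijkl_def
  define v0 where "v0 = wij + wik + wjk + wil + wjl + wkl + 2 * wijk + 2 * wijl + 2 * wikl
      + 2 * wjkl + 3 * wijkl"
  define v1 where "v1 = wijk + wijl + wikl + wjkl + 2 * wijkl"
  define v2 where "v2 = wijkl"
  define v3 where "v3 = wij + wijk + wijl + wijkl"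
  define v4 where "v4 = wkl + wikl + wjkl + wijkl"
  define v5 where "v5 = wij + wik + wjk + 2 * wijk + wijl + wikl + wjkl + 2 * wijkl"
  define v6 where "v6 = wijk + wijkl"
  define v7 where "v7 = wijl + wijkl"
  define v8 where "v8 = wikl + wijkl"
  define v9 where "v9 = wjkl + wijkl"
  define v10 where "v10 = wij + wijk + wijl + wikl + wjkl + 2 * wijkl"
  define v11 where "v11 = wkl + wijk + wijl + wikl + wjkl + 2 * wijkl"
  note v_defs = v0_def v1_def v2_def v3_def v4_def v5_def v6_def v7_def v8_def v9_def v10_def
      v11_def
  have small: "v0 \<le> 17 * C" "v1 \<le> 17 * C" "v2 \<le> 17 * C" "v3 \<le> 17 * C" "v4 \<le> 17 * C" "v5 \<le> 17 * C"
      "v6 \<le> 17 * C" "v7 \<le> 17 * C" "v8 \<le> 17 * C" "v9 \<le> 17 * C" "v10 \<le> 17 * C" "v11 \<le> 17 * C"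
    unfolding v_defs using abs_le_D1[OF w(1)] abs_le_D1[OF w(2)] abs_le_D1[OF w(3)] abs_le_D1[OF
        w(4)] abs_le_D1[OF w(5)] abs_le_D1[OF w(6)] abs_le_D1[OF w(7)] abs_le_D1[OF w(8)]
        abs_le_D1[OF w(9)] abs_le_D1[OF w(10)] abs_le_D1[OF w(11)] w(1) by linarith+
  have pos: "0 \<le> v0" "0 \<le> v1" "0 \<le> v2" "0 \<le> v3" "0 \<le> v4" "0 \<le> v5" "0 \<le> v6" "0 \<le> v7" "0 \<le> v8"
      "0 \<le> v9" "0 \<le> v10" "0 \<le> v11"
    unfolding v_defs by (fact nonneg)+
  have "wij * fij + wik * fik + wjk * fjk + wil * fil + wjl * fjl + wkl * fkl + wijk * fijk
      + wijl * fijl + wikl * fikl + wjkl * fjkl + wijkl * fijkl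
      = u1 * v0 + u2 * v1 + u3 * v2 + pij * v3 + pkl * v4 + a * v5 + cl * v6 + ck * v7 + cj * v8
      + ci * v9 + mij * v10 + mkl * v11"
    unfolding f_defs v_defs by (simp add: algebra_simps)
  moreover have "wij * fij - K * C \<le> wij * gij" using product[OF w(1) close(1,2)]
      unfolding fij_def .
  moreover have "wik * fik - K * C \<le> wik * gik" using product[OF w(2) close(3,4)]
      unfolding fik_def .
  moreover have "wjk * fjk - K * C \<le> wjk * gjk" using product[OF w(3) close(5,6)]
      unfolding fjk_def .
  moreover have "wil * fil - K * C \<le> wil * gil" using product[OF w(4) close(7,8)]
      unfolding fil_def .
  moreover have "wjl * fjl - K * C \<le> wjl * gjl" using product[OF w(5) close(9,10)]
      unfolding fjl_def .
  moreover have "wkl * fkl - K * C \<le> wkl * gkl" using product[OF w(6) close(11,12)]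
      unfolding fkl_def .
  moreover have "wijk * fijk - K * C \<le> wijk * gijk" using product[OF w(7) close(13,14)]
      unfolding fijk_def .
  moreover have "wijl * fijl - K * C \<le> wijl * gijl" using product[OF w(8) close(15,16)]
      unfolding fijl_def .
  moreover have "wikl * fikl - K * C \<le> wikl * gikl" using product[OF w(9) close(17,18)]
      unfolding fikl_def .
  moreover have "wjkl * fjkl - K * C \<le> wjkl * gjkl" using product[OF w(10) close(19,20)]
      unfolding fjkl_def .
  moreover have "wijkl * fijkl - K * C \<le> wijkl * gijkl" using product[OF w(11) close(21,22)]
      unfolding fijkl_def .
  moreover note gen[OF lam(1) pos(1) small(1)]
  moreover note gen[OF lam(2) pos(2) small(2)]
  moreover note gen[OF lam(3) pos(3) small(3)]
  moreover note gen[OF lam(4) pos(4) small(4)]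
  moreover note gen[OF lam(5) pos(5) small(5)]
  moreover note gen[OF lam(6) pos(6) small(6)]
  moreover note gen[OF lam(7) pos(7) small(7)]
  moreover note gen[OF lam(8) pos(8) small(8)]
  moreover note gen[OF lam(9) pos(9) small(9)]
  moreover note gen[OF lam(10) pos(10) small(10)]
  moreover note gen[OF lam(11) pos(11) small(11)]
  moreover note gen[OF lam(12) pos(12) small(12)]
  moreover have "0 \<le> K * C" using K w(1) by (intro mult_nonneg_nonneg) auto
  ultimately show ?thesis by argo
qed

text \<open>The first pair is a maximal one; the second condition chooses the maximum of the other five,
  which either is the complementary pair or meets the first one, and then the indices are
  renamed.\<close>
lemma exists_max_pair:
  fixes g :: "nat set \<Rightarrow> real"
  shows "\<exists>i j k l. i < 4 \<and> j < 4 \<and> k < 4 \<and> l < 4 \<and> distinct [i,j,k,l] \<and>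
    g {i,k} \<le> g {i,j} \<and> g {j,k} \<le> g {i,j} \<and> g {i,l} \<le> g {i,j} \<and> g {j,l} \<le> g {i,j} \<and>
    ((\<forall>S\<in>{{j,k},{i,l},{j,l},{k,l}}. g S \<le> g {i,k}) \<or>
        (\<forall>S\<in>{{i,k},{j,k},{i,l},{j,l}}. g S \<le> g {k,l}))"
proof -
  let ?P = "{(i,j). i < 4 \<and> j < 4 \<and> i \<noteq> (j::nat)}"
  have fin: "finite ?P" by (rule finite_subset[of _ "{..<4} \<times> {..<4}"]) auto
  have "(0,1) \<in> ?P" by simp
  then have "(\<lambda>(i,j). g {i,j}) ` ?P \<noteq> {}" by blast
  then have "Max ((\<lambda>(i,j). g {i,j}) ` ?P) \<in> (\<lambda>(i,j). g {i,j}) ` ?P" using fin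
      by (intro Max_in) auto
  then obtain i j where ij: "i < 4" "j < 4" "i \<noteq> j"
      and m: "g {i,j} = Max ((\<lambda>(i,j). g {i,j}) ` ?P)" by auto
  have max: "g {a,b} \<le> g {i,j}" if "a < 4" "b < 4" "a \<noteq> b" for a b
    unfolding m using that fin by (intro Max_ge) auto
  have "card ({..<4} - {i,j}) = 2" using ij by (subst card_Diff_subset) auto
  then obtain k l where "{..<4} - {i,j} = {k,l}" "k \<noteq> l" by (auto simp: card_2_iff)
  then have kl: "k < 4" "l < 4" "distinct [i,j,k,l]" using ij by auto
  have c: "{j,i} = {i,j}" "{l,k} = {k,l}" by auto
  have ds: "distinct [j,i,k,l]" "distinct [i,j,l,k]" "distinct [j,i,l,k]" using kl by auto
  have dd: "i \<noteq> k" "i \<noteq> l" "j \<noteq> k" "j \<noteq> l" using kl(3) by auto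
  note mx = max[OF ij(1) kl(1) dd(1)] max[OF ij(1) kl(2) dd(2)] max[OF ij(2) kl(1) dd(3)] max[OF
      ij(2) kl(2) dd(4)]
  have found: ?thesis if "i' < 4" "j' < 4" "k' < 4" "l' < 4" "distinct [i',j',k',l']"
      "g {i',k'} \<le> g {i',j'}" "g {j',k'} \<le> g {i',j'}" "g {i',l'} \<le> g {i',j'}"
          "g {j',l'} \<le> g {i',j'}"
      "(\<forall>S\<in>{{j',k'},{i',l'},{j',l'},{k',l'}}. g S \<le> g {i',k'}) \<or>
          (\<forall>S\<in>{{i',k'},{j',k'},{i',l'},{j',l'}}. g S \<le> g {k',l'})"
    for i' j' k' l'
    by (rule exI[of _ i'], rule exI[of _ j'], rule exI[of _ k'],
        rule exI[of _ l'], intro conjI; fact)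
  have "(\<forall>S\<in>{{j,k},{i,l},{j,l},{k,l}}. g S \<le> g {i,k}) \<or>
      (\<forall>S\<in>{{i,k},{j,k},{i,l},{j,l}}. g S \<le> g {k,l}) \<or>
      (\<forall>S\<in>{{i,k},{j,l},{i,l},{k,l}}. g S \<le> g {j,k}) \<or>
          (\<forall>S\<in>{{j,l},{i,k},{j,k},{k,l}}. g S \<le> g {i,l}) \<or>
      (\<forall>S\<in>{{i,l},{j,k},{i,k},{k,l}}. g S \<le> g {j,l})"
    by (simp only: ball_simps simp_thms) argo
  then show ?thesis
    using found[OF ij(1,2) kl mx(1,3,2,4)]
      found[OF ij(2,1) kl(1,2) ds(1), unfolded c, OF mx(3,1,4,2)]
      found[OF ij(1,2) kl(2,1) ds(2), unfolded c, OF mx(2,4,1,3)]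
      found[OF ij(2,1) kl(2,1) ds(3), unfolded c, OF mx(4,2,3,1)]
    by argo
qed

lemma principal_minor_empty [simp]: "principal_minor A {} = 1"
  unfolding principal_minor_def by (subst det_dim_zero) (auto simp: dim_submatrix)

lemma log_minor_empty [simp]: "log_minor A {} = 0"
  by (simp add: log_minor_def)

text \<open>The constant \<open>7500 = 250 \<sqdot> 30\<close> does not depend on \<open>A\<close>.\<close>
lemma pairing_deficit_lower_bound:
  fixes w :: "nat set \<Rightarrow> real"
  assumes nonneg: "\<And>M. dim_col M = 4 \<Longrightarrow> 0 \<le> (\<Sum>T\<in>Pow {..<4}. w T * nullity_type M T)"
    and pd: "pos_def_mat 4 A"
  shows "- (7500 * (ln 4 * (\<Sum>T\<in>Pow {..<4}. \<bar>w T\<bar>))) \<le> (\<Sum>T\<in>Pow {..<4}. w T * deficit A T)"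
proof -
  obtain i j k l where lt: "i < 4" "j < 4" "k < 4" "l < 4" and d: "distinct [i,j,k,l]"
    and ord: "deficit A {i,k} \<le> deficit A {i,j}" "deficit A {j,k} \<le> deficit A {i,j}"
      "deficit A {i,l} \<le> deficit A {i,j}" "deficit A {j,l} \<le> deficit A {i,j}"
    and shape: "(\<forall>S\<in>{{j,k},{i,l},{j,l},{k,l}}. deficit A S \<le> deficit A {i,k}) \<or>
      (\<forall>S\<in>{{i,k},{j,k},{i,l},{j,l}}. deficit A S \<le> deficit A {k,l})"
    using exists_max_pair[of "deficit A"] by auto
  note near = near_model_deficit[OF pd lt d ord shape]
  define C where "C = (\<Sum>T\<in>Pow {..<4::nat}. \<bar>w T\<bar>)"
  have C: "\<bar>w T\<bar> \<le> C" if "T \<subseteq> {..<4}" for T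
    unfolding C_def using that by (intro member_le_sum) auto
  have d': "distinct [k,l,i,j]" "distinct [i,j,l,k]" "distinct [i,k,l,j]" "distinct [j,k,l,i]"
      using d by auto
  have c: "{k,i} = {i,k}" "{k,j} = {j,k}" "{l,i} = {i,l}" "{l,j} = {j,l}" "{l,k} = {k,l}"
      "{j,i} = {i,j}" "{k,l,i} = {i,k,l}" "{k,l,j} = {j,k,l}"
     "{k,i,j} = {i,j,k}" "{l,i,j} = {i,j,l}" "{k,l,i,j} = {i,j,k,l}" "{i,j,l,k} = {i,j,k,l}"
         "{i,l,k} = {i,k,l}" "{j,l,k} = {j,k,l}"
     "{i,k,j} = {i,j,k}" "{i,l,j} = {i,j,l}" "{k,l,j} = {j,k,l}" "{i,k,l,j} = {i,j,k,l}"
     "{j,k,i} = {i,j,k}" "{j,l,i} = {i,j,l}" "{j,k,l,i} = {i,j,k,l}"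
     "{k,i,j,l} = {i,j,k,l}" "{l,i,j,k} = {i,j,k,l}" "{j,i,k,l} = {i,j,k,l}" "{j,i,k} = {i,j,k}"
         "{j,i,l} = {i,j,l}" "{k,i,l} = {i,k,l}" "{k,j,l} = {j,k,l}" by auto
  have "- (250 * (30 * ln 4 * C)) \<le> w {i,j} * deficit A {i,j} + w {i,k} * deficit A {i,k}
      + w {j,k} * deficit A {j,k}
    + w {i,l} * deficit A {i,l} + w {j,l} * deficit A {j,l} + w {k,l} * deficit A {k,l}
        + w {i,j,k} * deficit A {i,j,k}
    + w {i,j,l} * deficit A {i,j,l} + w {i,k,l} * deficit A {i,k,l}
        + w {j,k,l} * deficit A {j,k,l} + w {i,j,k,l} * deficit A {i,j,k,l}"
  proof (rule near_model_lower_bound[OF _ near])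
    note g1 = rank_one_pairing[OF lt d nonneg] rank_two_pairing[OF lt d nonneg]
        rank_three_pairing[OF lt d nonneg]
      parallel_pair_pairing[OF lt d nonneg] parallel_pair_pairing[OF lt(3,4,1,2) d'(1) nonneg]
      parallel_triple_pairing[OF lt d nonneg]
      circuit_triple_pairing[OF lt d nonneg] circuit_triple_pairing[OF lt(1,2,4,3) d'(2) nonneg]
      circuit_triple_pairing[OF lt(1,3,4,2) d'(3) nonneg] circuit_triple_pairing[OF lt(2,3,4,1)
          d'(4) nonneg]
      rank_two_pair_pairing[OF lt d nonneg] rank_two_pair_pairing[OF lt(3,4,1,2) d'(1) nonneg]
    note g = g1[unfolded c]
    show "0 \<le> w {i,j} + w {i,k} + w {j,k} + w {i,l} + w {j,l} + w {k,l} + 2 * w {i,j,k}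
        + 2 * w {i,j,l} + 2 * w {i,k,l} + 2 * w {j,k,l}
        + 3 * w {i,j,k,l}" using g(1) by (simp add: algebra_simps)
    show "0 \<le> w {i,j,k} + w {i,j,l} + w {i,k,l} + w {j,k,l} + 2 * w {i,j,k,l}" using g(2)
        by (simp add: algebra_simps)
    show "0 \<le> w {i,j,k,l}" using g(3) by (simp add: algebra_simps)
    show "0 \<le> w {i,j} + w {i,j,k} + w {i,j,l} + w {i,j,k,l}" using g(4)
        by (simp add: algebra_simps)
    show "0 \<le> w {k,l} + w {i,k,l} + w {j,k,l} + w {i,j,k,l}" using g(5)
        by (simp add: algebra_simps)
    show "0 \<le> w {i,j} + w {i,k} + w {j,k} + 2 * w {i,j,k} + w {i,j,l} + w {i,k,l} + w {j,k,l}
        + 2 * w {i,j,k,l}" using g(6) by (simp add: algebra_simps)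
    show "0 \<le> w {i,j,k} + w {i,j,k,l}" using g(7) by (simp add: algebra_simps)
    show "0 \<le> w {i,j,l} + w {i,j,k,l}" using g(8) by (simp add: algebra_simps)
    show "0 \<le> w {i,k,l} + w {i,j,k,l}" using g(9) by (simp add: algebra_simps)
    show "0 \<le> w {j,k,l} + w {i,j,k,l}" using g(10) by (simp add: algebra_simps)
    show "0 \<le> w {i,j} + w {i,j,k} + w {i,j,l} + w {i,k,l} + w {j,k,l} + 2 * w {i,j,k,l}"
        using g(11) by (simp add: algebra_simps)
    show "0 \<le> w {k,l} + w {i,j,k} + w {i,j,l} + w {i,k,l} + w {j,k,l} + 2 * w {i,j,k,l}"
        using g(12) by (simp add: algebra_simps)
  qed (use lt in \<open>auto intro!: C\<close>)
  also have "\<dots> = (\<Sum>T\<in>Pow {..<4}. w T * deficit A T)"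
    unfolding set_four[OF lt d] sum_Pow_four[OF d]
        by (simp add: deficit_simps(1)[OF pd] deficit_def[of A "{}"])
  finally show ?thesis by (simp add: C_def mult.assoc)
qed

lemma sum_Pow_swap:
  fixes w :: "nat set \<Rightarrow> real"
  shows "(\<Sum>S\<in>Pow {..<n}. w S * (\<Sum>i\<in>S. x i)) = (\<Sum>i<n. x i * (\<Sum>S | S \<subseteq> {..<n} \<and> i \<in> S. w S))"
proof -
  have "(\<Sum>S\<in>Pow {..<n}. w S * (\<Sum>i\<in>S. x i)) = (\<Sum>S\<in>Pow {..<n}. \<Sum>i<n. if i \<in> S then w S * x i else
      0)"
    by (intro sum.cong refl) (auto simp: sum_distrib_left sum.If_cases Int_absorb1 intro!:
        sum.cong)
  also have "\<dots> = (\<Sum>i<n. \<Sum>S\<in>Pow {..<n}. if i \<in> S then w S * x i else 0)" by (rule sum.swap)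
  also have "\<dots> = (\<Sum>i<n. x i * (\<Sum>S | S \<subseteq> {..<n} \<and> i \<in> S. w S))"
    by (intro sum.cong refl) (auto simp: sum.If_cases sum_distrib_left Collect_conj_eq Pow_def
        mult.commute intro!: sum.cong)
  finally show ?thesis .
qed

section \<open>Bounded ratios and nullity types\<close>

lemma product_value_eq_exp:
  assumes pd: "pos_def_mat n A" and \<alpha>: "\<alpha> \<in> minor_products n"
  shows "product_value \<alpha> A = exp (\<Sum>S\<in>Pow {..<n}. total_exponent \<alpha> S * log_minor A S)"
  using \<alpha>
proof (induction \<alpha>)
  case Nil
  show ?case by (simp add: product_value_def total_exponent_def)
next
  case (Cons x \<alpha>)
  obtain S \<eta> where x: "x = (S, \<eta>)" by force
  have S: "S \<subseteq> {..<n}" and \<alpha>: "\<alpha> \<in> minor_products n" using Cons.prems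
      by (auto simp: x minor_products_def)
  have "principal_minor A S powr \<eta> = exp (\<eta> * log_minor A S)"
    using principal_minor_pos[OF pd S] by (simp add: powr_def log_minor_def)
  moreover have "(\<Sum>T\<in>Pow {..<n}. total_exponent (x # \<alpha>) T * log_minor A T)
      = \<eta> * log_minor A S + (\<Sum>T\<in>Pow {..<n}. total_exponent \<alpha> T * log_minor A T)"
  proof -
    have "(\<Sum>T\<in>Pow {..<n}. (if S = T then \<eta> else 0) * log_minor A T) = (\<Sum>T\<in>Pow {..<n}. if S
        = T then \<eta> * log_minor A T else 0)"
      by (intro sum.cong) auto
    also have "\<dots> = \<eta> * log_minor A S" using S by (subst sum.delta') auto
    finally show ?thesis by (simp add: total_exponent_def x distrib_right sum.distrib)
  qed
  ultimately show ?case using Cons.IH[OF \<alpha>] by (simp add: product_value_def x exp_add)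
qed

lemma ratio_value_eq_exp:
  assumes pd: "pos_def_mat n A" and r: "r \<in> ratios n"
  shows "ratio_value r A = exp (\<Sum>S\<in>Pow {..<n}. formal_log n r S * log_minor A S)"
proof -
  have "ratio_value r A = exp (\<Sum>S\<in>Pow {..<n}. net_exponent r S * log_minor A S)"
    using r product_value_eq_exp[OF pd, of "fst r"] product_value_eq_exp[OF pd, of "snd r"]
    by (auto simp: ratios_def ratio_value_def net_exponent_def exp_diff left_diff_distrib
        sum_subtractf)
  also have "(\<Sum>S\<in>Pow {..<n}. net_exponent r S * log_minor A S)
      = (\<Sum>S\<in>Pow {..<n}. formal_log n r S * log_minor A S)"
    by (intro sum.cong refl) (simp add: formal_log_def)
  finally show ?thesis .
qed

text \<open>The degree of the ratio in the scaling of row and column \<open>i\<close>.\<close>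
definition singleton_weight :: "nat \<Rightarrow> ratio \<Rightarrow> nat \<Rightarrow> real" where
  "singleton_weight n r i = (\<Sum>S | S \<subseteq> {..<n} \<and> i \<in> S. formal_log n r S)"

lemma diagonal_log_minor:
  assumes pd: "pos_def_mat n D" and diag: "diagonal_mat D" and S: "S \<subseteq> {..<n}"
  shows "log_minor D S = (\<Sum>i\<in>S. log_minor D {i})"
proof -
  have D: "D \<in> carrier_mat n n" and adj: "mat_adjoint D = D" using pd
      by (auto simp: pos_def_mat_def)
  have fin: "finite S" using S finite_subset by auto
  have re: "D $$ (a, a) = complex_of_real (Re (D $$ (a, a)))" if "a < n" for a
    using mat_adjoint_eqD[OF D adj that that] by (metis Reals_cnj_iff of_real_Re)
  obtain xs where xs: "set xs = S" "distinct xs" using finite_distinct_list[OF fin] by blast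
  let ?k = "length xs"
  let ?B = "mat ?k ?k (\<lambda>(a, b). D $$ (xs ! a, xs ! b))"
  have lt: "xs ! a < n" if "a < ?k" for a using that xs(1) S nth_mem by blast
  have "upper_triangular ?B"
  proof (rule upper_triangularI)
    fix a b assume "b < a" "a < dim_row ?B"
    then show "?B $$ (a, b) = 0"
      using diag D lt xs(2) unfolding diagonal_mat_def by (auto simp: nth_eq_iff_index_eq)
  qed
  then have "det ?B = prod_list (diag_mat ?B)" by (rule det_upper_triangular[of _ ?k]) simp
  also have "diag_mat ?B = map (\<lambda>i. complex_of_real (Re (D $$ (i, i)))) xs"
    by (rule nth_equalityI) (simp_all add: diag_mat_def re[symmetric] lt)
  also have "prod_list \<dots> = complex_of_real (\<Prod>i\<leftarrow>xs. Re (D $$ (i, i)))" by (induction xs) auto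
  finally have "principal_minor D S = (\<Prod>i\<leftarrow>xs. Re (D $$ (i, i)))"
    using principal_minor_reindex[OF D, of xs] xs S by simp
  also have "\<dots> = (\<Prod>i\<in>S. Re (D $$ (i, i)))" using xs by (metis prod.distinct_set_conv_list)
  also have "\<dots> = (\<Prod>i\<in>S. principal_minor D {i})"
    using S by (intro prod.cong refl) (auto simp: hermitian_minors(1)[OF D adj])
  finally have "principal_minor D S = (\<Prod>i\<in>S. principal_minor D {i})" .
  moreover have "principal_minor D {i} > 0" if "i \<in> S" for i
    using that S by (intro principal_minor_pos[OF pd]) auto
  then have "ln (\<Prod>i\<in>S. principal_minor D {i}) = (\<Sum>i\<in>S. ln (principal_minor D {i}))"
      by (intro ln_prod fin) (simp add: less_imp_neq[symmetric])
  ultimately show ?thesis unfolding log_minor_def by simp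
qed

lemma scaling_mat:
  fixes t :: real
  assumes "i < n"
  obtains D where "pos_def_mat n D" "diagonal_mat D"
      "\<And>j. j < n \<Longrightarrow> log_minor D {j} = (if j = i then t else 0)"
proof
  define d :: "nat \<Rightarrow> real" where "d a = (if a = i then exp t else 1)" for a
  define D where "D = mat n n (\<lambda>(a, b). if a = b then complex_of_real (d a) else 0)"
  have D: "D \<in> carrier_mat n n" by (simp add: D_def)
  have dpos: "d a > 0" for a by (simp add: d_def)
  have adj: "mat_adjoint D = D" by (rule mat_adjoint_eqI[OF D]) (auto simp: D_def)
  show "pos_def_mat n D"
    unfolding pos_def_mat_def
  proof (intro conjI ballI impI D adj)
    fix v :: "complex vec" assume v: "v \<in> carrier_vec n" "v \<noteq> 0\<^sub>v n"
    have "(D *\<^sub>v v) \<bullet>c v = (\<Sum>a<n. (\<Sum>b<n. D $$ (a, b) * v $ b) * cnj (v $ a))"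
        by (rule quadratic_form_expand[OF D v(1)])
    also have "\<dots> = (\<Sum>a<n. complex_of_real (d a * (cmod (v $ a))\<^sup>2))"
    proof (intro sum.cong refl)
      fix a assume a: "a \<in> {..<n}"
      have "(\<Sum>b<n. D $$ (a, b) * v $ b) = (\<Sum>b<n. if a
          = b then complex_of_real (d a) * v $ b else 0)"
        using a by (intro sum.cong) (auto simp: D_def)
      also have "\<dots> = complex_of_real (d a) * v $ a" using a by simp
      finally show "(\<Sum>b<n. D $$ (a, b) * v $ b) * cnj (v $ a)
          = complex_of_real (d a * (cmod (v $ a))\<^sup>2)"
        by (simp add: complex_norm_square mult.assoc del: of_real_power)
    qed
    also have "\<dots> = complex_of_real (\<Sum>a<n. d a * (cmod (v $ a))\<^sup>2)" by simp
    finally have "Re ((D *\<^sub>v v) \<bullet>c v) = (\<Sum>a<n. d a * (cmod (v $ a))\<^sup>2)"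
        by (simp only: Re_complex_of_real)
    moreover obtain a where "a < n" "v $ a \<noteq> 0" using v
        by (metis eq_vecI carrier_vecD index_zero_vec)
    then have "(\<Sum>a<n. d a * (cmod (v $ a))\<^sup>2) > 0"
      using dpos[of a] by (intro sum_pos2[of _ a]) (auto intro!: mult_nonneg_nonneg less_imp_le[OF
          dpos])
    ultimately show "Re ((D *\<^sub>v v) \<bullet>c v) > 0" by simp
  qed
  show "diagonal_mat D" by (auto simp: diagonal_mat_def D_def)
  show "log_minor D {j} = (if j = i then t else 0)" if "j < n" for j
  proof -
    have "D $$ (j, j) = complex_of_real (d j)" using that by (simp add: D_def)
    then show ?thesis by (simp add: log_minor_def hermitian_minors(1)[OF D adj that] d_def)
  qed
qed

lemma ratio_value_diagonal:
  assumes r: "r \<in> ratios n" and pd: "pos_def_mat n D" and diag: "diagonal_mat D"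
  shows "ratio_value r D = exp (\<Sum>i<n. log_minor D {i} * singleton_weight n r i)"
proof -
  have "(\<Sum>S\<in>Pow {..<n}. formal_log n r S * log_minor D S)
      = (\<Sum>S\<in>Pow {..<n}. formal_log n r S * (\<Sum>i\<in>S. log_minor D {i}))"
    using diagonal_log_minor[OF pd diag] by (intro sum.cong refl) auto
  then show ?thesis
    unfolding ratio_value_eq_exp[OF pd r] sum_Pow_swap singleton_weight_def by simp
qed

text \<open>Along these matrices a ratio is an exponential in \<open>t\<close>, so it is bounded above for all \<open>t\<close>
  only if it is constant.\<close>
lemma ratio_value_scaling:
  assumes r: "r \<in> ratios n" and i: "i < n"
  obtains D where "pos_def_mat n D" "diagonal_mat D"
      "ratio_value r D = exp (t * singleton_weight n r i)"
proof -
  obtain D where D: "pos_def_mat n D" "diagonal_mat D"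
      and l: "\<And>j. j < n \<Longrightarrow> log_minor D {j} = (if j = i then t else 0)"
    using scaling_mat[OF i, of t] by metis
  have "(\<Sum>j<n. log_minor D {j} * singleton_weight n r j) = (\<Sum>j<n. if j
      = i then t * singleton_weight n r j else 0)"
    by (intro sum.cong) (auto simp: l)
  also have "\<dots> = t * singleton_weight n r i" using i by simp
  finally show ?thesis using that[OF D] ratio_value_diagonal[OF r D] by simp
qed

lemma homogeneous_ratio_iff:
  assumes r: "r \<in> ratios n"
  shows "homogeneous_ratio n r \<longleftrightarrow> (\<forall>i<n. singleton_weight n r i = 0)"
proof
  assume h: "homogeneous_ratio n r"
  show "\<forall>i<n. singleton_weight n r i = 0"
  proof (intro allI impI)
    fix i assume "i < n"
    then obtain D where "pos_def_mat n D" "diagonal_mat D"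
        "ratio_value r D = exp (1 * singleton_weight n r i)"
      using ratio_value_scaling[OF r] by blast
    then show "singleton_weight n r i = 0" using h by (simp add: homogeneous_ratio_def)
  qed
qed (simp add: homogeneous_ratio_def ratio_value_diagonal[OF r])

lemma bounded_imp_homogeneous:
  assumes r: "r \<in> ratios n" and b: "bounded_ratio n r"
  shows "homogeneous_ratio n r"
  unfolding homogeneous_ratio_iff[OF r]
proof (intro allI impI, rule ccontr)
  fix i assume i: "i < n" and s: "singleton_weight n r i \<noteq> 0"
  obtain C where C: "\<And>A. pos_def_mat n A \<Longrightarrow> ratio_value r A \<le> C" using b
      by (auto simp: bounded_ratio_def)
  obtain D where "pos_def_mat n D" "ratio_value r D
      = exp (C / singleton_weight n r i * singleton_weight n r i)"
    using ratio_value_scaling[OF r i] by blast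
  then have "exp C \<le> C" using C s by fastforce
  then show False using exp_ge_add_one_self[of C] by linarith
qed

text \<open>By \<open>principal_minor_gram_mat\<close> the logarithm of the ratio at \<open>M\<^sup>*M + \<epsilon>I\<close> is \<open>ln \<epsilon>\<close> times the
  sum in question, up to a convergent term.\<close>
lemma bounded_imp_nullity:
  assumes r: "r \<in> ratios n" and b: "bounded_ratio n r" and M: "dim_col M = n"
  shows "0 \<le> (\<Sum>T\<in>Pow {..<n}. formal_log n r T * nullity_type M T)"
proof (rule ccontr)
  let ?s = "\<Sum>T\<in>Pow {..<n}. formal_log n r T * nullity_type M T"
  assume "\<not> 0 \<le> ?s"
  then have s: "?s < 0" by simp
  have "\<exists>c. ((\<lambda>\<epsilon>. log_minor (gram_mat M \<epsilon>) T - nullity_type M T * ln \<epsilon>) \<longlongrightarrow> c) (at_right 0)"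
      if T: "T \<in> Pow {..<n}" for T
  proof -
    have T': "T \<subseteq> {..<dim_col M}" using T M by simp
    obtain k es where k: "nullity_type M T = real k" and es: "\<forall>e\<in>set es. e > 0"
      and m: "\<And>\<epsilon>. principal_minor (gram_mat M \<epsilon>) T = \<epsilon> ^ k * (\<Prod>e\<leftarrow>es. e + \<epsilon>)"
      using principal_minor_gram_mat[OF T'] by metis
    have pos: "(\<Prod>e\<leftarrow>es. e + \<epsilon>) > 0" if "\<epsilon> \<ge> 0" for \<epsilon> using es that
        by (induction es) (auto intro: add_pos_nonneg)
    have "((\<lambda>\<epsilon>::real. \<Prod>e\<leftarrow>es. e + \<epsilon>) \<longlongrightarrow> (\<Prod>e\<leftarrow>es. e + 0)) (at_right 0)"
      by (induction es) (auto intro!: tendsto_eq_intros)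
    then have "((\<lambda>\<epsilon>::real. ln (\<Prod>e\<leftarrow>es. e + \<epsilon>)) \<longlongrightarrow> ln (\<Prod>e\<leftarrow>es. e + 0)) (at_right 0)"
      by (rule tendsto_ln) (use pos[of 0] in linarith)
    then have "((\<lambda>\<epsilon>. log_minor (gram_mat M \<epsilon>) T - nullity_type M T * ln \<epsilon>) \<longlongrightarrow> ln (\<Prod>e\<leftarrow>es. e
        + 0)) (at_right 0)"
    proof (rule Lim_transform_eventually)
      show "\<forall>\<^sub>F \<epsilon> in at_right 0. ln (\<Prod>e\<leftarrow>es. e + \<epsilon>)
          = log_minor (gram_mat M \<epsilon>) T - nullity_type M T * ln \<epsilon>"
      proof (rule eventually_mono[OF eventually_at_right_less])
        fix \<epsilon> :: real assume e: "0 < \<epsilon>"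
        have "ln (\<epsilon> ^ k * (\<Prod>e\<leftarrow>es. e + \<epsilon>)) = real k * ln \<epsilon> + ln (\<Prod>e\<leftarrow>es. e + \<epsilon>)"
          using e pos[of \<epsilon>] by (subst ln_mult_pos) (auto simp: ln_realpow)
        then show "ln (\<Prod>e\<leftarrow>es. e + \<epsilon>) = log_minor (gram_mat M \<epsilon>) T - nullity_type M T * ln \<epsilon>"
          by (simp add: log_minor_def m k)
      qed
    qed
    then show ?thesis by blast
  qed
  then obtain c where c: "\<And>T. T \<in> Pow {..<n} \<Longrightarrow>
      ((\<lambda>\<epsilon>. log_minor (gram_mat M \<epsilon>) T - nullity_type M T * ln \<epsilon>) \<longlongrightarrow> c T) (at_right 0)" by metis
  have "((\<lambda>\<epsilon>. \<Sum>T\<in>Pow {..<n}. formal_log n r T * (log_minor (gram_mat M \<epsilon>) T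
      - nullity_type M T * ln \<epsilon>))
      \<longlongrightarrow> (\<Sum>T\<in>Pow {..<n}. formal_log n r T * c T)) (at_right 0)"
    by (intro tendsto_sum tendsto_mult tendsto_const c)
  moreover have "filterlim (\<lambda>\<epsilon>. c * ln \<epsilon>) at_top (at_right 0)" if "c < 0" for c :: real
    using that by real_asymp
  note this[OF s]
  ultimately have "filterlim (\<lambda>\<epsilon>. (\<Sum>T\<in>Pow {..<n}. formal_log n r T * (log_minor (gram_mat M \<epsilon>) T
      - nullity_type M T * ln \<epsilon>)) + ?s * ln \<epsilon>)
      at_top (at_right 0)"
    by (rule filterlim_tendsto_add_at_top)
  moreover have "(\<Sum>T\<in>Pow {..<n}. formal_log n r T * (log_minor (gram_mat M \<epsilon>) T
      - nullity_type M T * ln \<epsilon>)) + ?s * ln \<epsilon>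
      = (\<Sum>T\<in>Pow {..<n}. formal_log n r T * log_minor (gram_mat M \<epsilon>) T)" for \<epsilon>
    by (simp add: right_diff_distrib sum_subtractf sum_distrib_right mult.assoc)
  ultimately have lim: "filterlim (\<lambda>\<epsilon>. \<Sum>T\<in>Pow {..<n}. formal_log n r T * log_minor (gram_mat M \<epsilon>)
      T) at_top (at_right 0)"
    by simp
  obtain C where C: "\<And>A. pos_def_mat n A \<Longrightarrow> ratio_value r A \<le> C" using b
      by (auto simp: bounded_ratio_def)
  have "eventually (\<lambda>\<epsilon>. C \<le> (\<Sum>T\<in>Pow {..<n}. formal_log n r T * log_minor (gram_mat M \<epsilon>) T))
      (at_right 0)"
    using lim by (simp add: filterlim_at_top)
  then have "eventually (\<lambda>\<epsilon>::real. False) (at_right 0)"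
    using eventually_at_right_less
  proof eventually_elim
    case (elim \<epsilon>)
    have pd: "pos_def_mat n (gram_mat M \<epsilon>)" using gram_mat_pos_def[OF elim(2), of M] M by simp
    have "exp C \<le> ratio_value r (gram_mat M \<epsilon>)" using elim(1)
        by (simp add: ratio_value_eq_exp[OF pd r])
    then have "exp C \<le> C" using C[OF pd] by linarith
    then show ?case using exp_ge_add_one_self[of C] by linarith
  qed
  then show False by simp
qed

text \<open>Homogeneity makes the formal logarithm orthogonal to the modular part of \<open>log_minor\<close>, so
  only the deficit remains.\<close>
lemma nullity_imp_bounded_4:
  assumes r: "r \<in> ratios 4" and h: "homogeneous_ratio 4 r"
    and nonneg: "\<And>M. dim_col M = 4 \<Longrightarrow> 0 \<le> (\<Sum>T\<in>Pow {..<4}. formal_log 4 r T * nullity_type M T)"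
  shows "bounded_ratio 4 r"
  unfolding bounded_ratio_def
proof (intro exI allI impI)
  fix A assume pd: "pos_def_mat 4 A"
  let ?w = "formal_log 4 r"
  have "(\<Sum>S\<in>Pow {..<4}. ?w S * log_minor A S)
      = (\<Sum>S\<in>Pow {..<4}. ?w S * (\<Sum>i\<in>S. log_minor A {i})) - (\<Sum>S\<in>Pow {..<4}. ?w S * deficit A S)"
    by (simp add: deficit_def right_diff_distrib sum_subtractf)
  also have "(\<Sum>S\<in>Pow {..<4}. ?w S * (\<Sum>i\<in>S. log_minor A {i})) = 0"
    using h unfolding homogeneous_ratio_iff[OF r] singleton_weight_def sum_Pow_swap by simp
  finally have "(\<Sum>S\<in>Pow {..<4}. ?w S * log_minor A S) \<le> 7500 * (ln 4 * (\<Sum>T\<in>Pow {..<4}. \<bar>?w T\<bar>))"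
    using pairing_deficit_lower_bound[OF nonneg pd] by linarith
  then show "ratio_value r A \<le> exp (7500 * (ln 4 * (\<Sum>T\<in>Pow {..<4}. \<bar>?w T\<bar>)))"
    by (simp add: ratio_value_eq_exp[OF pd r])
qed

lemma \<B>_eq_\<D>: "\<B> 4 = \<D> 4"
proof -
  have "{r \<in> ratios 4. bounded_ratio 4 r} = {r \<in> ratios 4. homogeneous_ratio 4 r \<and>
     (\<forall>M. dim_col M = 4 \<longrightarrow> (\<Sum>T\<in>Pow {..<4}. formal_log 4 r T * nullity_type M T) \<ge> 0)}"
    using bounded_imp_homogeneous bounded_imp_nullity nullity_imp_bounded_4 by auto
  then show ?thesis unfolding \<B>_def \<D>_def by simp
qed

section \<open>Ratios separating the three sets\<close>

text \<open>Membership of a class in a quotient only provides some representative with the same formal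
  logarithm.\<close>
lemma same_ratio_representative:
  assumes r: "r \<in> ratios n" and eq: "X // same_ratio n = Y // same_ratio n" and "r \<in> X"
  obtains s where "s \<in> Y" "s \<in> ratios n" "\<And>S. S \<subseteq> {..<n} \<Longrightarrow> formal_log n s S = formal_log n r S"
proof -
  have "same_ratio n `` {r} \<in> Y // same_ratio n" using eq \<open>r \<in> X\<close> by (metis quotientI)
  then obtain s where s: "s \<in> Y" "same_ratio n `` {r} = same_ratio n `` {s}"
      by (auto elim: quotientE)
  have "(r, r) \<in> same_ratio n" using r by (simp add: same_ratio_def)
  then have "(s, r) \<in> same_ratio n" using s(2) by blast
  then show ?thesis using s(1) by (intro that[of s]) (auto simp: same_ratio_def)
qed

text \<open>Ingleton's inequality for ranks of vector subspaces, written multiplicatively in principal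
  minors.\<close>
definition ingleton_ratio :: ratio where
  "ingleton_ratio =
    ([({0,1}, 1), ({0,2,3}, 1), ({1,2,3}, 1), ({2}, 1), ({3}, 1)],
     [({0,2}, 1), ({0,3}, 1), ({1,2}, 1), ({1,3}, 1), ({2,3}, 1)])"

lemma ingleton_ratio: "ingleton_ratio \<in> ratios 4"
  by (auto simp: ingleton_ratio_def ratios_def minor_products_def)

lemma ingleton_ratio_value:
  assumes pd: "pos_def_mat 4 A"
  shows "ratio_value ingleton_ratio A =
    principal_minor A {0,1} * principal_minor A {0,2,3} * principal_minor A {1,2,3} *
        principal_minor A {2} * principal_minor A {3} /
    (principal_minor A {0,2} * principal_minor A {0,3} * principal_minor A {1,2} * principal_minor
        A {1,3} * principal_minor A {2,3})"
proof -
  have "principal_minor A S powr 1 = principal_minor A S" if "S \<subseteq> {..<4}" for S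
    using principal_minor_pos[OF pd that] by simp
  then show ?thesis
    by (simp add: ingleton_ratio_def ratio_value_def product_value_def mult.assoc)
qed

lemma ingleton_ratio_bounded: "bounded_ratio 4 ingleton_ratio"
  unfolding bounded_ratio_def
proof (intro exI allI impI)
  fix A assume pd: "pos_def_mat 4 A"
  let ?g = "deficit A"
  have lt: "(0::nat) < 4" "(1::nat) < 4" "(2::nat) < 4" "(3::nat) < 4" by simp_all
  have c: "{2,0} = {0,2::nat}" "{3,0} = {0,3::nat}" "{2,1} = {1,2::nat}" "{3,1} = {1,3::nat}"
      "{3,2} = {2,3::nat}"
    "{2,3,0} = {0,2,3::nat}" "{2,3,1} = {1,2,3::nat}" "{0,3,2} = {0,2,3::nat}"
        "{1,3,2} = {1,2,3::nat}" by auto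
  note sub = deficit_ineqs3(2)[OF pd lt(1,3,4)] deficit_ineqs3(2)[OF pd lt(2,3,4)]
      deficit_ineqs3(2)[OF pd lt(3,4,1)]
    deficit_ineqs3(2)[OF pd lt(3,4,2)] deficit_ineqs3(2)[OF pd lt(1,4,3)] deficit_ineqs3(2)[OF pd
        lt(2,4,3)]
  note ult = deficit_ultra3[OF pd lt(1,2,3)] deficit_ultra3[OF pd lt(1,2,4)] deficit_ultra3[OF pd
      lt(1,3,4)] deficit_ultra3[OF pd lt(2,3,4)]
  have "- (2 * ln 4) \<le> ?g {0,1} + ?g {0,2,3} + ?g {1,2,3} - ?g {0,2} - ?g {0,3} - ?g {1,2}
      - ?g {1,3} - ?g {2,3}"
    using sub ult unfolding c almost_ultrametric_def by (simp add: min_def) argo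
  moreover have "ln (ratio_value ingleton_ratio A)
      = ?g {0,2} + ?g {0,3} + ?g {1,2} + ?g {1,3} + ?g {2,3} - ?g {0,1} - ?g {0,2,3} - ?g {1,2,3}"
  proof -
    have "principal_minor A S > 0" if "S \<subseteq> {..<4}" for S using principal_minor_pos[OF pd that] .
    then have "principal_minor A S \<noteq> 0" "principal_minor A S > 0" if "S \<subseteq> {..<4}" for S using that
        by (auto simp: less_le)
    then have "ln (ratio_value ingleton_ratio A)
        = log_minor A {0,1} + log_minor A {0,2,3} + log_minor A {1,2,3} + log_minor A {2}
        + log_minor A {3}
       - (log_minor A {0,2} + log_minor A {0,3} + log_minor A {1,2} + log_minor A {1,3}
           + log_minor A {2,3})"
      unfolding ingleton_ratio_value[OF pd] log_minor_def by (simp add: ln_div ln_mult)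
    then show ?thesis by (simp add: deficit_def)
  qed
  ultimately have "ln (ratio_value ingleton_ratio A) \<le> 2 * ln 4" by linarith
  moreover have "ratio_value ingleton_ratio A > 0"
      by (simp add: ratio_value_eq_exp[OF pd ingleton_ratio])
  ultimately show "ratio_value ingleton_ratio A \<le> exp (2 * ln 4)"
      by (metis exp_le_cancel_iff exp_ln)
qed

text \<open>The matrix is \<open>M\<^sup>*M + I\<close> with rows \<open>(2, 0, 1, 1)\<close>, \<open>(0, 2, 1, 1)\<close>, \<open>(1, 1, 4, 1)\<close>, \<open>(1, 1, 1,
  4)\<close>.\<close>
lemma ingleton_ratio_not_absolutely_bounded: "\<exists>A. pos_def_mat 4 A \<and>
    ratio_value ingleton_ratio A > 1"
proof -
  let ?M = "config_mat 0 1 2 [0,0,-1] [1,0,0] [1,1,-1] [1,-1,-1]"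
  let ?A = "gram_mat ?M 1"
  have pd: "pos_def_mat 4 ?A" using gram_mat_pos_def[of 1 ?M] by simp
  have lt: "(0::nat) < 4" "(1::nat) < 4" "(2::nat) < 4" "(3::nat) < 4" "distinct [0,1,2,3::nat]"
      by simp_all
  note m = gram_config_minors[OF lt, where \<epsilon> = 1 and a = "[0,0,-1]" and b = "[1,0,0]"
      and c = "[1,1,-1]" and d = "[1,-1,-1]"]
  have "ratio_value ingleton_ratio ?A = 36864 / 36015"
    unfolding ingleton_ratio_value[OF pd] m by (simp add: dot3_def eval_nat_numeral)
  then show ?thesis using pd by (intro exI[of _ ?A]) simp
qed

lemma \<A>_neq_\<B>: "\<A> 4 \<noteq> \<B> 4"
proof
  assume "\<A> 4 = \<B> 4"
  then obtain s where s: "s \<in> ratios 4" "absolutely_bounded_ratio 4 s"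
    and fl: "\<And>S. S \<subseteq> {..<4} \<Longrightarrow> formal_log 4 s S = formal_log 4 ingleton_ratio S"
    using same_ratio_representative[OF ingleton_ratio, of "{r \<in> ratios 4. bounded_ratio 4 r}" "{r
        \<in> ratios 4. absolutely_bounded_ratio 4 r}"]
      ingleton_ratio ingleton_ratio_bounded unfolding \<A>_def \<B>_def
          by (metis (no_types, lifting) mem_Collect_eq)
  obtain A where A: "pos_def_mat 4 A" "ratio_value ingleton_ratio A > 1"
      using ingleton_ratio_not_absolutely_bounded by blast
  have "ratio_value s A = ratio_value ingleton_ratio A"
    unfolding ratio_value_eq_exp[OF A(1) s(1)] ratio_value_eq_exp[OF A(1) ingleton_ratio]
    by (intro arg_cong[where f = exp] sum.cong) (auto simp: fl)
  then show False using s(2) A by (fastforce simp: absolutely_bounded_ratio_def)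
qed

definition alternating_ratio :: ratio where
  "alternating_ratio =
    ([({0,1}, 1), ({0,2}, 1), ({0,3}, 1), ({1,2}, 1), ({1,3}, 1), ({2,3}, 1), ({0,1,2,3}, 1)],
     [({0}, 1), ({1}, 1), ({2}, 1), ({3}, 1), ({0,1,2}, 1), ({0,1,3}, 1), ({0,2,3}, 1), ({1,2,3},
         1)])"

lemma alternating_ratio: "alternating_ratio \<in> ratios 4"
  by (auto simp: alternating_ratio_def ratios_def minor_products_def)

lemma lessThan_4: "{..<4} = {0,1,2,3::nat}" by auto

lemma ball_Pow_4: "(\<forall>S\<subseteq>{0,1,2,3::nat}. P S) \<longleftrightarrow> P {} \<and> P {0} \<and> P {1} \<and> P {2} \<and> P {3} \<and> P {0,1} \<and>
    P {0,2} \<and> P {1,2} \<and> P {0,3} \<and> P {1,3} \<and> P {2,3}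
    \<and> P {0,1,2} \<and> P {0,1,3} \<and> P {0,2,3} \<and> P {1,2,3} \<and> P {0,1,2,3}" (is "?l \<longleftrightarrow> ?r")
proof
  assume ?r
  show ?l
  proof (intro allI impI)
    fix S assume "S \<subseteq> {0,1,2,3::nat}"
    then have "S \<in> Pow {0,1,2,3}" by simp
    then show "P S" using \<open>?r\<close> unfolding Pow_insert Pow_empty by auto
  qed
qed auto

text \<open>Adding or removing a fixed element of \<open>A\<close> is a sign-reversing involution on the subsets.\<close>
lemma sum_Pow_alternating:
  fixes A :: "nat set"
  assumes "finite A"
  shows "(\<Sum>T\<in>Pow A. (-1::real) ^ card T) = (if A = {} then 1 else 0)"
proof (cases "A = {}")
  case False
  then obtain a B where A: "A = insert a B" "a \<notin> B" by (meson Set.set_insert all_not_in_conv)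
  then have B: "finite B" using assms by simp
  have "(\<Sum>T\<in>Pow A. (-1::real) ^ card T) = (\<Sum>T\<in>Pow B. (-1) ^ card T)
      + (\<Sum>T\<in>Pow B. (-1) ^ card (insert a T))"
    unfolding A(1) by (rule sum_Pow_insert[OF B A(2)])
  also have "(\<Sum>T\<in>Pow B. (-1::real) ^ card (insert a T)) = (\<Sum>T\<in>Pow B. - ((-1) ^ card T))"
    using A(2) B by (intro sum.cong refl) (auto simp: card_insert_if finite_subset)
  finally show ?thesis using False by (simp add: sum_negf)
qed simp

lemma formal_log_alternating:
  assumes "S \<subseteq> {..<4}"
  shows "formal_log 4 alternating_ratio S = (-1) ^ card S"
proof -
  have net: "\<forall>S\<subseteq>{0,1,2,3}. net_exponent alternating_ratio S = (if S
      = {} then 0 else (-1) ^ card S)"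
    unfolding ball_Pow_4 net_exponent_def total_exponent_def alternating_ratio_def
        by (simp add: set_eq_subset del: subset_empty)
  have "(\<Sum>T\<in>Pow {..<4::nat}. (-1::real) ^ card T)
      = (-1) ^ card ({} :: nat set) + (\<Sum>T\<in>Pow {..<4::nat} - {{}}. (-1) ^ card T)"
    by (rule sum.remove) simp_all
  then have "(\<Sum>T\<in>Pow {..<4::nat} - {{}}. (-1::real) ^ card T) = -1"
    by (simp add: sum_Pow_alternating lessThan_empty_iff)
  moreover have "(\<Sum>T\<in>Pow {..<4} - {{}}. net_exponent alternating_ratio T)
      = (\<Sum>T\<in>Pow {..<4::nat} - {{}}. (-1::real) ^ card T)"
    by (rule sum.cong[OF refl]) (simp add: net[folded lessThan_4])
  ultimately show ?thesis using net[folded lessThan_4] assms by (simp add: formal_log_def)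
qed

text \<open>Taking complements in a set of even size preserves the sign and turns the sums of (ST1) into
  those of (ST2).\<close>
lemma alternating_ratio_ST: "ST1 4 alternating_ratio" "ST2 4 alternating_ratio"
proof -
  show "ST2 4 alternating_ratio"
    unfolding ST2_def
  proof (intro allI impI)
    fix S assume S: "S \<subseteq> {..<4::nat}"
    have "(\<Sum>T\<in>Pow S. formal_log 4 alternating_ratio T) = (\<Sum>T\<in>Pow S. (-1) ^ card T)"
      using S by (intro sum.cong refl formal_log_alternating) auto
    then show "0 \<le> (\<Sum>T\<in>Pow S. formal_log 4 alternating_ratio T)"
      using finite_subset[OF S] by (simp add: sum_Pow_alternating)
  qed
  show "ST1 4 alternating_ratio"
    unfolding ST1_def
  proof (intro allI impI)
    fix S assume S: "S \<subseteq> {..<4::nat}"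
    have "(\<Sum>T | S \<subseteq> T \<and> T \<subseteq> {..<4}. formal_log 4 alternating_ratio T)
        = (\<Sum>U\<in>Pow ({..<4} - S). (-1) ^ card U)"
    proof (rule sum.reindex_bij_witness[where i = "\<lambda>U. {..<4} - U" and j = "\<lambda>T. {..<4} - T"])
      fix T assume T: "T \<in> {T. S \<subseteq> T \<and> T \<subseteq> {..<4}}"
      have c: "card ({..<4} - T) = 4 - card T" using T
          by (subst card_Diff_subset) (auto intro: finite_subset)
      have "card T \<le> 4" using T card_mono[of "{..<4}" T] by simp
      then have "(-1::real) ^ card ({..<4} - T) = (-1) ^ card T" unfolding c
        by (simp add: minus_one_power_iff)
      then show "(-1) ^ card ({..<4} - T) = formal_log 4 alternating_ratio T" using T
          by (simp add: formal_log_alternating)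
    qed (use S in auto)
    then show "0 \<le> (\<Sum>T | S \<subseteq> T \<and> T \<subseteq> {..<4}. formal_log 4 alternating_ratio T)"
      by (simp add: sum_Pow_alternating)
  qed
qed

lemma \<D>_neq_\<E>: "\<D> 4 \<noteq> \<E> 4"
proof
  let ?D = "{r \<in> ratios 4. homogeneous_ratio 4 r \<and>
     (\<forall>M. dim_col M = 4 \<longrightarrow> (\<Sum>T\<in>Pow {..<4}. formal_log 4 r T * nullity_type M T) \<ge> 0)}"
  let ?E = "{r \<in> ratios 4. ST1 4 r \<and> ST2 4 r}"
  assume "\<D> 4 = \<E> 4"
  then have eq: "?E // same_ratio 4 = ?D // same_ratio 4" unfolding \<D>_def \<E>_def by simp
  have mem: "alternating_ratio \<in> ?E" using alternating_ratio alternating_ratio_ST by simp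
  obtain s where s: "s \<in> ?D" and fl: "\<And>S. S \<subseteq> {..<4} \<Longrightarrow>
      formal_log 4 s S = formal_log 4 alternating_ratio S"
    by (rule same_ratio_representative[OF alternating_ratio eq mem]) (rule that)
  have "\<forall>M. dim_col M = 4 \<longrightarrow> (\<Sum>T\<in>Pow {..<4}. formal_log 4 s T * nullity_type M T) \<ge> 0"
    using s by (elim CollectE conjE)
  note n = this[rule_format]
  have "0 \<le> formal_log 4 s {0,1,2} + formal_log 4 s {0,1,3} + formal_log 4 s {0,2,3}
      + formal_log 4 s {1,2,3} + 2 * formal_log 4 s {0,1,2,3}"
    by (rule rank_two_pairing[OF _ _ _ _ _ n]) simp_all
  then show False by (simp add: fl formal_log_alternating)
qed

theorem mainTheorem5:
  shows "\<A> 4 \<noteq> \<B> 4 \<and> \<B> 4 = \<D> 4 \<and> \<D> 4 \<noteq> \<E> 4"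
  using \<A>_neq_\<B> \<B>_eq_\<D> \<D>_neq_\<E> by blast

end
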